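(* There is a real number $r_0$ with decimal expansion $r_0 = 0.695356\ldots$ (i.e. $0.695356\le r_0<0.695357$) such that every finite Blaschke product $B$ satisfies $$\|B\|_{\mathbb{B}} \ge r_0 .$$ Conversely, for any real $k > 2/e = 0.73575\ldots$ there exists a finite Blaschke product $B$ for which $\|B\|_{\mathbb{B}} \le k$.
   Context: $\mathbb{D}=\{z\in\mathbb{C}:|z|<1\}$. A finite Blaschke product is a function of the form $$B(z)=\prod_{j=1}^n\frac{z-z_j}{1-\overline{z_j}z},\qquad |z_j|<1,\ n\ge 1.$$ For $f$ analytic in $\mathbb{D}$, its Bloch seminorm is $\|f\|_{\mathbb{B}}:=\sup_{z\in\mathbb{D}}|f'(z)|(1-|z|^2)$. *)

theory Defs
  imports "HOL-Analysis.Analysis"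
begin

(* B is a total function on the complex plane. Its poles 1 / cnj (a j), for a j nonzero,
   all lie outside the closed unit disc; division returns 0 there. There is no unimodular
   constant factor, and n = 0 is excluded. *)
definition finite_Blaschke_product :: "(complex \<Rightarrow> complex) \<Rightarrow> bool" where
  "finite_Blaschke_product B \<longleftrightarrow>
     (\<exists>(n::nat) a. n \<ge> 1 \<and> (\<forall>j\<in>{1..n}. cmod (a j) < 1) \<and>
        B = (\<lambda>z. \<Prod>j=1..n. (z - a j) / (1 - cnj (a j) * z)))"

(* Meant for f analytic on the open unit disc. The supremum is taken in the extended
   reals, so that it is infinite, not unspecified, when f is not a Bloch function. *)
definition Bloch_seminorm :: "(complex \<Rightarrow> complex) \<Rightarrow> ereal" where
  "Bloch_seminorm f = (SUP z\<in>ball 0 1. ereal (cmod (deriv f z) * (1 - (cmod z)\<^sup>2)))"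

end

theory Submission
  imports Defs "HOL-Complex_Analysis.Complex_Analysis" "HOL-Computational_Algebra.Fundamental_Theorem_Algebra"
begin

text \<open>
  Upper bound: \<open>z ^ n\<close> has Bloch seminorm tending to \<open>2 / e\<close>.

  Lower bound. If \<open>F\<close> is a holomorphic lift of an explicit map \<open>\<psi>\<close> through \<open>B\<close>, i.e. \<open>B \<circ> F = \<psi>\<close>,
  then Schwarz--Pick for \<open>F\<close> turns the size of \<open>\<psi>'\<close> into a lower bound for \<open>|B'| (1 - |z|\<^sup>2)\<close>; so one needs
  inverse branches of \<open>B\<close> on large domains. Cut the disc along the radial rays that start at the branch
  values. This gives \<open>n\<close> sheets, and by Riemann--Hurwitz the hypergraph recording which sheets are joined at
  which points over the branch values has the edge count of a tree. Hence there is a leaf, a sheet whose inverse branch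
  needs only one cut \<open>[b, b / |b|)\<close>. If \<open>|b| \<ge> 1/49\<close>, the disc minus that cut is large enough. If all
  leaves have \<open>|b| < 1/49\<close>, a second leaf count (after pruning the leaves) yields a leaf that, on one
  of the two sides of its cut, continues through its neighbour to a further half-turn over \<open>1/49 < |w| < 1\<close>;
  lifted by \<open>w = \<zeta>\<^sup>2\<close> this is a half-disc with most of a third quadrant attached.
  The argument needs branch values on distinct rays from a non-critical value \<open>0\<close>; this is arranged by
  composing \<open>B\<close> with a Moebius map close to the identity, which changes the seminorm little.
\<close>

text \<open>A leaf by itself falls just short. If its slit starts at the centre, lifting
  \<open>t^2\<close> from the half-disc gives at best 4 (3 - 2 sqrt 2) = 0.6863, below 0.695356. The
  loss disappears once the tip of the slit is far enough from the centre, hence a threshold for the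
  tip; below it, extra room has to be found on a second sheet. The gain is limited to a half-turn
  because the count leaves the neighbour one ray that may lead to an uncontrolled sheet. Its
  direction is unknown, but it misses the half-turn on one of the two sides of the cut. Every other
  ray met there leads to a leaf, whose only cut is the one just crossed, so the continuation is
  never stopped again. The annulus \<open>1/49 < |w| < 1\<close> keeps the path beyond the tips of
  the rays that it crosses. The hypergraph has the zeros of \<open>B\<close> as vertices (one per
  sheet) and the points over branch values as hyperedges. Its count rests on the bound
  \<open>n - 1\<close> for the critical points in the disc, proved algebraically: the numerator of
  the derivative is a self-inversive polynomial of degree at most \<open>2 (n - 1)\<close>, so at
  most half of its roots lie inside.\<close>

section \<open>Upper bound from the powers of z\<close>

lemma mult_exp_minus_le: "t * exp (- t) \<le> exp (- 1 :: real)"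
proof -
  have "t \<le> exp (t - 1)" using exp_ge_add_one_self[of "t - 1"] by simp
  then have "t * exp (- t) \<le> exp (t - 1) * exp (- t)" by (rule mult_right_mono) simp
  then show ?thesis by (simp flip: exp_add)
qed

text \<open>With \<open>y = 1 - r^2\<close>, the inequality \<open>1 - y \<le> exp (- y)\<close>
  turns the expression into a multiple of \<open>t exp (- t)\<close> at
  \<open>t = (n - 1) y / 2\<close>, and this is largest at \<open>t = 1\<close>.\<close>

lemma power_Bloch_bound:
  fixes r :: real
  assumes "2 \<le> n" "0 \<le> r" "r < 1"
  shows "of_nat n * r ^ (n - 1) * (1 - r\<^sup>2) \<le> 2 / exp 1 * (real n / (real n - 1))"
proof -
  define y where "y = 1 - r\<^sup>2"
  define m where "m = real (n - 1)"
  have m: "m > 0" "real n - 1 = m" using assms by (auto simp: m_def)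
  have "y \<ge> 0" using assms by (simp add: y_def abs_square_le_1)
  have "r\<^sup>2 \<le> exp (- y)" using exp_ge_add_one_self[of "- y"] by (simp add: y_def)
  also have "\<dots> = (exp (- y / 2))\<^sup>2" by (simp flip: exp_double)
  finally have "r \<le> exp (- y / 2)" by (rule power2_le_imp_le) simp
  then have "r ^ (n - 1) \<le> exp (- y / 2) ^ (n - 1)" using assms by (intro power_mono) auto
  also have "\<dots> = exp (- (m * y / 2))" by (simp add: m_def flip: exp_of_nat_mult)
  finally have "n * r ^ (n - 1) * y \<le> n * exp (- (m * y / 2)) * y"
    using \<open>y \<ge> 0\<close> by (intro mult_right_mono mult_left_mono) auto
  also have "\<dots> = (2 * n / m) * ((m * y / 2) * exp (- (m * y / 2)))" using m by simp
  also have "\<dots> \<le> (2 * n / m) * exp (- 1)"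
    using m by (intro mult_left_mono mult_exp_minus_le) auto
  also have "\<dots> = 2 / exp 1 * (real n / (real n - 1))" using m by (simp add: exp_minus field_simps)
  finally show ?thesis by (simp add: y_def)
qed

lemma Blaschke_power:
  assumes "n \<ge> 1" shows "finite_Blaschke_product (\<lambda>z. z ^ n)"
  unfolding finite_Blaschke_product_def
  by (rule exI[of _ n], rule exI[of _ "\<lambda>_. 0"]) (use assms in auto)

lemma Bloch_seminorm_power:
  assumes "2 \<le> n"
  shows "Bloch_seminorm (\<lambda>z. z ^ n) \<le> ereal (2 / exp 1 * (real n / (real n - 1)))"
  unfolding Bloch_seminorm_def
proof (rule SUP_least)
  fix z :: complex assume z: "z \<in> ball 0 1"
  have "deriv (\<lambda>z. z ^ n) z = of_nat n * z ^ (n - 1)"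
    by (rule DERIV_imp_deriv) (auto intro!: derivative_eq_intros)
  then show "ereal (cmod (deriv (\<lambda>z. z ^ n) z) * (1 - (cmod z)\<^sup>2)) \<le> ereal (2 / exp 1 * (real n / (real n - 1)))"
    using power_Bloch_bound[OF assms, of "cmod z"] z by (simp add: norm_mult norm_power)
qed

lemma Blaschke_upper:
  fixes k :: real
  assumes "k > 2 / exp 1"
  shows "\<exists>B. finite_Blaschke_product B \<and> Bloch_seminorm B \<le> ereal k"
proof -
  have "(\<lambda>n. 2 / exp 1 * (real n / (real n - 1))) \<longlonglongrightarrow> 2 / exp 1 * 1"
    by (intro tendsto_mult tendsto_const) real_asymp
  then have "eventually (\<lambda>n. 2 / exp 1 * (real n / (real n - 1)) < k) sequentially"
    using assms by (intro order_tendstoD(2)) auto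
  then obtain n where n: "n \<ge> 2" "2 / exp 1 * (real n / (real n - 1)) < k"
    using eventually_conj[OF _ eventually_ge_at_top[of 2]] eventually_happens'[OF sequentially_bot]
    by (metis (mono_tags, lifting) eventually_sequentially linorder_le_cases nle_le)
  have "Bloch_seminorm (\<lambda>z. z ^ n) \<le> ereal k"
    using Bloch_seminorm_power[OF n(1)] n(2) by (metis ereal_less_eq(3) less_imp_le order_trans)
  then show ?thesis using Blaschke_power[of n] n(1) by (intro exI[of _ "\<lambda>z. z ^ n"]) auto
qed

lemma two_over_e_bounds: "0.73575 \<le> 2 / exp (1::real)" "2 / exp (1::real) < 0.73576"
proof -
  have "\<bar>exp 1 - 5837465777 / 2147483648\<bar> \<le> (1 / 4294967296 :: real)"
    using e_approx_32 by simp
  then have "exp 1 \<le> (5837465777 / 2147483648 + 1 / 4294967296 :: real)"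
    "exp 1 \<ge> (5837465777 / 2147483648 - 1 / 4294967296 :: real)"
    by linarith+
  then show "0.73575 \<le> 2 / exp (1::real)" "2 / exp (1::real) < 0.73576"
    by (simp_all add: divide_le_eq le_divide_eq divide_less_eq less_divide_eq)
qed

subsection \<open>Schwarz--Pick estimates\<close>

text \<open>Schwarz's lemma applied after the disc automorphism that moves \<open>f 0\<close> to the
  origin.\<close>

lemma Schwarz_Pick_at_0:
  assumes "f holomorphic_on ball 0 1" and "\<And>z. cmod z < 1 \<Longrightarrow> cmod (f z) < 1"
  shows "cmod (deriv f 0) \<le> 1 - (cmod (f 0))\<^sup>2"
proof -
  define a where "a = f 0"
  have a: "cmod a < 1" using assms(2)[of 0] by (simp add: a_def)
  have nz: "1 - cnj a * w \<noteq> 0" if "cmod w < 1" for w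
  proof
    assume "1 - cnj a * w = 0"
    then have "cmod (cnj a * w) = 1" by (metis norm_one eq_iff_diff_eq_0)
    moreover have "cmod a * cmod w < 1" using a that by (metis mult_strict_mono' norm_ge_zero mult_1)
    ultimately show False by (simp add: norm_mult)
  qed
  define h where "h = (\<lambda>z. (f z - a) / (1 - cnj a * f z))"
  have holh: "h holomorphic_on ball 0 1"
    unfolding h_def using assms nz by (auto intro!: holomorphic_intros)
  have h1: "cmod (h z) < 1" if "cmod z < 1" for z
    using Moebius_function_norm_lt_1[OF a assms(2)[OF that], of 0] 
    by (simp add: Moebius_function_def h_def)
  have "cmod (deriv h 0) \<le> 1"
    using Schwarz_Lemma(2)[OF holh _ h1, of 0] by (auto simp: h_def a_def)
  moreover have "deriv h 0 = deriv f 0 / (1 - cnj a * a)"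
  proof -
    have "(f has_field_derivative deriv f 0) (at 0)"
      using assms(1) by (auto intro!: holomorphic_derivI)
    then have "(h has_field_derivative ((deriv f 0 * (1 - cnj a * a) - (a - a) * (- (cnj a * deriv f 0)))
        / ((1 - cnj a * a) * (1 - cnj a * a)))) (at 0)"
      using nz[OF a] unfolding h_def a_def
      by (intro DERIV_divide derivative_eq_intros) (auto simp: algebra_simps)
    then show ?thesis using nz[OF a] by (simp add: DERIV_imp_deriv)
  qed
  moreover have eq: "cmod (1 - cnj a * a) = 1 - (cmod a)\<^sup>2"
  proof -
    have "1 - cnj a * a = complex_of_real (1 - (cmod a)\<^sup>2)"
      by (metis complex_norm_square mult.commute of_real_1 of_real_diff)
    then show ?thesis using a by (simp add: abs_square_le_1 del: of_real_diff)
  qed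
  moreover have "1 - (cmod a)\<^sup>2 > 0" using a by (simp add: abs_square_less_1)
  ultimately have "cmod (deriv f 0) / (1 - (cmod a)\<^sup>2) \<le> 1" "1 - (cmod a)\<^sup>2 > 0"
    by (metis norm_divide)+
  then show ?thesis by (simp add: a_def)
qed

lemma Schwarz_Pick_half_plane:
  assumes "F holomorphic_on {v. Im v > 0}" and "\<And>v. Im v > 0 \<Longrightarrow> cmod (F v) < 1" and "Im v0 > 0"
  shows "cmod (deriv F v0) * (2 * Im v0) \<le> 1 - (cmod (F v0))\<^sup>2"
proof -
  \<comment> \<open>A Cayley transform from the disc onto the upper half-plane with
    \<open>m 0 = v0\<close> and derivative \<open>2 i Im v0\<close> at the origin.\<close>
  define m where "m = (\<lambda>z. (v0 - cnj v0 * z) / (1 - z))"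
  have nz: "1 - z \<noteq> 0" if "cmod z < 1" for z using that by auto
  have Im: "Im (m z) > 0" if "cmod z < 1" for z
  proof -
    have "m z = (v0 - cnj v0 * z) * cnj (1 - z) / of_real ((cmod (1 - z))\<^sup>2)"
      unfolding m_def using nz[OF that]
      by (metis complex_div_cnj)
    then have "Im (m z) = Im ((v0 - cnj v0 * z) * cnj (1 - z)) / (cmod (1 - z))\<^sup>2"
      by (simp only: Im_divide_of_real)
    also have "Im ((v0 - cnj v0 * z) * cnj (1 - z)) = Im v0 * (1 - (cmod z)\<^sup>2)"
      unfolding cmod_power2 by (simp add: algebra_simps power2_eq_square)
    finally show ?thesis using nz[OF that] that assms(3)
      by (simp add: abs_square_less_1)
  qed
  have hm: "m holomorphic_on ball 0 1" unfolding m_def by (auto intro!: holomorphic_intros)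
  have "(F \<circ> m) holomorphic_on ball 0 1"
    using hm assms(1) Im by (auto intro!: holomorphic_on_compose_gen)
  then have *: "cmod (deriv (F \<circ> m) 0) \<le> 1 - (cmod ((F \<circ> m) 0))\<^sup>2"
    using Im assms(2) by (intro Schwarz_Pick_at_0) auto
  have op: "open {v. Im v > 0}" by (rule open_halfspace_Im_gt)
  have dm: "(m has_field_derivative (2 * \<i> * Im v0)) (at 0)"
    unfolding m_def by (auto intro!: derivative_eq_intros simp: complex_eq_iff)
  have "(F has_field_derivative deriv F v0) (at (m 0))"
    using holomorphic_derivI[OF assms(1) op] assms(3) by (simp add: m_def)
  then have "(F \<circ> m has_field_derivative (deriv F v0 * (2 * \<i> * Im v0))) (at 0)"
    using dm by (rule DERIV_chain)
  then show ?thesis using * assms(3) by (simp add: DERIV_imp_deriv norm_mult m_def)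
qed

definition half_disc :: "complex set" where
  "half_disc = {t. cmod t < 1 \<and> Im t > 0}"

lemma open_half_disc: "open half_disc"
proof -
  have "half_disc = ball 0 1 \<inter> {t. Im t > 0}" by (auto simp: half_disc_def)
  then show ?thesis using open_Int[OF open_ball open_halfspace_Im_gt] by metis
qed

text \<open>The map \<open>(1 + t) / (1 - t)\<close> takes the half-disc to a quadrant, and squaring
  takes the quadrant to the upper half-plane; \<open>E\<close> is the inverse of the composite. The
  factor on the left is the reciprocal of the hyperbolic density of the half-disc.\<close>

lemma Schwarz_Pick_half_disc:
  assumes F: "F holomorphic_on half_disc" and F1: "\<And>t. t \<in> half_disc \<Longrightarrow> cmod (F t) < 1"
    and t0: "t0 \<in> half_disc"
  shows "cmod (deriv F t0) * (2 * Im t0 * (1 - (cmod t0)\<^sup>2) / cmod (1 - t0\<^sup>2)) \<le> 1 - (cmod (F t0))\<^sup>2"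
proof -
  define s where "s = (1 + t0) / (1 - t0)"
  define E where "E = (\<lambda>v. (csqrt v - 1) / (csqrt v + 1))"
  have t1: "cmod t0 < 1" "Im t0 > 0" using t0 by (auto simp: half_disc_def)
  then have ne: "t0 \<noteq> 1" "t0 \<noteq> -1" by auto
  have s_cart: "s = of_real ((1 - (cmod t0)\<^sup>2) / (cmod (1 - t0))\<^sup>2) + \<i> * of_real (2 * Im t0 / (cmod (1 - t0))\<^sup>2)"
  proof -
    have "s = (1 + t0) * cnj (1 - t0) / of_real ((cmod (1 - t0))\<^sup>2)"
      unfolding s_def using ne by (metis complex_div_cnj)
    also have "(1 + t0) * cnj (1 - t0) = of_real (1 - (cmod t0)\<^sup>2) + \<i> * of_real (2 * Im t0)"
      unfolding cmod_power2 by (simp add: complex_eq_iff algebra_simps power2_eq_square)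
    finally show ?thesis by (simp add: add_divide_distrib)
  qed
  have pos: "(cmod (1 - t0))\<^sup>2 > 0" using ne by auto
  have Res: "Re s > 0" and Ims: "Im s > 0"
    unfolding s_cart using pos t1 by (auto simp: abs_square_less_1 simp del: of_real_divide of_real_mult)
  have cs: "csqrt (s\<^sup>2) = s" using Res by (intro csqrt_unique) auto
  have sq: "Re (csqrt v) > 0" "Im (csqrt v) > 0" if "Im v > 0" for v
  proof -
    have "Im v = Im ((csqrt v)\<^sup>2)" by simp
    then have "Im v = 2 * Re (csqrt v) * Im (csqrt v)" unfolding Im_power2 .
    then have pos: "0 < Re (csqrt v) * Im (csqrt v)" using that by linarith
    show "Re (csqrt v) > 0" using pos csqrt_principal[of v] by (metis less_irrefl mult_zero_left)
    then show "Im (csqrt v) > 0" using pos by (metis zero_less_mult_pos)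
  qed
  have nz: "csqrt v + 1 \<noteq> 0" if "Im v > 0" for v using sq[OF that] by (auto simp: complex_eq_iff)
  have E: "E v \<in> half_disc" if "Im v > 0" for v
  proof -
    define q where "q = csqrt v"
    have q: "Re q > 0" "Im q > 0" using sq[OF that] by (auto simp: q_def)
    have 1: "cmod (q - 1) < cmod (q + 1)"
    proof (rule power2_less_imp_less)
      show "(cmod (q - 1))\<^sup>2 < (cmod (q + 1))\<^sup>2"
        unfolding cmod_power2 using q by (simp add: power2_eq_square algebra_simps)
    qed simp
    have "E v = (q - 1) * cnj (q + 1) / of_real ((cmod (q + 1))\<^sup>2)"
      unfolding E_def q_def using complex_div_cnj by blast
    then have "Im (E v) = Im ((q - 1) * cnj (q + 1)) / (cmod (q + 1))\<^sup>2"
      by (simp only: Im_divide_of_real)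
    also have "Im ((q - 1) * cnj (q + 1)) = 2 * Im q" by (simp add: algebra_simps)
    finally have "Im (E v) > 0" using q nz[OF that] by (auto simp: q_def)
    moreover have "cmod (E v) < 1"
      using 1 by (simp add: E_def norm_divide q_def divide_simps)
    ultimately show ?thesis by (simp add: half_disc_def)
  qed
  have holE: "E holomorphic_on {v. Im v > 0}"
    unfolding E_def using nz by (auto intro!: holomorphic_intros simp: complex_nonpos_Reals_iff)
  have "(F \<circ> E) holomorphic_on {v. Im v > 0}"
    using holE F E by (auto intro!: holomorphic_on_compose_gen)
  moreover have ims2: "Im (s\<^sup>2) > 0" using Res Ims by (simp add: Im_power2)
  ultimately have *: "cmod (deriv (F \<circ> E) (s\<^sup>2)) * (2 * Im (s\<^sup>2)) \<le> 1 - (cmod ((F \<circ> E) (s\<^sup>2)))\<^sup>2"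
    using E F1 by (intro Schwarz_Pick_half_plane) auto
  have Es: "E (s\<^sup>2) = t0"
  proof -
    have "(1 + t0) / (1 - t0) + 1 = 2 / (1 - t0)" "(1 + t0) / (1 - t0) - 1 = 2 * t0 / (1 - t0)"
      using ne by (auto simp: field_simps)
    then show ?thesis unfolding E_def cs using ne by (simp add: s_def)
  qed
  have s1: "s + 1 \<noteq> 0" "s \<noteq> 0" using Res by (auto simp: complex_eq_iff)
  have dE: "(E has_field_derivative (1 / (s * (s + 1)\<^sup>2))) (at (s\<^sup>2))"
  proof -
    have sr: "s\<^sup>2 \<notin> \<real>\<^sub>\<le>\<^sub>0" using ims2 by (auto simp: complex_nonpos_Reals_iff)
    have "(csqrt has_field_derivative (1 / (2 * s))) (at (s\<^sup>2))"
      using has_field_derivative_csqrt[OF sr] by (simp add: cs inverse_eq_divide)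
    then have "(E has_field_derivative (((1 / (2 * s)) * (s + 1) - (s - 1) * (1 / (2 * s))) / ((s + 1) * (s + 1)))) (at (s\<^sup>2))"
      unfolding E_def using s1 sr by (auto intro!: derivative_eq_intros simp: cs)
    also have "(((1 / (2 * s)) * (s + 1) - (s - 1) * (1 / (2 * s))) / ((s + 1) * (s + 1))) = 1 / (s * (s + 1)\<^sup>2)"
      using s1 by (simp add: divide_simps) (simp add: power2_eq_square algebra_simps)
    finally show ?thesis .
  qed
  have "(F has_field_derivative deriv F t0) (at (E (s\<^sup>2)))"
    using holomorphic_derivI[OF F open_half_disc] t0 by (simp add: Es)
  then have "(F \<circ> E has_field_derivative (deriv F t0 * (1 / (s * (s + 1)\<^sup>2)))) (at (s\<^sup>2))"
    using dE by (rule DERIV_chain)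
  then have d: "deriv (F \<circ> E) (s\<^sup>2) = deriv F t0 * (1 / (s * (s + 1)\<^sup>2))" by (rule DERIV_imp_deriv)
  have "cmod (1 / (s * (s + 1)\<^sup>2)) * (2 * Im (s\<^sup>2)) = 2 * Im t0 * (1 - (cmod t0)\<^sup>2) / cmod (1 - t0\<^sup>2)"
  proof -
    define p where "p = cmod (1 - t0)"
    have p: "p > 0" using ne by (simp add: p_def)
    have Im2: "Im (s\<^sup>2) = 2 * ((1 - (cmod t0)\<^sup>2) / p\<^sup>2) * (2 * Im t0 / p\<^sup>2)"
      unfolding Im_power2 by (subst (1 2) s_cart) (simp add: p_def del: of_real_divide)
    have "s + 1 = 2 / (1 - t0)" using ne by (auto simp: s_def field_simps)
    then have c1: "cmod (s + 1) = 2 / p" by (simp add: norm_divide p_def)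
    have c2: "cmod s = cmod (1 + t0) / p" by (simp add: s_def norm_divide p_def)
    have c3: "cmod (1 - t0\<^sup>2) = cmod (1 + t0) * p"
      unfolding p_def norm_mult[symmetric] by (simp add: algebra_simps power2_eq_square)
    have "cmod (1 + t0) > 0" using ne by (auto simp: add_eq_0_iff)
    then show ?thesis using p
      by (simp add: norm_divide norm_mult norm_power Im2 c1 c2 c3 divide_simps) (simp add: eval_nat_numeral algebra_simps)
  qed
  then have "cmod (deriv F t0) * (2 * Im t0 * (1 - (cmod t0)\<^sup>2) / cmod (1 - t0\<^sup>2))
      = cmod (deriv (F \<circ> E) (s\<^sup>2)) * (2 * Im (s\<^sup>2))"
    by (simp only: d norm_mult mult.assoc)
  then show ?thesis using * by (simp add: Es)
qed

subsection \<open>Two explicit conformal maps\<close>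

text \<open>The chain rule gives \<open>D = B'(F t0) F'(t0)\<close>, and Schwarz--Pick bounds the
  second factor. The left side depends on \<psi> and \<open>t0\<close> only, so it is a number to be
  computed.\<close>

lemma Bloch_from_half_disc_lift:
  assumes B: "B holomorphic_on ball 0 1" and F: "F holomorphic_on half_disc"
    and F1: "\<And>t. t \<in> half_disc \<Longrightarrow> cmod (F t) < 1"
    and lift: "\<And>t. t \<in> half_disc \<Longrightarrow> B (F t) = \<psi> t"
    and \<psi>: "(\<psi> has_field_derivative D) (at t0)" and t0: "t0 \<in> half_disc"
  shows "cmod D * (2 * Im t0 * (1 - (cmod t0)\<^sup>2) / cmod (1 - t0\<^sup>2))
    \<le> cmod (deriv B (F t0)) * (1 - (cmod (F t0))\<^sup>2)"
proof -
  have "(F has_field_derivative deriv F t0) (at t0)"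
    by (rule holomorphic_derivI[OF F open_half_disc t0])
  moreover have "(B has_field_derivative deriv B (F t0)) (at (F t0))"
    using holomorphic_derivI[OF B open_ball] F1[OF t0] by simp
  ultimately have "(B \<circ> F has_field_derivative (deriv B (F t0) * deriv F t0)) (at t0)"
    by (metis DERIV_chain)
  moreover have "(B \<circ> F has_field_derivative D) (at t0)"
    by (rule has_field_derivative_transform_within_open[OF \<psi> open_half_disc t0]) (simp add: lift)
  ultimately have "D = deriv B (F t0) * deriv F t0" by (rule DERIV_unique[OF _, symmetric])
  then have "cmod D * (2 * Im t0 * (1 - (cmod t0)\<^sup>2) / cmod (1 - t0\<^sup>2))
     = cmod (deriv B (F t0)) * (cmod (deriv F t0) * (2 * Im t0 * (1 - (cmod t0)\<^sup>2) / cmod (1 - t0\<^sup>2)))"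
    by (simp add: norm_mult)
  also have "\<dots> \<le> cmod (deriv B (F t0)) * (1 - (cmod (F t0))\<^sup>2)"
    by (intro mult_left_mono Schwarz_Pick_half_disc F F1 t0) auto
  finally show ?thesis .
qed

text \<open>Squaring maps the half-disc onto the disc slit along \<open>[0, 1)\<close>, and the
  Moebius map moves the tip of the slit from \<open>0\<close> to \<open>1/49\<close>. The evaluation
  point \<open>2i/3\<close> is a rational point near the maximiser on the imaginary axis.\<close>

lemma Bloch_from_slit_disc_lift:
  assumes B: "B holomorphic_on ball 0 1" and F: "F holomorphic_on half_disc"
    and F1: "\<And>t. t \<in> half_disc \<Longrightarrow> cmod (F t) < 1" and u: "cmod u = 1"
    and lift: "\<And>t. t \<in> half_disc \<Longrightarrow> B (F t) = u * ((t\<^sup>2 + 1/49) / (1 + t\<^sup>2 / 49))"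
  shows "\<exists>z\<in>ball 0 1. 0.695356 \<le> cmod (deriv B z) * (1 - (cmod z)\<^sup>2)"
proof -
  \<comment> \<open>The threshold \<open>1/49\<close> is chosen so that this bound (about 0.6960) and that of
    the next domain (about 0.6956) both suffice; the window is narrow.\<close>
  define t0 where "t0 = Complex 0 (2/3)"
  have t0: "t0 \<in> half_disc" by (simp add: half_disc_def t0_def cmod_def abs_square_less_1)
  have sq: "t0\<^sup>2 = - 4/9" by (simp add: t0_def complex_eq_iff power2_eq_square)
  define D where "D = u * (2 * t0 * (1 + t0\<^sup>2/49) - (t0\<^sup>2 + 1/49) * (2 * t0 / 49)) / (1 + t0\<^sup>2/49)\<^sup>2"
  have "((\<lambda>t. u * ((t\<^sup>2 + 1/49) / (1 + t\<^sup>2 / 49))) has_field_derivative D) (at t0)"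
  proof -
    have "((\<lambda>t. t\<^sup>2 + 1/49) has_field_derivative (2 * t0)) (at t0)"
      "((\<lambda>t. 1 + t\<^sup>2/49) has_field_derivative (2 * t0 / 49)) (at t0)"
      by (auto intro!: derivative_eq_intros)
    moreover have "1 + t0\<^sup>2/49 \<noteq> 0" by (simp add: sq)
    ultimately have "((\<lambda>t. (t\<^sup>2 + 1/49) / (1 + t\<^sup>2 / 49)) has_field_derivative
      (2 * t0 * (1 + t0\<^sup>2/49) - (t0\<^sup>2 + 1/49) * (2 * t0 / 49)) / ((1 + t0\<^sup>2/49) * (1 + t0\<^sup>2/49))) (at t0)"
      by (rule DERIV_divide)
    from DERIV_cmult[OF this, of u] show ?thesis unfolding D_def by (simp add: power2_eq_square)
  qed
  from Bloch_from_half_disc_lift[OF B F F1 lift this t0]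
  have *: "cmod D * (2 * Im t0 * (1 - (cmod t0)\<^sup>2) / cmod (1 - t0\<^sup>2))
    \<le> cmod (deriv B (F t0)) * (1 - (cmod (F t0))\<^sup>2)" by simp
  have ct: "cmod t0 = 2/3" by (simp add: t0_def cmod_def)
  have "D = u * t0 * (2 * (1 - 4/441) - 2/49 * (1/49 - 4/9)) / (1 - 4/441)\<^sup>2"
    unfolding D_def sq by (simp add: field_simps)
  also have "\<dots> = u * t0 * of_real ((2 * (1 - 4/441) - 2/49 * (1/49 - 4/9)) / (1 - 4/441)\<^sup>2)"
    by simp
  finally have "cmod D = 2/3 * ((2 * (1 - 4/441) - 2/49 * (1/49 - 4/9)) / (1 - 4/441)\<^sup>2)"
    using u ct by (simp add: norm_mult norm_divide norm_power del: of_real_divide of_real_mult of_real_diff)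
  moreover have "cmod (1 - t0\<^sup>2) = 13/9" unfolding sq by simp
  moreover have "Im t0 = 2/3" by (simp add: t0_def)
  ultimately have "0.695356 \<le> cmod D * (2 * Im t0 * (1 - (cmod t0)\<^sup>2) / cmod (1 - t0\<^sup>2))"
    by (simp only: ct) (simp add: power2_eq_square)
  with * F1[OF t0] show ?thesis by (intro bexI[of _ "F t0"]) auto
qed

text \<open>\<open>t \<mapsto> t powr (3/2)\<close> maps the half-disc onto a three-quarter sector; the Moebius map moves its vertex to
  \<open>- 1/7\<close>, and the vertical edge becomes a geodesic that bends away from the disc of radius \<open>1/7\<close>.\<close>

definition zeta_map :: "complex \<Rightarrow> complex" where
  "zeta_map t = (t * csqrt t - 1/7) / (1 - t * csqrt t / 7)"

text \<open>The radius \<open>1/7\<close> is the square root of the threshold \<open>1/49\<close>: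
  squaring takes the part in the third quadrant to a half-turn over
  \<open>1/49 < |w| < 1\<close>.\<close>

definition notched_disc :: "complex set" where
  "notched_disc = {\<zeta>. cmod \<zeta> < 1 \<and> (Im \<zeta> > 0 \<or> Re \<zeta> < 0 \<and> cmod \<zeta> > 1/7)}"

lemma open_notched_disc: "open notched_disc"
proof -
  have "notched_disc = ball 0 1 \<inter> ({\<zeta>. Im \<zeta> > 0} \<union> ({\<zeta>. Re \<zeta> < 0} \<inter> - cball 0 (1/7)))"
    by (auto simp: notched_disc_def)
  moreover have "open \<dots>"
    by (intro open_Int open_Un open_ball open_halfspace_Im_gt open_halfspace_Re_lt open_Compl closed_cball)
  ultimately show ?thesis by metis
qed

lemma half_disc_csqrt:
  assumes "t \<in> half_disc"
  shows "Re (csqrt t) > 0" "Im (csqrt t) > 0" "cmod (csqrt t) < 1" "t \<notin> \<real>\<^sub>\<le>\<^sub>0"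
proof -
  have t: "cmod t < 1" "Im t > 0" using assms by (auto simp: half_disc_def)
  have "Im t = Im ((csqrt t)\<^sup>2)" by simp
  then have "Im t = 2 * Re (csqrt t) * Im (csqrt t)" unfolding Im_power2 .
  then have pos: "0 < Re (csqrt t) * Im (csqrt t)" using t by linarith
  show "Re (csqrt t) > 0" using pos csqrt_principal[of t] by (metis less_irrefl mult_zero_left)
  then show "Im (csqrt t) > 0" using pos by (metis zero_less_mult_pos)
  have "(cmod (csqrt t))\<^sup>2 < 1" using t by (metis norm_power power2_csqrt)
  then show "cmod (csqrt t) < 1" by (simp add: abs_square_less_1)
  show "t \<notin> \<real>\<^sub>\<le>\<^sub>0" using t by (auto simp: complex_nonpos_Reals_iff)
qed

lemma zeta_map_denom:
  assumes "t \<in> half_disc" shows "1 - t * csqrt t / 7 \<noteq> 0"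
proof
  assume "1 - t * csqrt t / 7 = 0"
  then have "t * csqrt t = 7" by (simp add: field_simps)
  then have "cmod t * cmod (csqrt t) = 7" by (metis norm_mult norm_numeral)
  moreover have "cmod t * cmod (csqrt t) < 1 * 1"
    using assms half_disc_csqrt(3)[OF assms] by (intro mult_strict_mono') (auto simp: half_disc_def)
  ultimately show False by simp
qed

lemma zeta_map_holomorphic: "zeta_map holomorphic_on half_disc"
  unfolding zeta_map_def using zeta_map_denom half_disc_csqrt(4) by (auto intro!: holomorphic_intros)

text \<open>Here \<open>h = k^3\<close> with \<open>k\<close> in the open first quadrant, so
  \<open>h\<close> has argument between 0 and three quarters of a turn. The Moebius map preserves
  the sign of \<open>Im h\<close>; where \<open>Im h \<le> 0\<close>, one has
  \<open>Re h < 0\<close>, which gives both the negative real part and the modulus above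
  \<open>1/7\<close>.\<close>

lemma zeta_map_in:
  assumes "t \<in> half_disc" shows "zeta_map t \<in> notched_disc"
proof -
  define k where "k = csqrt t"
  define a where "a = Re k"
  define b where "b = Im k"
  define h where "h = t * csqrt t"
  have k: "a > 0" "b > 0" "cmod k < 1" using half_disc_csqrt[OF assms] by (auto simp: k_def a_def b_def)
  have "t = k\<^sup>2" by (simp add: k_def)
  then have h: "h = k ^ 3" by (simp add: h_def k_def power2_eq_square power3_eq_cube)
  have Re: "Re h = a * (a\<^sup>2 - 3 * b\<^sup>2)" and Im: "Im h = b * (3 * a\<^sup>2 - b\<^sup>2)"
    by (auto simp: h a_def b_def power3_eq_cube power2_eq_square algebra_simps)
  have h1: "cmod h < 1" using k by (simp add: h norm_power power_less_one_iff)
  have nz: "1 - h / 7 \<noteq> 0" using zeta_map_denom[OF assms] by (simp add: h_def)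
  define N where "N = (cmod (1 - h/7))\<^sup>2"
  have N: "N > 0" using nz by (simp add: N_def)
  have z: "zeta_map t = (h - 1/7) / (1 - h/7)" by (simp add: zeta_map_def h_def)
  also have "\<dots> = (h - 1/7) * cnj (1 - h/7) / of_real N" unfolding N_def by (rule complex_div_cnj)
  finally have z': "zeta_map t = (h - 1/7) * cnj (1 - h/7) / of_real N" .
  define S where "S = (Re h)\<^sup>2 + (Im h)\<^sup>2"
  have S: "0 \<le> S" "S < 1" using h1 by (simp_all add: S_def flip: cmod_power2 add: abs_square_less_1)
  have ImN: "Im (zeta_map t) = Im h * (48/49) / N"
    unfolding z' Im_divide_of_real by (simp add: algebra_simps)
  have ReN: "Re (zeta_map t) = (Re h * (50/49) - 1/7 - S / 7) / N"
    unfolding z' Re_divide_of_real S_def by (simp add: algebra_simps power2_eq_square)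
  have NN: "N = 1 - 2/7 * Re h + S/49"
    unfolding N_def cmod_power2 S_def by (simp add: power2_eq_square algebra_simps)
  have MM: "(cmod (h - 1/7))\<^sup>2 = 1/49 - 2/7 * Re h + S"
    unfolding cmod_power2 S_def by (simp add: power2_eq_square algebra_simps)
  have cz: "(cmod (zeta_map t))\<^sup>2 * N = 1/49 - 2/7 * Re h + S"
    unfolding z MM[symmetric] using N by (simp add: norm_divide power_divide N_def)
  have "(cmod (zeta_map t))\<^sup>2 * N < 1 * N" unfolding cz using S by (simp add: NN)
  then have "(cmod (zeta_map t))\<^sup>2 < 1" using N by (simp only: mult_less_cancel_right_pos)
  then have 1: "cmod (zeta_map t) < 1" by (simp add: abs_square_less_1)
  show ?thesis
  proof (cases "Im h > 0")
    case True
    then show ?thesis using 1 N by (simp add: notched_disc_def ImN)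
  next
    case False
    \<comment> \<open>The argument of \<open>k\<close> is now at least a sixth of a turn, so that of
      \<open>k^3\<close> is at least a half-turn but less than three quarters.\<close>
    then have "3 * a\<^sup>2 - b\<^sup>2 \<le> 0" using k by (simp add: Im zero_less_mult_iff)
    then have "a\<^sup>2 - 3 * b\<^sup>2 < 0" using zero_less_power[OF k(1), of 2] by linarith
    then have Reh: "Re h < 0" using k by (simp add: Re mult_less_0_iff)
    then have "Re h * (50/49) - 1/7 - S / 7 < 0" using S by linarith
    then have R: "Re (zeta_map t) < 0" unfolding ReN using N by (simp add: divide_neg_pos)
    have "(1/7)\<^sup>2 * N < (cmod (zeta_map t))\<^sup>2 * N"
      unfolding cz using S Reh by (simp add: NN power2_eq_square)
    then have "(1/7)\<^sup>2 < (cmod (zeta_map t))\<^sup>2" using N by (simp only: mult_less_cancel_right_pos)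
    then have "1/7 < cmod (zeta_map t)" by (rule power2_less_imp_less) simp
    then show ?thesis using 1 R by (simp add: notched_disc_def)
  qed
qed

lemma cmod_bounds:
  assumes "0 \<le> c" shows "c\<^sup>2 \<le> a\<^sup>2 + b\<^sup>2 \<Longrightarrow> c \<le> cmod (Complex a b)" "a\<^sup>2 + b\<^sup>2 \<le> c\<^sup>2 \<Longrightarrow> cmod (Complex a b) \<le> c"
  using assms by (auto simp: cmod_def real_le_rsqrt intro: real_le_lsqrt)

lemma Bloch_from_notched_disc_lift:
  assumes B: "B holomorphic_on ball 0 1" and F: "F holomorphic_on notched_disc"
    and F1: "\<And>t. t \<in> notched_disc \<Longrightarrow> cmod (F t) < 1" and u: "cmod u = 1"
    and lift: "\<And>t. t \<in> notched_disc \<Longrightarrow> B (F t) = u * t\<^sup>2"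
  shows "\<exists>z\<in>ball 0 1. 0.695356 \<le> cmod (deriv B z) * (1 - (cmod z)\<^sup>2)"
proof -
  \<comment> \<open>Choosing the square root of \<open>t0\<close> first makes
    \<open>csqrt t0\<close>, \<open>num\<close>, \<open>den\<close> and \<open>q\<close> exact
    rational points, so that only four moduli need estimates.\<close>
  define k where "k = Complex (9/12) (5/12)"
  define t0 where "t0 = k\<^sup>2"
  have t0C: "t0 = Complex (28/72) (45/72)"
    by (simp add: t0_def k_def complex_eq_iff power2_eq_square)
  have ck: "csqrt t0 = k" unfolding t0_def by (rule csqrt_unique) (auto simp: k_def)
  have ct: "cmod t0 = 53/72"
    unfolding t0C cmod_def by (rule real_sqrt_unique) (auto simp: power2_eq_square)
  have t0: "t0 \<in> half_disc" unfolding half_disc_def mem_Collect_eq ct by (simp add: t0C)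
  define h where "h = t0 * k"
  have h: "h = Complex (27/864) (545/864)"
    by (simp add: h_def t0C k_def complex_eq_iff)
  define num where "num = Complex (27/864 - 1/7) (545/864)"
  define den where "den = Complex (1 - 27/6048) (- 545/6048)"
  have num: "h - 1/7 = num" by (simp add: h num_def complex_eq_iff)
  have den: "1 - h/7 = den" by (simp add: h den_def complex_eq_iff)
  have den0: "den \<noteq> 0" by (simp add: den_def complex_eq_iff)
  have z0: "zeta_map t0 = num / den" unfolding zeta_map_def ck num[symmetric] den[symmetric] h_def ..
  have k0: "k \<noteq> 0" by (simp add: k_def complex_eq_iff)
  have hol: "(F \<circ> zeta_map) holomorphic_on half_disc"
    using zeta_map_holomorphic F zeta_map_in by (auto intro!: holomorphic_on_compose_gen)
  define D where "D = u * (2 * (num / den)) * ((48/49) / den\<^sup>2) * (3/2 * k)"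
  have sr: "t0 \<notin> \<real>\<^sub>\<le>\<^sub>0" using half_disc_csqrt(4)[OF t0] .
  have dh: "((\<lambda>t. t * csqrt t) has_field_derivative (3/2 * k)) (at t0)"
  proof -
    have "((\<lambda>t. t * csqrt t) has_field_derivative (k + t0 / (2 * k))) (at t0)"
      using sr by (auto intro!: derivative_eq_intros simp: ck)
    moreover have "k + t0 / (2 * k) = 3/2 * k" using k0 by (simp add: t0_def power2_eq_square)
    ultimately show ?thesis by metis
  qed
  have dz: "(zeta_map has_field_derivative ((48/49) / den\<^sup>2 * (3/2 * k))) (at t0)"
  proof -
    have d1: "((\<lambda>t. t * csqrt t - 1/7) has_field_derivative (3/2 * k)) (at t0)"
      using DERIV_diff[OF dh DERIV_const] by simp
    have d2: "((\<lambda>t. 1 - t * csqrt t / 7) has_field_derivative (- (3/2 * k) / 7)) (at t0)"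
      using DERIV_diff[OF DERIV_const DERIV_cdivide[OF dh, of 7], of 1] by simp
    have v: "t0 * csqrt t0 - 1/7 = num" "1 - t0 * csqrt t0 / 7 = den"
      using num den by (simp_all add: h_def ck)
    have "(zeta_map has_field_derivative ((3/2 * k) * den - num * (- (3/2 * k) / 7)) / (den * den)) (at t0)"
      using DERIV_divide[OF d1 d2] den0 unfolding v zeta_map_def by blast
    moreover have "((3/2 * k) * den - num * (- (3/2 * k) / 7)) / (den * den) = (48/49) / den\<^sup>2 * (3/2 * k)"
    proof -
      have "(3/2 * k) * den - num * (- (3/2 * k) / 7) = (den + num / 7) * (3/2 * k)"
        by (simp add: algebra_simps)
      also have "den + num / 7 = 48/49" by (simp add: num_def den_def complex_eq_iff)
      finally show ?thesis unfolding power2_eq_square by (simp only: times_divide_eq_left)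
    qed
    ultimately show ?thesis by (simp only:)
  qed
  have dD: "((\<lambda>t. u * (zeta_map t)\<^sup>2) has_field_derivative D) (at t0)"
    using DERIV_cmult[OF DERIV_power[OF dz, of 2], of u] by (simp add: D_def z0 mult_ac)
  have Bl: "B ((F \<circ> zeta_map) t) = u * (zeta_map t)\<^sup>2" if "t \<in> half_disc" for t
    using lift zeta_map_in[OF that] by simp
  have in1: "cmod ((F \<circ> zeta_map) t) < 1" if "t \<in> half_disc" for t
    using F1 zeta_map_in[OF that] by simp
  have *: "cmod D * (2 * Im t0 * (1 - (cmod t0)\<^sup>2) / cmod (1 - t0\<^sup>2))
    \<le> cmod (deriv B ((F \<circ> zeta_map) t0)) * (1 - (cmod ((F \<circ> zeta_map) t0))\<^sup>2)"
    by (rule Bloch_from_half_disc_lift[OF B hol in1 Bl dD t0])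
  define q where "q = 1 - t0\<^sup>2"
  have q: "q = Complex (6425/5184) (-2520/5184)"
    by (simp add: q_def t0C complex_eq_iff power2_eq_square)
  \<comment> \<open>Six digits are kept because the final margin over 0.695356 is only about
    0.0002.\<close>
  have b1: "0.640584 \<le> cmod num" unfolding num_def by (rule cmod_bounds) (simp_all add: power2_eq_square)
  have b2: "cmod den \<le> 0.999606" unfolding den_def by (rule cmod_bounds) (simp_all add: power2_eq_square)
  have b3: "0.857969 \<le> cmod k" unfolding k_def by (rule cmod_bounds) (simp_all add: power2_eq_square)
  have b4: "cmod q \<le> 1.331313" unfolding q by (rule cmod_bounds) (simp_all add: power2_eq_square)
  have q0: "cmod q > 0" by (simp add: q complex_eq_iff)
  have dp: "cmod den > 0" using den0 by simp
  have eq: "cmod D * (2 * Im t0 * (1 - (cmod t0)\<^sup>2) / cmod (1 - t0\<^sup>2))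
    = (144/49) * (45/36 * (1 - (53/72)\<^sup>2)) * ((cmod num * cmod k) / (cmod den ^ 3 * cmod q))"
  proof -
    have "cmod D = 2 * (cmod num / cmod den) * ((48/49) / (cmod den)\<^sup>2) * (3/2 * cmod k)"
      unfolding D_def using u by (simp add: norm_mult norm_divide norm_power)
    moreover have "2 * (n / d) * ((48/49) / d\<^sup>2) * (3/2 * c) * (2 * (45/72) * X / y)
      = (144/49) * (45/36 * X) * ((n * c) / (d ^ 3 * y))" for n d c y X :: real
      by (simp add: power2_eq_square power3_eq_cube mult_ac)
    moreover have "Im t0 = 45/72" by (simp add: t0C)
    ultimately show ?thesis unfolding ct q_def[symmetric] by presburger
  qed
  have "0.640584 * 0.857969 \<le> cmod num * cmod k"
    using b1 b3 by (intro mult_mono) auto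
  moreover have "cmod den ^ 3 * cmod q \<le> 0.999606 ^ 3 * 1.331313"
    using b2 b4 by (intro mult_mono power_mono) auto
  ultimately have "(0.640584 * 0.857969) / (0.999606 ^ 3 * 1.331313) \<le> (cmod num * cmod k) / (cmod den ^ 3 * cmod q)"
    using q0 dp by (intro frac_le) auto
  then have "(144/49) * (45/36 * (1 - (53/72)\<^sup>2)) * ((0.640584 * 0.857969) / (0.999606 ^ 3 * 1.331313))
    \<le> (144/49) * (45/36 * (1 - (53/72)\<^sup>2)) * ((cmod num * cmod k) / (cmod den ^ 3 * cmod q))"
    by (rule mult_left_mono) (simp add: power2_eq_square)
  moreover have "(0.695356::real) \<le> (144/49) * (45/36 * (1 - (53/72)\<^sup>2)) * ((0.640584 * 0.857969) / (0.999606 ^ 3 * 1.331313))"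
    by (simp add: power2_eq_square power3_eq_cube)
  ultimately have "0.695356 \<le> (144/49) * (45/36 * (1 - (53/72)\<^sup>2)) * ((cmod num * cmod k) / (cmod den ^ 3 * cmod q))"
    by linarith
  then have "0.695356 \<le> cmod D * (2 * Im t0 * (1 - (cmod t0)\<^sup>2) / cmod (1 - t0\<^sup>2))"
    unfolding eq .
  then show ?thesis using * in1[OF t0] by (intro bexI[of _ "(F \<circ> zeta_map) t0"]) auto
qed

subsection \<open>Proper self-maps of the disc as branched coverings\<close>

definition fibre :: "(complex \<Rightarrow> complex) \<Rightarrow> complex \<Rightarrow> complex set" where
  "fibre B w = {z. cmod z < 1 \<and> B z = w}"

lemma finite_separated:
  fixes F :: "'a :: metric_space set"
  assumes "finite F"
  obtains d where "d > 0" "\<And>z z'. z \<in> F \<Longrightarrow> z' \<in> F \<Longrightarrow> z \<noteq> z' \<Longrightarrow> d \<le> dist z z'"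
proof -
  have "\<exists>d>0. \<forall>z'\<in>F. z' \<noteq> z \<longrightarrow> d \<le> dist z z'" for z
    using finite_set_avoid[OF assms, of z] by auto
  then obtain D where D: "\<And>z. D z > 0" "\<And>z z'. z' \<in> F \<Longrightarrow> z' \<noteq> z \<Longrightarrow> D z \<le> dist z z'" by metis
  show thesis
  proof (rule that[of "Min (insert 1 (D ` F))"])
    show "Min (insert 1 (D ` F)) > 0" using assms D(1) by (subst Min_gr_iff) auto
    show "Min (insert 1 (D ` F)) \<le> dist z z'" if "z \<in> F" "z' \<in> F" "z \<noteq> z'" for z z'
    proof -
      have "Min (insert 1 (D ` F)) \<le> D z" using assms that by (intro Min_le) auto
      then show ?thesis using D(2)[of z' z] that by auto
    qed
  qed
qed

text \<open>This abstracts from Blaschke products the properties that survive composition with a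
  disc automorphism; \<open>n\<close> is the degree. \<open>Riemann_Hurwitz\<close> bounds the total
  number of missing preimages by the number of critical points that the disc can hold.\<close>

locale proper_disc_map =
  fixes B :: "complex \<Rightarrow> complex" and n :: nat
  assumes holB: "B holomorphic_on ball 0 1"
    and contB: "continuous_on (cball 0 1) B"
    and bdryB: "\<And>z. cmod z = 1 \<Longrightarrow> cmod (B z) = 1"
    and intoB: "\<And>z. cmod z < 1 \<Longrightarrow> cmod (B z) < 1"
    and n_pos: "n \<ge> 1"
    and finite_fibre: "\<And>w. cmod w < 1 \<Longrightarrow> finite (fibre B w)"
    and card_fibre_le: "\<And>w. cmod w < 1 \<Longrightarrow> card (fibre B w) \<le> n"
    and deriv_nz: "\<And>w z. cmod w < 1 \<Longrightarrow> card (fibre B w) = n \<Longrightarrow> z \<in> fibre B w \<Longrightarrow> deriv B z \<noteq> 0"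
    and Riemann_Hurwitz: "\<And>W. finite W \<Longrightarrow> W \<subseteq> ball 0 1 \<Longrightarrow> (\<Sum>w\<in>W. n - card (fibre B w)) \<le> n - 1"
begin

definition branch_values :: "complex set" where
  "branch_values = {w. cmod w < 1 \<and> card (fibre B w) \<noteq> n}"

definition lift :: "complex set \<Rightarrow> (complex \<Rightarrow> complex) \<Rightarrow> bool" where
  "lift U g \<longleftrightarrow> continuous_on U g \<and> (\<forall>w\<in>U. g w \<in> fibre B w)"

lemma branch_values_less: "w \<in> branch_values \<Longrightarrow> card (fibre B w) < n"
  using card_fibre_le[of w] by (auto simp: branch_values_def)

text \<open>Each branch value lacks at least one preimage, so \<open>n\<close> of them would exceed
  the total deficit \<open>n - 1\<close>.\<close>

lemma finite_branch_values: "finite branch_values"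
proof (rule ccontr)
  assume "infinite branch_values"
  then obtain W where W: "W \<subseteq> branch_values" "finite W" "card W = n"
    by (metis infinite_arbitrarily_large)
  have "n = (\<Sum>w\<in>W. 1)" using W by simp
  also have "\<dots> \<le> (\<Sum>w\<in>W. n - card (fibre B w))"
    using W branch_values_less by (intro sum_mono) fastforce
  also have "\<dots> \<le> n - 1" using W by (intro Riemann_Hurwitz) (auto simp: branch_values_def)
  finally show False using n_pos by simp
qed

text \<open>Around the \<open>n\<close> points of a full fibre choose disjoint discs on which
  \<open>B\<close> is injective. Over nearby values each disc holds one preimage, and since a fibre
  has at most \<open>n\<close> points these are all of them: the value is evenly covered.\<close>

lemma covering: "covering_space (ball 0 1 - B -` branch_values) B (ball 0 1 - branch_values)"
proof
  show "continuous_on (ball 0 1 - B -` branch_values) B"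
    using holomorphic_on_imp_continuous_on[OF holB] continuous_on_subset by blast
  have full: "card (fibre B w) = n" if "w \<in> ball 0 1 - branch_values" for w
    using that by (auto simp: branch_values_def)
  show "B ` (ball 0 1 - B -` branch_values) = ball 0 1 - branch_values"
  proof (intro equalityI subsetI)
    fix w assume w: "w \<in> ball 0 1 - branch_values"
    then have "fibre B w \<noteq> {}" using full[OF w] n_pos by auto
    then show "w \<in> B ` (ball 0 1 - B -` branch_values)" using w by (auto simp: fibre_def)
  qed (use intoB in auto)
  fix w assume w: "w \<in> ball 0 1 - branch_values"
  define F where "F = fibre B w"
  have finF: "finite F" using w finite_fibre by (auto simp: F_def)
  have "\<forall>z\<in>F. \<exists>r>0. ball z r \<subseteq> ball 0 1 \<and> inj_on B (ball z r)"
  proof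
    fix z assume z: "z \<in> F"
    then have z1: "z \<in> ball 0 1" by (auto simp: F_def fibre_def)
    have "deriv B z \<noteq> 0" using deriv_nz[of w z] full[OF w] w z by (auto simp: F_def)
    then obtain r where r: "r > 0" "ball z r \<subseteq> ball 0 1" "inj_on B (ball z r)"
      using has_complex_derivative_locally_injective[OF holB z1] by auto
    then show "\<exists>r>0. ball z r \<subseteq> ball 0 1 \<and> inj_on B (ball z r)" by blast
  qed
  then obtain r where r: "\<And>z. z \<in> F \<Longrightarrow> r z > 0" "\<And>z. z \<in> F \<Longrightarrow> ball z (r z) \<subseteq> ball 0 1"
    "\<And>z. z \<in> F \<Longrightarrow> inj_on B (ball z (r z))" by metis
  obtain d where d: "d > 0" "\<And>z z'. z \<in> F \<Longrightarrow> z' \<in> F \<Longrightarrow> z \<noteq> z' \<Longrightarrow> d \<le> dist z z'"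
    using finite_separated[OF finF] by blast
  define U where "U = (\<lambda>z. ball z (min (r z) (d/2)))"
  have U1: "U z \<subseteq> ball 0 1" "inj_on B (U z)" "open (U z)" "z \<in> U z" if "z \<in> F" for z
  proof -
    have sub: "U z \<subseteq> ball z (r z)" by (auto simp: U_def)
    show "U z \<subseteq> ball 0 1" "inj_on B (U z)" using sub r(2,3)[OF that] inj_on_subset by blast+
    show "open (U z)" "z \<in> U z" using r(1)[OF that] d(1) by (auto simp: U_def)
  qed
  have Udisj: "U z \<inter> U z' = {}" if "z \<in> F" "z' \<in> F" "z \<noteq> z'" for z z'
  proof -
    have "U z \<subseteq> ball z (d/2)" "U z' \<subseteq> ball z' (d/2)" by (auto simp: U_def)
    moreover have "ball z (d/2) \<inter> ball z' (d/2) = {}"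
      using d(2)[OF that] by (intro disjoint_ballI) auto
    ultimately show ?thesis by blast
  qed
  have holU: "B holomorphic_on U z" if "z \<in> F" for z
    using holB U1[OF that] holomorphic_on_subset by blast
  define T where "T = (ball 0 1 - branch_values) \<inter> (\<Inter>z\<in>F. B ` U z)"
  have wT: "w \<in> T" using w U1 by (auto simp: T_def F_def fibre_def)
  have opT: "openin (top_of_set (ball 0 1 - branch_values)) T"
  proof -
    have "open (\<Inter>z\<in>F. B ` U z)"
      using finF holU U1 open_mapping_thm3 by (intro open_INT) auto
    then show ?thesis unfolding T_def by (rule openin_open_Int)
  qed
  define v where "v = (\<lambda>z. U z \<inter> B -` T) ` F"
  have Un: "\<Union>v = (ball 0 1 - B -` branch_values) \<inter> B -` T"
  proof (intro equalityI subsetI)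
    fix x assume "x \<in> \<Union>v"
    then obtain z where z: "z \<in> F" "x \<in> U z" "B x \<in> T" by (auto simp: v_def)
    then have "x \<in> ball 0 1" using U1(1) by blast
    then show "x \<in> (ball 0 1 - B -` branch_values) \<inter> B -` T" using z(3) by (auto simp: T_def)
  next
    fix x assume x: "x \<in> (ball 0 1 - B -` branch_values) \<inter> B -` T"
    have "\<exists>y\<in>U z. B y = B x" if "z \<in> F" for z
    proof -
      have "B x \<in> B ` U z" using x that unfolding T_def by blast
      then show ?thesis by force
    qed
    then obtain y where y: "\<And>z. z \<in> F \<Longrightarrow> y z \<in> U z" "\<And>z. z \<in> F \<Longrightarrow> B (y z) = B x" by metis
    have Bx: "B x \<in> ball 0 1 - branch_values" using x by (auto simp: T_def)
    have "inj_on y F"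
    proof (rule inj_onI, rule ccontr)
      fix z z' assume *: "z \<in> F" "z' \<in> F" "y z = y z'" "z \<noteq> z'"
      then have "y z \<in> U z \<inter> U z'" using y(1)[of z] y(1)[of z'] by simp
      then show False using Udisj[OF *(1,2,4)] by simp
    qed
    \<comment> \<open>One preimage in each of \<open>n\<close> disjoint discs exhausts the fibre, so
      no preimage of \<open>B x\<close> lies outside the discs.\<close>
    then have "card (y ` F) = n" using full[OF w] by (simp add: card_image F_def)
    moreover have "y ` F \<subseteq> fibre B (B x)" using y U1(1) by (auto simp: fibre_def subset_eq)
    ultimately have "y ` F = fibre B (B x)"
      using full[OF Bx] finite_fibre[of "B x"] Bx by (intro card_subset_eq) auto
    moreover have "x \<in> fibre B (B x)" using x by (auto simp: fibre_def)
    ultimately obtain z where "z \<in> F" "x = y z" by blast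
    then have "x \<in> U z \<inter> B -` T" using y(1)[of z] x by simp
    then show "x \<in> \<Union>v" using \<open>z \<in> F\<close> unfolding v_def by blast
  qed
  have "\<forall>u\<in>v. openin (top_of_set (ball 0 1 - B -` branch_values)) u"
  proof
    fix u assume "u \<in> v"
    then obtain z where z: "z \<in> F" "u = U z \<inter> B -` T" by (auto simp: v_def)
    have "open (U z \<inter> B -` (\<Inter>z\<in>F. B ` U z))"
      using finF holU U1 open_mapping_thm3 z holomorphic_on_imp_continuous_on
      by (intro continuous_open_preimage open_INT) auto
    moreover have "u = (ball 0 1 - B -` branch_values) \<inter> (U z \<inter> B -` (\<Inter>z\<in>F. B ` U z))"
      using z U1[OF z(1)] intoB by (auto simp: T_def)
    ultimately show "openin (top_of_set (ball 0 1 - B -` branch_values)) u" by (metis openin_open_Int)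
  qed
  moreover have "pairwise disjnt v"
    using Udisj by (auto simp: v_def pairwise_def disjnt_def)
  moreover have "\<forall>u\<in>v. \<exists>q. homeomorphism u T B q"
  proof
    fix u assume "u \<in> v"
    then obtain z where z: "z \<in> F" "u = U z \<inter> B -` T" by (auto simp: v_def)
    obtain g where g: "g holomorphic_on (B ` U z)" "\<And>x. x \<in> U z \<Longrightarrow> g (B x) = x"
      using holomorphic_has_inverse[OF holU[OF z(1)] U1(3)[OF z(1)] U1(2)[OF z(1)]] by metis
    have "continuous_on T g"
      using holomorphic_on_imp_continuous_on[OF g(1)] z by (auto simp: T_def intro: continuous_on_subset)
    moreover have "continuous_on u B"
      using holomorphic_on_imp_continuous_on[OF holU[OF z(1)]] z continuous_on_subset by blast
    moreover have Bu: "B ` u = T"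
    proof (intro equalityI subsetI)
      fix y assume "y \<in> T"
      then have "y \<in> B ` U z" using z(1) by (simp add: T_def)
      then show "y \<in> B ` u" using \<open>y \<in> T\<close> z(2) by blast
    qed (use z(2) in blast)
    moreover have gB: "g (B x) = x" if "x \<in> u" for x using g(2) that z(2) by blast
    moreover have "B (g y) = y" if "y \<in> T" for y using that Bu gB by (metis imageE)
    moreover have "g ` T = u" using Bu gB by force
    ultimately have "homeomorphism u T B g" unfolding homeomorphism_def by blast
    then show "\<exists>q. homeomorphism u T B q" by blast
  qed
  ultimately show "\<exists>T. w \<in> T \<and> openin (top_of_set (ball 0 1 - branch_values)) T \<and>
      (\<exists>v. \<Union>v = (ball 0 1 - B -` branch_values) \<inter> B -` T \<and> (\<forall>u\<in>v. openin (top_of_set (ball 0 1 - B -` branch_values)) u) \<and>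
        pairwise disjnt v \<and> (\<forall>u\<in>v. \<exists>q. homeomorphism u T B q))"
    using wT opT Un by blast
qed

lemma lift_exists:
  assumes "open U" "starlike U" "U \<subseteq> ball 0 1 - branch_values" "w0 \<in> U" "z0 \<in> fibre B w0"
  obtains g where "lift U g" "g w0 = z0"
proof -
  have lpc: "locally path_connected U" by (rule open_imp_locally_path_connected[OF assms(1)])
  have sc: "simply_connected U" by (rule starlike_imp_simply_connected[OF assms(2)])
  have w0: "w0 \<in> ball 0 1 - branch_values" using assms(3,4) by blast
  have z0: "cmod z0 < 1" "B z0 = w0" using assms(5) by (auto simp: fibre_def)
  have 1: "z0 \<in> ball 0 1 - B -` branch_values" using z0 w0 by simp
  have 2: "(\<lambda>x. x) \<in> U \<rightarrow> ball 0 1 - branch_values" using assms(3) by (intro Pi_I) blast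
  obtain g where g: "continuous_on U g" "g \<in> U \<rightarrow> ball 0 1 - B -` branch_values" "g w0 = z0" "\<And>y. y \<in> U \<Longrightarrow> B (g y) = y"
    using covering_space_lift_strong[OF covering 1 assms(4) sc lpc continuous_on_id 2 z0(2)[symmetric]] by metis
  have "cmod (g y) < 1" if "y \<in> U" for y using funcset_mem[OF g(2) that] by simp
  then have "lift U g" using g(1,4) by (simp add: lift_def fibre_def)
  then show thesis using g(3) that by blast
qed

lemma lift_unique:
  assumes "connected U" "U \<subseteq> ball 0 1 - branch_values" "lift U g1" "lift U g2" "a \<in> U" "g1 a = g2 a" "x \<in> U"
  shows "g1 x = g2 x"
proof (rule covering_space_lift_unique[OF covering, of g1 a g2 U "\<lambda>x. x"])
  have "g \<in> U \<rightarrow> ball 0 1 - B -` branch_values" if "lift U g" for g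
    using that assms(2) by (auto simp: lift_def fibre_def)
  then show "g1 \<in> U \<rightarrow> ball 0 1 - B -` branch_values" "g2 \<in> U \<rightarrow> ball 0 1 - B -` branch_values" using assms by auto
qed (use assms in \<open>auto simp: lift_def fibre_def\<close>)

lemma lift_subset: "lift U g \<Longrightarrow> T \<subseteq> U \<Longrightarrow> lift T g"
  by (auto simp: lift_def intro: continuous_on_subset)

text \<open>Properness: the closed disc minus balls about the fibre is compact, and \<open>B\<close>
  omits \<open>b\<close> there, on the circle because \<open>B\<close> has modulus 1. Hence
  \<open>B\<close> stays at a positive distance from \<open>b\<close>.\<close>

lemma fibre_nearby:
  assumes "cmod b < 1" "r > 0"
  obtains e where "e > 0" "\<And>z. cmod z < 1 \<Longrightarrow> dist b (B z) < e \<Longrightarrow> \<exists>y\<in>fibre B b. dist y z < r"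
proof -
  define K where "K = cball 0 1 - (\<Union>y\<in>fibre B b. ball y r)"
  have "compact K" unfolding K_def by (intro compact_diff) auto
  show thesis
  proof (cases "K = {}")
    case True
    have "\<exists>y\<in>fibre B b. dist y z < r" if "cmod z < 1" for z
    proof -
      have "z \<notin> K" using True by simp
      then show ?thesis using that by (auto simp: K_def)
    qed
    then show thesis by (intro that[of 1]) auto
  next
    case False
    have "continuous_on K (\<lambda>z. dist b (B z))"
      by (intro continuous_intros continuous_on_subset[OF contB]) (auto simp: K_def)
    then obtain x where x: "x \<in> K" "\<And>z. z \<in> K \<Longrightarrow> dist b (B x) \<le> dist b (B z)"
      using continuous_attains_inf[OF \<open>compact K\<close> False] by blast
    have "b \<noteq> B x"
    proof
      assume "b = B x"
      have "cmod x \<le> 1" using x(1) by (simp add: K_def)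
      moreover have "cmod x \<noteq> 1" using \<open>b = B x\<close> bdryB[of x] assms(1) by auto
      ultimately have "cmod x < 1" by simp
      then have "x \<in> fibre B b" using \<open>b = B x\<close> by (simp add: fibre_def)
      moreover have "x \<in> ball x r" using assms(2) by simp
      ultimately show False using x(1) unfolding K_def by blast
    qed
    show thesis
    proof (rule that[of "dist b (B x)"])
      show "dist b (B x) > 0" using \<open>b \<noteq> B x\<close> by simp
      fix z assume "cmod z < 1" "dist b (B z) < dist b (B x)"
      then have "z \<notin> K" using x(2) by (meson not_le)
      then show "\<exists>y\<in>fibre B b. dist y z < r" using \<open>cmod z < 1\<close> by (auto simp: K_def)
    qed
  qed
qed

lemma fibre_separated:
  assumes "cmod b < 1"
  obtains r where "r > 0" "\<And>y y'. y \<in> fibre B b \<Longrightarrow> y' \<in> fibre B b \<Longrightarrow> y \<noteq> y' \<Longrightarrow> ball y r \<inter> ball y' r = {}"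
proof -
  obtain d where d: "d > 0" "\<And>z z'. z \<in> fibre B b \<Longrightarrow> z' \<in> fibre B b \<Longrightarrow> z \<noteq> z' \<Longrightarrow> d \<le> dist z z'"
    using finite_separated[OF finite_fibre[OF assms]] by blast
  show thesis
  proof (rule that[of "d / 2"])
    fix z z' assume "z \<in> fibre B b" "z' \<in> fibre B b" "z \<noteq> z'"
    then show "ball z (d/2) \<inter> ball z' (d/2) = {}" using d(2) by (intro disjoint_ballI) auto
  qed (use d(1) in simp)
qed

text \<open>The image of the lift is connected and covered by disjoint balls about the fibre, so a
  single ball contains it. This is what gives lifts a limit at a branch value.\<close>

lemma connected_lift_near:
  assumes "connected U" "U \<noteq> {}" "lift U g" "U \<subseteq> ball b e"
    and e: "\<And>z. cmod z < 1 \<Longrightarrow> dist b (B z) < e \<Longrightarrow> \<exists>y\<in>fibre B b. dist y z < r"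
    and sep: "\<And>y y'. y \<in> fibre B b \<Longrightarrow> y' \<in> fibre B b \<Longrightarrow> y \<noteq> y' \<Longrightarrow> ball y r \<inter> ball y' r = {}"
  obtains y where "y \<in> fibre B b" "g ` U \<subseteq> ball y r"
proof -
  have cov: "\<exists>y\<in>fibre B b. g w \<in> ball y r" if "w \<in> U" for w
    using assms(3,4) that e[of "g w"] by (auto simp: lift_def fibre_def subset_eq)
  obtain w0 where w0: "w0 \<in> U" using assms(2) by blast
  then obtain y where y: "y \<in> fibre B b" "g w0 \<in> ball y r" using cov by blast
  have con: "connected (g ` U)" using assms(1,3) connected_continuous_image by (auto simp: lift_def)
  have "g ` U \<subseteq> ball y r"
  proof (rule ccontr)
    assume "\<not> g ` U \<subseteq> ball y r"
    moreover define X where "X = (\<Union>y'\<in>fibre B b - {y}. ball y' r)"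
    have "open X" by (auto simp: X_def)
    moreover have "g ` U \<subseteq> ball y r \<union> X" using cov unfolding X_def by blast
    moreover have "ball y r \<inter> X \<inter> g ` U = {}" using sep y(1) unfolding X_def by blast
    ultimately show False
      using connectedD[OF con open_ball[of y r] \<open>open X\<close>] y(2) w0 by blast
  qed
  then show thesis using that y by blast
qed

end

subsection \<open>Sheets over the disc cut along rays\<close>

text \<open>The half-lines on the line through \<open>0\<close> and \<open>b\<close>, starting at \<open>b\<close> and pointing away from \<open>0\<close> resp. towards \<open>0\<close>.\<close>

definition ray :: "complex \<Rightarrow> complex set" where
  "ray b = {w. Im (w / b) = 0 \<and> Re (w / b) \<ge> 1}"

definition coray :: "complex \<Rightarrow> complex set" where
  "coray b = {w. Im (w / b) = 0 \<and> Re (w / b) \<le> 1}"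

text \<open>Dividing by \<open>b\<close> turns the ray of \<open>b\<close> into the positive axis;
  \<epsilon> is the tangent of half the opening angle.\<close>

definition wedge :: "complex \<Rightarrow> real \<Rightarrow> complex set" where
  "wedge b \<epsilon> = {w. cmod w < 1 \<and> \<bar>Im (w / b)\<bar> < \<epsilon> * Re (w / b)}"

lemma closed_ray: "closed (ray b)"
  unfolding ray_def divide_inverse by (intro closed_Collect_conj closed_Collect_eq closed_Collect_le continuous_intros)

lemma closed_coray: "closed (coray b)"
  unfolding coray_def divide_inverse by (intro closed_Collect_conj closed_Collect_eq closed_Collect_le continuous_intros)

lemma open_wedge: "open (wedge b \<epsilon>)"
  unfolding wedge_def divide_inverse by (intro open_Collect_conj open_Collect_less continuous_intros)

lemma Re_divide_combo: "Re ((of_real s * x + of_real t * y) / b) = s * Re (x / b) + t * Re (y / b)"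
  and Im_divide_combo: "Im ((of_real s * x + of_real t * y) / b) = s * Im (x / b) + t * Im (y / b)"
  by (simp_all add: add_divide_distrib flip: times_divide_eq_right)

lemma convex_halfplane_lin:
  assumes "\<And>s t x y. f (of_real s * x + of_real t * y) = s * f x + t * f (y::complex)"
  shows "convex {w. (f w :: real) > 0}"
proof (rule convexI)
  fix x y and u v :: real
  assume *: "x \<in> {w. f w > 0}" "y \<in> {w. f w > 0}" "0 \<le> u" "0 \<le> v" "u + v = 1"
  have "f (u *\<^sub>R x + v *\<^sub>R y) = u * f x + v * f y" using assms by (simp add: scaleR_conv_of_real)
  also have "\<dots> > 0"
  proof (cases "u = 0")
    case False
    then have "u * f x > 0" "v * f y \<ge> 0" using * by auto
    then show ?thesis by linarith
  qed (use * in auto)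
  finally show "u *\<^sub>R x + v *\<^sub>R y \<in> {w. f w > 0}" by simp
qed

lemma convex_wedge: "convex (wedge b \<epsilon>)"
proof -
  have "wedge b \<epsilon> = ball 0 1 \<inter> {w. \<epsilon> * Re (w / b) - Im (w / b) > 0} \<inter> {w. \<epsilon> * Re (w / b) + Im (w / b) > 0}"
    by (auto simp: wedge_def)
  moreover have "convex \<dots>"
    by (intro convex_Int convex_ball convex_halfplane_lin)
      (simp_all only: Re_divide_combo Im_divide_combo, simp_all add: algebra_simps)
  ultimately show ?thesis by simp
qed

lemma convex_Im_side: "convex {w. s * Im (w / b) > 0}"
  by (rule convex_halfplane_lin) (simp only: Im_divide_combo, simp add: algebra_simps)

text \<open>The centre \<open>p\<close> lies on the line of the removed half-line but not on the
  half-line itself. A segment from \<open>p\<close> can therefore meet the half-line only if it runs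
  along that line and ends on the half-line. The sign \<open>s\<close> treats \<open>ray\<close> and
  \<open>coray\<close> together.\<close>

lemma starlike_minus_half_line:
  assumes K: "convex K" "p \<in> K" "Im (p / b) = 0" "s * Re (p / b) < s"
  shows "starlike (K - {w. Im (w / b) = 0 \<and> s * Re (w / b) \<ge> s})"
  unfolding starlike_def
proof (intro bexI ballI)
  let ?R = "{w. Im (w / b) = 0 \<and> s * Re (w / b) \<ge> s}"
  show "p \<in> K - ?R" using K by auto
  fix w assume w: "w \<in> K - ?R"
  show "closed_segment p w \<subseteq> K - ?R"
  proof
    fix x assume x: "x \<in> closed_segment p w"
    then have "x \<in> K" using closed_segment_subset[OF K(2) _ K(1)] w by blast
    moreover obtain t where t: "0 \<le> t" "t \<le> 1" "x = (1 - t) *\<^sub>R p + t *\<^sub>R w"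
      using x by (auto simp: closed_segment_def)
    have "x = of_real (1 - t) * p + of_real t * w" by (simp add: t(3) scaleR_conv_of_real)
    then have x': "Im (x / b) = t * Im (w / b)" "Re (x / b) = (1 - t) * Re (p / b) + t * Re (w / b)"
      using Im_divide_combo[of "1 - t" p t w b] Re_divide_combo[of "1 - t" p t w b] K(3) by simp_all
    have "x \<notin> ?R"
    proof
      assume xr: "x \<in> ?R"
      then have "t \<noteq> 0" using x' K(4) by auto
      then have "Im (w / b) = 0" using xr x'(1) by simp
      then have "s * Re (w / b) < s" using w by auto
      then have "t * (s * Re (w / b)) < t * s" using t(1) \<open>t \<noteq> 0\<close> by (intro mult_strict_left_mono) auto
      moreover have "(1 - t) * (s * Re (p / b)) \<le> (1 - t) * s" using t(2) K(4) by (intro mult_left_mono) auto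
      ultimately have "(1 - t) * (s * Re (p / b)) + t * (s * Re (w / b)) < (1 - t) * s + t * s"
        by (intro add_le_less_mono)
      then have "s * Re (x / b) < s" unfolding x'(2) by (simp add: algebra_simps)
      then show False using xr by simp
    qed
    ultimately show "x \<in> K - ?R" by simp
  qed
qed

lemma starlike_minus_ray:
  "convex K \<Longrightarrow> p \<in> K \<Longrightarrow> Im (p / b) = 0 \<Longrightarrow> Re (p / b) < 1 \<Longrightarrow> starlike (K - ray b)"
  using starlike_minus_half_line[of K p b 1] by (simp add: ray_def)

lemma starlike_minus_coray:
  "convex K \<Longrightarrow> p \<in> K \<Longrightarrow> Im (p / b) = 0 \<Longrightarrow> Re (p / b) > 1 \<Longrightarrow> starlike (K - coray b)"
  using starlike_minus_half_line[of K p b "- 1"] by (simp add: coray_def)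

text \<open>With one branch value per ray, every cut has a single tip, and crossing it anywhere
  beyond the tip joins the sheets in the same way. As \<open>0\<close> is not a branch value, its
  \<open>n\<close> preimages can label the sheets.\<close>

locale generic_disc_map = proper_disc_map +
  assumes V0: "0 \<notin> branch_values"
    and branch_values_rays: "\<And>b b'. b \<in> branch_values \<Longrightarrow> b' \<in> branch_values \<Longrightarrow> Im (b' / b) = 0 \<Longrightarrow> Re (b' / b) > 0 \<Longrightarrow> b' = b"
begin

lemma branch_values_D: "b \<in> branch_values \<Longrightarrow> cmod b < 1" "b \<in> branch_values \<Longrightarrow> b \<noteq> 0"
  using V0 by (auto simp: branch_values_def)

definition star_dom :: "complex set" where
  "star_dom = ball 0 1 - (\<Union>b\<in>branch_values. ray b)"

lemma branch_values_ray: "b \<in> branch_values \<Longrightarrow> b \<in> ray b"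
  using V0 by (auto simp: ray_def)

lemma open_star_dom: "open star_dom"
  unfolding star_dom_def using finite_branch_values closed_ray by (intro open_Diff open_ball closed_UN) auto

lemma star_dom_subset: "star_dom \<subseteq> ball 0 1 - branch_values"
  using branch_values_ray by (auto simp: star_dom_def)

lemma zero_star_dom: "0 \<in> star_dom"
  by (auto simp: star_dom_def ray_def)

lemma starlike_star_dom: "starlike star_dom"
  unfolding starlike_def
proof (intro bexI[OF _ zero_star_dom] ballI subsetI)
  fix w x assume w: "w \<in> star_dom" and x: "x \<in> closed_segment 0 w"
  then obtain t where t: "0 \<le> t" "t \<le> 1" "x = of_real t * w"
    by (auto simp: closed_segment_def scaleR_conv_of_real)
  have "cmod x \<le> 1 * cmod w" unfolding t(3) norm_mult using t by (intro mult_right_mono) auto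
  then have "cmod x < 1" using w by (auto simp: star_dom_def)
  moreover have "x \<notin> ray b" if "b \<in> branch_values" for b
  proof
    assume xr: "x \<in> ray b"
    have xb: "Re (x / b) = t * Re (w / b)" "Im (x / b) = t * Im (w / b)"
      unfolding t(3) by (simp_all flip: times_divide_eq_right)
    then have 1: "1 \<le> t * Re (w / b)" using xr by (simp add: ray_def)
    then have "t > 0" using t(1) by (cases "t = 0") auto
    then have "Re (w / b) \<ge> 0" using 1 by (meson zero_less_mult_pos less_le_trans less_imp_le zero_less_one)
    then have "t * Re (w / b) \<le> 1 * Re (w / b)" using t by (intro mult_right_mono) auto
    then have "w \<in> ray b" using xr xb \<open>t > 0\<close> by (auto simp: ray_def)
    then show False using w that by (auto simp: star_dom_def)
  qed
  ultimately show "x \<in> star_dom" by (auto simp: star_dom_def)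
qed

lemma connected_star_dom: "connected star_dom"
  by (rule starlike_imp_connected[OF starlike_star_dom])

definition base_fibre :: "complex set" where "base_fibre = fibre B 0"

text \<open>Sheets are indexed by the zeros of \<open>B\<close>, their values at \<open>0\<close>.\<close>

definition sheet :: "complex \<Rightarrow> complex \<Rightarrow> complex" where
  "sheet z = (SOME g. lift star_dom g \<and> g 0 = z)"

lemma sheet: assumes "z \<in> base_fibre" shows "lift star_dom (sheet z)" "sheet z 0 = z"
proof -
  have "\<exists>g. lift star_dom g \<and> g 0 = z"
    using lift_exists[OF open_star_dom starlike_star_dom star_dom_subset zero_star_dom] assms unfolding base_fibre_def by metis
  from someI_ex[OF this] show "lift star_dom (sheet z)" "sheet z 0 = z" unfolding sheet_def by auto
qed

lemma finite_base_fibre: "finite base_fibre" and card_base_fibre: "card base_fibre = n"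
  using finite_fibre[of 0] V0 by (auto simp: base_fibre_def branch_values_def)

lemma sheet_inj:
  assumes "z \<in> base_fibre" "z' \<in> base_fibre" "w \<in> star_dom" "sheet z w = sheet z' w" shows "z = z'"
  using lift_unique[OF connected_star_dom star_dom_subset sheet(1)[OF assms(1)] sheet(1)[OF assms(2)] assms(3,4) zero_star_dom]
    sheet(2) assms by simp

lemma sheets_cover:
  assumes "w \<in> star_dom" shows "bij_betw (\<lambda>z. sheet z w) base_fibre (fibre B w)"
proof -
  have inj: "inj_on (\<lambda>z. sheet z w) base_fibre" using sheet_inj assms by (auto intro!: inj_onI)
  have sub: "(\<lambda>z. sheet z w) ` base_fibre \<subseteq> fibre B w" using sheet(1) assms by (auto simp: lift_def)
  have w: "w \<in> ball 0 1 - branch_values" using assms star_dom_subset by blast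
  then have "card (fibre B w) = n" "finite (fibre B w)" using finite_fibre by (auto simp: branch_values_def)
  then have "(\<lambda>z. sheet z w) ` base_fibre = fibre B w"
    using sub inj card_base_fibre by (intro card_subset_eq) (auto simp: card_image)
  then show ?thesis using inj by (simp add: bij_betw_def)
qed

lemma lift_is_sheet:
  assumes "connected U" "U \<noteq> {}" "U \<subseteq> star_dom" "lift U h"
  obtains z where "z \<in> base_fibre" "\<And>w. w \<in> U \<Longrightarrow> h w = sheet z w"
proof -
  obtain p where p: "p \<in> U" using assms(2) by blast
  then have "h p \<in> fibre B p" using assms(4) by (auto simp: lift_def)
  then obtain z where z: "z \<in> base_fibre" "h p = sheet z p"
    using sheets_cover[of p] p assms(3) by (auto simp: bij_betw_def)
  have "h w = sheet z w" if "w \<in> U" for w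
    using lift_unique[OF assms(1) _ assms(4) lift_subset[OF sheet(1)[OF z(1)] assms(3)] p z(2) that]
      star_dom_subset assms(3) by blast
  then show thesis using that z by blast
qed

definition aperture :: "complex \<Rightarrow> real" where
  "aperture b = (SOME \<epsilon>. \<epsilon> > 0 \<and> (\<forall>b'\<in>branch_values. b' \<noteq> b \<longrightarrow> \<not> \<bar>Im (b' / b)\<bar> < \<epsilon> * Re (b' / b)))"

text \<open>Only branch values with positive \<open>Re (b' / b)\<close> matter. They are finitely
  many, and none lies on the ray of \<open>b\<close>, so their slopes have a positive
  minimum.\<close>

lemma aperture: assumes "b \<in> branch_values"
  shows "aperture b > 0" "\<And>b'. b' \<in> branch_values \<Longrightarrow> b' \<noteq> b \<Longrightarrow> \<not> \<bar>Im (b' / b)\<bar> < aperture b * Re (b' / b)"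
proof -
  define W where "W = {b'\<in>branch_values. b' \<noteq> b \<and> Re (b' / b) > 0}"
  define f where "f = (\<lambda>b'. \<bar>Im (b' / b)\<bar> / Re (b' / b))"
  have finW: "finite W" using finite_branch_values by (simp add: W_def)
  have f: "f b' > 0" if "b' \<in> W" for b'
  proof -
    have "Im (b' / b) \<noteq> 0" using that branch_values_rays[OF assms, of b'] by (auto simp: W_def)
    then show ?thesis using that by (simp add: W_def f_def)
  qed
  define \<epsilon> where "\<epsilon> = Min (insert 1 (f ` W))"
  have "\<epsilon> > 0" unfolding \<epsilon>_def using finW f by (subst Min_gr_iff) auto
  moreover have "\<not> \<bar>Im (b' / b)\<bar> < \<epsilon> * Re (b' / b)" if "b' \<in> branch_values" "b' \<noteq> b" for b'
  proof (cases "Re (b' / b) > 0")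
    case True
    then have "\<epsilon> \<le> f b'" unfolding \<epsilon>_def using finW that by (intro Min_le) (auto simp: W_def)
    then show ?thesis using True by (simp add: f_def pos_le_divide_eq)
  next
    case False
    then have "\<epsilon> * Re (b' / b) \<le> 0" using \<open>\<epsilon> > 0\<close> by (simp add: mult_le_0_iff)
    then show ?thesis by linarith
  qed
  ultimately have "\<exists>\<epsilon>. \<epsilon> > 0 \<and> (\<forall>b'\<in>branch_values. b' \<noteq> b \<longrightarrow> \<not> \<bar>Im (b' / b)\<bar> < \<epsilon> * Re (b' / b))" by blast
  from someI_ex[OF this] show "aperture b > 0" "\<And>b'. b' \<in> branch_values \<Longrightarrow> b' \<noteq> b \<Longrightarrow> \<not> \<bar>Im (b' / b)\<bar> < aperture b * Re (b' / b)"
    unfolding aperture_def by auto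
qed

definition wedge_at :: "complex \<Rightarrow> complex set" where "wedge_at b = wedge b (aperture b)"

text \<open>The wedge conditions are invariant under positive scaling, so a point of the ray of
  \<open>b'\<close> in the wedge would force \<open>b'\<close> itself into the sector.\<close>

lemma wedge_at_other_ray:
  assumes "b \<in> branch_values" "b' \<in> branch_values" "b' \<noteq> b" "w \<in> wedge_at b" shows "w \<notin> ray b'"
proof
  assume w: "w \<in> ray b'"
  define r where "r = Re (w / b')"
  have "b' \<noteq> 0" "b \<noteq> 0" using assms branch_values_D by auto
  have r: "r \<ge> 1" "w / b' = of_real r" using w by (auto simp: r_def ray_def complex_eq_iff)
  then have "w = of_real r * b'" using \<open>b' \<noteq> 0\<close> by (simp add: field_simps)
  then have e: "w / b = of_real r * (b' / b)" by simp
  have "\<bar>Im (w / b)\<bar> < aperture b * Re (w / b)" using assms(4) by (simp add: wedge_at_def wedge_def)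
  then have "r * \<bar>Im (b' / b)\<bar> < r * (aperture b * Re (b' / b))"
  proof -
    have "Re (w / b) = r * Re (b' / b)" "Im (w / b) = r * Im (b' / b)"
      unfolding e by (simp_all flip: times_divide_eq_right)
    then show ?thesis using \<open>\<bar>Im (w / b)\<bar> < aperture b * Re (w / b)\<close> r(1) by (simp add: abs_mult mult.left_commute)
  qed
  then have "\<bar>Im (b' / b)\<bar> < aperture b * Re (b' / b)" using r(1) by simp
  then show False using aperture(2)[OF assms(1-3)] by blast
qed

lemma wedge_at_star_dom: "b \<in> branch_values \<Longrightarrow> wedge_at b - ray b \<subseteq> star_dom"
  using wedge_at_other_ray by (auto simp: star_dom_def wedge_at_def wedge_def)

lemma wedge_at_real: 
  assumes "b \<in> branch_values" "r > 0" "r * cmod b < 1" shows "of_real r * b \<in> wedge_at b" 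
  using assms branch_values_D(2)[OF assms(1)] aperture(1)[OF assms(1)] by (simp add: wedge_at_def wedge_def norm_mult)

lemma b_wedge_at: "b \<in> branch_values \<Longrightarrow> b \<in> wedge_at b"
  using wedge_at_real[of b 1] branch_values_D by simp

lemma open_wedge_at: "open (wedge_at b)" and convex_wedge_at: "convex (wedge_at b)"
  by (simp_all add: wedge_at_def open_wedge convex_wedge)

text \<open>The cut is placed on the opposite side of \<open>b\<close>, towards the origin. The rest
  is simply connected and contains both sides of the ray beyond \<open>b\<close>, so a lift here
  compares the sheets on the two sides.\<close>

definition inner_wedge :: "complex \<Rightarrow> complex set" where "inner_wedge b = wedge_at b - coray b"

definition side :: "real \<Rightarrow> complex \<Rightarrow> complex set" where
  "side s b = {w \<in> wedge_at b. s * Im (w / b) > 0}"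

lemma open_inner_wedge: "open (inner_wedge b)"
  by (simp add: inner_wedge_def open_Diff open_wedge_at closed_coray)

lemma beyond: assumes "b \<in> branch_values" obtains r where "r > 1" "r * cmod b < 1"
proof (rule that[of "(1 + 1 / cmod b) / 2"])
  have b: "cmod b > 0" "cmod b < 1" using branch_values_D[OF assms] by auto
  then have "1 / cmod b > 1" by simp
  then show "(1 + 1 / cmod b) / 2 > 1" by simp
  have "(1 + 1 / cmod b) / 2 * cmod b = (cmod b + 1) / 2" using b by (simp add: field_simps)
  then show "(1 + 1 / cmod b) / 2 * cmod b < 1" using b by simp
qed

lemma starlike_inner_wedge: assumes "b \<in> branch_values" shows "starlike (inner_wedge b)"
proof -
  obtain r where r: "r > 1" "r * cmod b < 1" using beyond[OF assms] .
  then show ?thesis unfolding inner_wedge_def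
    using starlike_minus_coray[OF convex_wedge_at, of "of_real r * b" b b] wedge_at_real[OF assms, of r] branch_values_D[OF assms] by auto
qed

lemma inner_wedge_subset: assumes "b \<in> branch_values" shows "inner_wedge b \<subseteq> ball 0 1 - branch_values"
proof
  fix w assume w: "w \<in> inner_wedge b"
  then have "w \<in> ball 0 1" by (auto simp: inner_wedge_def wedge_at_def wedge_def)
  moreover have "w \<notin> branch_values"
  proof
    assume "w \<in> branch_values"
    moreover have "w \<noteq> b" using w branch_values_D[OF assms] by (auto simp: inner_wedge_def coray_def)
    ultimately show False using wedge_at_other_ray[OF assms, of w w] branch_values_ray w by (auto simp: inner_wedge_def)
  qed
  ultimately show "w \<in> ball 0 1 - branch_values" by blast
qed

lemma side_subset: "side s b \<subseteq> wedge_at b" "side s b \<subseteq> inner_wedge b" "b \<in> branch_values \<Longrightarrow> side s b \<subseteq> star_dom"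
proof -
  show 1: "side s b \<subseteq> wedge_at b" "side s b \<subseteq> inner_wedge b" by (auto simp: side_def inner_wedge_def coray_def)
  have "side s b \<inter> ray b = {}" by (auto simp: side_def ray_def)
  then show "b \<in> branch_values \<Longrightarrow> side s b \<subseteq> star_dom" using 1(1) wedge_at_star_dom[of b] by blast
qed

lemma convex_side: "convex (side s b)"
proof -
  have "side s b = wedge_at b \<inter> {w. s * Im (w / b) > 0}" by (auto simp: side_def)
  then show ?thesis by (simp add: convex_Int convex_wedge_at convex_Im_side)
qed

lemma side_near:
  assumes "b \<in> branch_values" "s \<noteq> 0" "e > 0" obtains w where "w \<in> side s b" "w \<in> ball b e"
proof -
  have "open (wedge_at b \<inter> ball b e)" "b \<in> wedge_at b \<inter> ball b e" using open_wedge_at b_wedge_at assms by auto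
  then obtain d where d: "d > 0" "ball b d \<subseteq> wedge_at b \<inter> ball b e" by (meson open_contains_ball)
  define w where "w = b + of_real (d / 2 * sgn s) * \<i> * b"
  have b: "b \<noteq> 0" "cmod b < 1" using branch_values_D[OF assms(1)] by auto
  have "w / b = 1 + of_real (d / 2 * sgn s) * \<i>" using b by (simp add: w_def add_divide_distrib)
  then have "s * Im (w / b) = d / 2 * \<bar>s\<bar>" by (simp add: abs_sgn)
  also have "\<dots> > 0" using d(1) assms(2) by simp
  finally have "s * Im (w / b) > 0" .
  moreover have "dist b w < d"
  proof -
    have "dist b w = d / 2 * cmod b" using assms(2) d by (simp add: w_def dist_norm norm_mult abs_sgn_eq)
    also have "\<dots> \<le> d / 2 * 1" using d b by (intro mult_left_mono) auto
    finally show ?thesis using d by simp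
  qed
  ultimately show thesis using d(2) by (intro that[of w]) (auto simp: side_def)
qed

lemma side_nonempty: "b \<in> branch_values \<Longrightarrow> s \<noteq> 0 \<Longrightarrow> side s b \<noteq> {}"
  using side_near[of b s 1] by auto

text \<open>Crossing the ray of \<open>b\<close> into the side \<open>s\<close> (\<open>s = 1\<close>: counterclockwise), the sheet \<open>z\<close> continues as the sheet \<open>z'\<close>.\<close>

definition crossing :: "real \<Rightarrow> complex \<Rightarrow> complex \<Rightarrow> complex \<Rightarrow> bool" where
  "crossing s b z z' \<longleftrightarrow> (\<exists>h. lift (inner_wedge b) h \<and> (\<forall>w\<in>side (- s) b. h w = sheet z w) \<and> (\<forall>w\<in>side s b. h w = sheet z' w))"

lemma crossing_uminus: "crossing (- s) b z z' \<longleftrightarrow> crossing s b z' z"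
  by (auto simp: crossing_def)

text \<open>Together with uniqueness and reversal of \<open>s\<close>, this makes
  \<open>crossing s b\<close> a permutation of the sheets: the local monodromy at
  \<open>b\<close>.\<close>

lemma crossing_exists:
  assumes "b \<in> branch_values" "z \<in> base_fibre" "s \<noteq> 0"
  obtains z' where "z' \<in> base_fibre" "crossing s b z z'"
proof -
  have s: "- s \<noteq> 0" using assms by simp
  obtain p where p: "p \<in> side (- s) b" using side_nonempty[OF assms(1) s] by blast
  have pS: "p \<in> star_dom" "p \<in> inner_wedge b" using p side_subset(2,3) assms(1) by blast+
  have "sheet z p \<in> fibre B p" using sheet(1)[OF assms(2)] pS(1) by (auto simp: lift_def)
  then obtain h where h: "lift (inner_wedge b) h" "h p = sheet z p"
    using lift_exists[OF open_inner_wedge starlike_inner_wedge[OF assms(1)] inner_wedge_subset[OF assms(1)] pS(2)] by metis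
  have h': "lift (side r b) h" for r using h(1) side_subset(2) lift_subset by blast
  obtain z1 where z1: "z1 \<in> base_fibre" "\<And>w. w \<in> side (- s) b \<Longrightarrow> h w = sheet z1 w"
    using lift_is_sheet[OF convex_connected[OF convex_side] side_nonempty[OF assms(1) s] side_subset(3)[OF assms(1)] h'] by blast
  have "z1 = z" using sheet_inj[OF z1(1) assms(2) pS(1)] z1(2)[OF p] h(2) by simp
  obtain z' where z': "z' \<in> base_fibre" "\<And>w. w \<in> side s b \<Longrightarrow> h w = sheet z' w"
    using lift_is_sheet[OF convex_connected[OF convex_side] side_nonempty[OF assms(1,3)] side_subset(3)[OF assms(1)] h'] by blast
  show thesis using that[OF z'(1)] h(1) z1(2) z'(2) \<open>z1 = z\<close> by (auto simp: crossing_def)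
qed

lemma crossing_unique:
  assumes "b \<in> branch_values" "s \<noteq> 0" "z1 \<in> base_fibre" "z2 \<in> base_fibre" "crossing s b z z1" "crossing s b z z2"
  shows "z1 = z2"
proof -
  obtain h1 where h1: "lift (inner_wedge b) h1" "\<forall>w\<in>side (- s) b. h1 w = sheet z w" "\<forall>w\<in>side s b. h1 w = sheet z1 w"
    using assms(5) unfolding crossing_def by (elim exE conjE)
  obtain h2 where h2: "lift (inner_wedge b) h2" "\<forall>w\<in>side (- s) b. h2 w = sheet z w" "\<forall>w\<in>side s b. h2 w = sheet z2 w"
    using assms(6) unfolding crossing_def by (elim exE conjE)
  have "- s \<noteq> 0" using assms(2) by simp
  then obtain p where p: "p \<in> side (- s) b" using side_nonempty[OF assms(1)] by blast
  obtain q where q: "q \<in> side s b" using side_nonempty[OF assms(1,2)] by blast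
  have con: "connected (inner_wedge b)" by (rule starlike_imp_connected[OF starlike_inner_wedge[OF assms(1)]])
  have "p \<in> inner_wedge b" "q \<in> inner_wedge b" "q \<in> star_dom" using p q side_subset(2,3) assms(1) by blast+
  then have "h1 q = h2 q"
    using lift_unique[OF con inner_wedge_subset[OF assms(1)] h1(1) h2(1), of p q] h1(2) h2(2) p by simp
  then show ?thesis using sheet_inj[OF assms(3,4) \<open>q \<in> star_dom\<close>] h1(3) h2(3) q by simp
qed

end

subsection \<open>A counting lemma for tree-like hypergraphs\<close>

lemma sum_card_swap:
  assumes "finite A" "finite C"
  shows "(\<Sum>a\<in>A. card {c\<in>C. P a c}) = (\<Sum>c\<in>C. card {a\<in>A. P a c})"
proof -
  have "(\<Sum>a\<in>A. card {c\<in>C. P a c}) = (\<Sum>a\<in>A. \<Sum>c\<in>C. if P a c then 1 else 0)"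
    using assms by (simp add: sum.If_cases Int_def)
  also have "\<dots> = (\<Sum>c\<in>C. \<Sum>a\<in>A. if P a c then 1 else 0)" by (rule sum.swap)
  also have "\<dots> = (\<Sum>c\<in>C. card {a\<in>A. P a c})"
    using assms by (simp add: sum.If_cases Int_def)
  finally show ?thesis .
qed

text \<open>Hyperedges are the sets \<open>H y\<close>. In the last case \<open>y\<close> joins \<open>M\<close> to leaves only, and so do all but at most one of
  the other hyperedges of \<open>M\<close>: delete the leaves and count once more.\<close>

lemma hypergraph_leaf:
  fixes H :: "'y \<Rightarrow> 'z set"
  defines "deg \<equiv> \<lambda>Y z. card {y\<in>Y. z \<in> H y}"
  assumes fin: "finite Y" "finite I" and sub: "\<And>y. y \<in> Y \<Longrightarrow> H y \<subseteq> I"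
    and tree: "(\<Sum>y\<in>Y. card (H y) - 1) \<le> card I - 1" and "I \<noteq> {}"
  obtains (isolated) z where "z \<in> I" "\<And>y. y \<in> Y \<Longrightarrow> z \<notin> H y"
  | (star) y where "y \<in> Y" "H y \<noteq> {}" "\<And>z. z \<in> H y \<Longrightarrow> deg Y z = 1"
  | (branch) M y where "M \<in> I" "y \<in> Y" "M \<in> H y" "\<And>z. z \<in> H y \<Longrightarrow> z \<noteq> M \<Longrightarrow> deg Y z = 1"
      "card {y'\<in>Y. M \<in> H y' \<and> (\<exists>z\<in>H y'. z \<noteq> M \<and> deg Y z \<noteq> 1)} \<le> 1"
proof -
  define leaf where "leaf = (\<lambda>z. deg Y z = 1)"
  define nl where "nl = (\<lambda>y. {z\<in>I. z \<in> H y \<and> \<not> leaf z})"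
  define lf where "lf = (\<lambda>y. {z\<in>I. z \<in> H y \<and> leaf z})"
  define \<Lambda> where "\<Lambda> = {z\<in>I. leaf z}"
  define N where "N = {z\<in>I. \<not> leaf z}"
  show thesis
  proof (cases "(\<exists>z\<in>I. \<forall>y\<in>Y. z \<notin> H y) \<or> (\<exists>y\<in>Y. H y \<noteq> {} \<and> (\<forall>z\<in>H y. leaf z))")
    case True
    then show thesis using isolated star by (auto simp: leaf_def)
  next
    case False
    have deg0: "deg Y z \<noteq> 0" if "z \<in> I" for z
      using False that fin unfolding deg_def by auto
    have nlne: "nl y \<noteq> {}" if "y \<in> Y" "H y \<noteq> {}" for y
      using False that sub[OF that(1)] unfolding nl_def by blast
    have finl: "finite (nl y)" "finite (lf y)" for y using fin by (auto simp: nl_def lf_def)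
    have cardH: "card (H y) = card (nl y) + card (lf y)" if "y \<in> Y" for y
    proof -
      have "H y = nl y \<union> lf y" using sub[OF that] by (auto simp: nl_def lf_def)
      moreover have "nl y \<inter> lf y = {}" by (auto simp: nl_def lf_def)
      ultimately show ?thesis using finl by (simp add: card_Un_disjoint)
    qed
    have "(\<Sum>y\<in>Y. card (lf y)) = (\<Sum>y\<in>Y. card {z\<in>\<Lambda>. z \<in> H y})"
      by (rule sum.cong) (auto simp: lf_def \<Lambda>_def intro!: arg_cong[of _ _ card])
    also have "\<dots> = (\<Sum>z\<in>\<Lambda>. card {y\<in>Y. z \<in> H y})"
      using fin by (intro sum_card_swap) (auto simp: \<Lambda>_def)
    also have "\<dots> = card \<Lambda>" by (simp add: \<Lambda>_def leaf_def deg_def)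
    finally have lf: "(\<Sum>y\<in>Y. card (lf y)) = card \<Lambda>" .
    \<comment> \<open>Deleting the leaves lowers the excess of a hyperedge by the number of leaves
      in it, since no nonempty hyperedge consists of leaves only. As each leaf lies in exactly one
      hyperedge, the tree inequality survives the pruning.\<close>
    have "(\<Sum>y\<in>Y. card (nl y) - 1) + card \<Lambda> = (\<Sum>y\<in>Y. (card (nl y) - 1) + card (lf y))"
      by (simp add: lf sum.distrib)
    also have "\<dots> = (\<Sum>y\<in>Y. card (H y) - 1)"
    proof (rule sum.cong[OF refl])
      fix y assume y: "y \<in> Y"
      show "(card (nl y) - 1) + card (lf y) = card (H y) - 1"
      proof (cases "H y = {}")
        case True
        then show ?thesis by (simp add: nl_def lf_def)
      next
        case False
        then have "card (nl y) > 0" using nlne[OF y] finl by (simp add: card_gt_0_iff)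
        then show ?thesis using cardH[OF y] by simp
      qed
    qed
    also have "\<dots> \<le> card I - 1" by (rule tree)
    finally have 1: "(\<Sum>y\<in>Y. card (nl y) - 1) + card \<Lambda> \<le> card I - 1" .
    have "card I = card N + card \<Lambda>"
    proof -
      have "I = N \<union> \<Lambda>" "N \<inter> \<Lambda> = {}" by (auto simp: N_def \<Lambda>_def)
      then show ?thesis using fin by (metis card_Un_disjoint finite_Un)
    qed
    moreover have "card N > 0"
    proof -
      obtain z where z: "z \<in> I" using \<open>I \<noteq> {}\<close> by blast
      then obtain y where "y \<in> Y" "z \<in> H y" using False by blast
      then obtain z' where "z' \<in> nl y" using nlne by blast
      then have "z' \<in> N" by (simp add: nl_def N_def)
      then show ?thesis using fin by (auto simp: N_def card_gt_0_iff)
    qed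
    ultimately have 2: "(\<Sum>y\<in>Y. card (nl y) - 1) < card N" using 1 by linarith
    \<comment> \<open>If every non-leaf lay in two hyperedges with at least two non-leaves, this sum
      would be at least \<open>2 card N\<close>. But \<open>c \<le> 2 (c - 1)\<close> for
      \<open>c \<ge> 2\<close>, so it is below \<open>2 card N\<close>.\<close>
    have "(\<Sum>M\<in>N. card {y\<in>Y. M \<in> H y \<and> card (nl y) \<ge> 2}) = (\<Sum>y\<in>Y. card {M\<in>N. M \<in> H y \<and> card (nl y) \<ge> 2})"
      using fin by (intro sum_card_swap) (auto simp: N_def)
    also have "\<dots> \<le> (\<Sum>y\<in>Y. 2 * (card (nl y) - 1))"
    proof (rule sum_mono)
      fix y assume "y \<in> Y"
      show "card {M\<in>N. M \<in> H y \<and> card (nl y) \<ge> 2} \<le> 2 * (card (nl y) - 1)"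
      proof (cases "card (nl y) \<ge> 2")
        case True
        then have "{M\<in>N. M \<in> H y \<and> card (nl y) \<ge> 2} = nl y" by (auto simp: N_def nl_def)
        then show ?thesis using True by simp
      qed simp
    qed
    also have "\<dots> < (\<Sum>M\<in>N. 2)" using 2 by (simp flip: sum_distrib_left)
    finally have "\<exists>M\<in>N. card {y\<in>Y. M \<in> H y \<and> card (nl y) \<ge> 2} < 2"
      by (meson not_le sum_mono)
    then obtain M where M: "M \<in> N" "card {y\<in>Y. M \<in> H y \<and> card (nl y) \<ge> 2} \<le> 1" by fastforce
    have MI: "M \<in> I" "\<not> leaf M" using M by (auto simp: N_def)
    have other: "(\<exists>z\<in>H y. z \<noteq> M \<and> \<not> leaf z) \<longleftrightarrow> card (nl y) \<ge> 2" if "y \<in> Y" "M \<in> H y" for y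
    proof -
      have Mn: "M \<in> nl y" using that MI by (simp add: nl_def)
      have "card (nl y) \<ge> 2 \<longleftrightarrow> card (nl y - {M}) > 0"
        using Mn finl by (simp add: card_Diff_singleton) linarith
      also have "\<dots> \<longleftrightarrow> nl y - {M} \<noteq> {}" using finl by (simp add: card_gt_0_iff)
      also have "\<dots> \<longleftrightarrow> (\<exists>z\<in>H y. z \<noteq> M \<and> \<not> leaf z)" using sub[OF that(1)] by (auto simp: nl_def)
      finally show ?thesis by simp
    qed
    \<comment> \<open>\<open>M\<close> lies in at least two hyperedges, at most one of which
      contains another non-leaf; the remaining one joins \<open>M\<close> to leaves only.\<close>
    have "deg Y M \<ge> 2" using deg0[OF MI(1)] MI(2) by (simp add: leaf_def)
    then have "\<not> {y\<in>Y. M \<in> H y} \<subseteq> {y\<in>Y. M \<in> H y \<and> card (nl y) \<ge> 2}"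
      using M(2) card_mono[of "{y\<in>Y. M \<in> H y \<and> card (nl y) \<ge> 2}" "{y\<in>Y. M \<in> H y}"] fin(1)
      by (auto simp: deg_def)
    then obtain y where y: "y \<in> Y" "M \<in> H y" "\<not> card (nl y) \<ge> 2" by blast
    show thesis
    proof (rule branch[OF MI(1) y(1,2)])
      show "deg Y z = 1" if "z \<in> H y" "z \<noteq> M" for z
        using other[OF y(1,2)] y(3) that by (auto simp: leaf_def)
      have "{y'\<in>Y. M \<in> H y' \<and> (\<exists>z\<in>H y'. z \<noteq> M \<and> deg Y z \<noteq> 1)} = {y\<in>Y. M \<in> H y \<and> card (nl y) \<ge> 2}"
        using other by (auto simp: leaf_def)
      then show "card {y'\<in>Y. M \<in> H y' \<and> (\<exists>z\<in>H y'. z \<noteq> M \<and> deg Y z \<noteq> 1)} \<le> 1" using M(2) by simp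
    qed
  qed
qed

subsection \<open>How sheets are joined at branch values\<close>

context generic_disc_map
begin

text \<open>This is the limit of \<open>sheet z\<close> at \<open>b\<close> within the cut disc:
  \<open>y\<close> is the point over \<open>b\<close> in the closure of the sheet.\<close>

definition attached :: "complex \<Rightarrow> complex \<Rightarrow> complex \<Rightarrow> bool" where
  "attached z b y \<longleftrightarrow> y \<in> fibre B b \<and> (\<forall>r>0. \<exists>e>0. \<forall>w\<in>star_dom \<inter> ball b e. sheet z w \<in> ball y r)"

lemma slit_ball:
  assumes "b \<in> branch_values" "e > 0"
  shows "starlike (ball b e - ray b)" "starlike (ball b e - coray b)"
proof -
  have b: "b \<noteq> 0" "cmod b < 1" using branch_values_D[OF assms(1)] by auto
  define d where "d = e / 2"
  have d: "d > 0" using assms by (simp add: d_def)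
  have in_ball: "of_real (1 + t) * b \<in> ball b e" if "\<bar>t\<bar> = d" for t
  proof -
    have "dist b (of_real (1 + t) * b) = d * cmod b" using that
      by (simp add: dist_norm algebra_simps norm_mult)
    also have "\<dots> \<le> d * 1" using b d by (intro mult_left_mono) auto
    finally show ?thesis using d by (simp add: d_def)
  qed
  show "starlike (ball b e - ray b)"
    using starlike_minus_ray[OF convex_ball in_ball[of "- d"], of b] b d by simp
  show "starlike (ball b e - coray b)"
    using starlike_minus_coray[OF convex_ball in_ball[of d], of b] b d by simp
qed

lemma near_branch_values:
  assumes "b \<in> branch_values" "r > 0"
  obtains e where "e > 0" "ball b e \<subseteq> wedge_at b"
    "\<And>z. cmod z < 1 \<Longrightarrow> dist b (B z) < e \<Longrightarrow> \<exists>y\<in>fibre B b. dist y z < r"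
proof -
  obtain e1 where e1: "e1 > 0" "\<And>z. cmod z < 1 \<Longrightarrow> dist b (B z) < e1 \<Longrightarrow> \<exists>y\<in>fibre B b. dist y z < r"
    using fibre_nearby[OF branch_values_D(1)[OF assms(1)] assms(2)] by blast
  obtain e2 where e2: "e2 > 0" "ball b e2 \<subseteq> wedge_at b"
    using open_wedge_at b_wedge_at[OF assms(1)] by (meson open_contains_ball)
  show thesis
  proof (rule that[of "min e1 e2"])
    show "min e1 e2 > 0" using e1 e2 by simp
    show "ball b (min e1 e2) \<subseteq> wedge_at b" using e2 by (auto simp: subset_eq)
    show "\<exists>y\<in>fibre B b. dist y z < r" if "cmod z < 1" "dist b (B z) < min e1 e2" for z
      using e1(2)[OF that(1)] that(2) by simp
  qed
qed

text \<open>Near \<open>b\<close> the cut disc is a slit ball, hence connected, so the sheet stays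
  close to one point of the fibre. The point is the same at every scale, because the slit balls
  overlap while the balls around fibre points are disjoint.\<close>

lemma attached_exists:
  assumes "b \<in> branch_values" "z \<in> base_fibre"
  obtains y where "attached z b y"
proof -
  obtain r1 where r1: "r1 > 0" "\<And>y y'. y \<in> fibre B b \<Longrightarrow> y' \<in> fibre B b \<Longrightarrow> y \<noteq> y' \<Longrightarrow> ball y r1 \<inter> ball y' r1 = {}"
    using fibre_separated[OF branch_values_D(1)[OF assms(1)]] by blast
  have *: "\<exists>e>0. \<exists>y\<in>fibre B b. \<forall>w\<in>star_dom \<inter> ball b e. sheet z w \<in> ball y r" if r: "0 < r" "r \<le> r1" for r
  proof -
    obtain e where e: "e > 0" "ball b e \<subseteq> wedge_at b"
      "\<And>z. cmod z < 1 \<Longrightarrow> dist b (B z) < e \<Longrightarrow> \<exists>y\<in>fibre B b. dist y z < r"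
      using near_branch_values[OF assms(1) r(1)] by blast
    have eq: "star_dom \<inter> ball b e = ball b e - ray b"
      using e(2) wedge_at_star_dom[OF assms(1)] assms(1) by (auto simp: star_dom_def)
    have sep: "ball y r \<inter> ball y' r = {}" if "y \<in> fibre B b" "y' \<in> fibre B b" "y \<noteq> y'" for y y'
      using r1(2)[OF that] r(2) subset_ball[of r r1] by blast
    obtain y where "y \<in> fibre B b" "sheet z ` (ball b e - ray b) \<subseteq> ball y r"
    proof (rule connected_lift_near[OF _ _ _ _ e(3) sep])
      show "connected (ball b e - ray b)" using slit_ball(1)[OF assms(1) e(1)] starlike_imp_connected by blast
      show "ball b e - ray b \<noteq> {}" using slit_ball(1)[OF assms(1) e(1)] by (auto simp: starlike_def)
      show "lift (ball b e - ray b) (sheet z)"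
        using lift_subset[OF sheet(1)[OF assms(2)]] eq by blast
    qed auto
    then show ?thesis using e(1) eq by blast
  qed
  obtain e1 y where y: "e1 > 0" "y \<in> fibre B b" "\<forall>w\<in>star_dom \<inter> ball b e1. sheet z w \<in> ball y r1"
    using *[OF r1(1) order_refl] by blast
  have "\<exists>e>0. \<forall>w\<in>star_dom \<inter> ball b e. sheet z w \<in> ball y r" if r: "r > 0" for r
  proof -
    define r' where "r' = min r r1"
    have r': "0 < r'" "r' \<le> r1" "r' \<le> r" using r r1 by (auto simp: r'_def)
    obtain e y' where y': "e > 0" "y' \<in> fibre B b" "\<forall>w\<in>star_dom \<inter> ball b e. sheet z w \<in> ball y' r'"
      using *[OF r'(1,2)] by blast
    obtain w where w: "w \<in> side 1 b" "w \<in> ball b (min e e1)"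
      using side_near[OF assms(1), of 1 "min e e1"] y y' by auto
    have "w \<in> star_dom" using w side_subset(3)[OF assms(1)] by blast
    then have "sheet z w \<in> ball y' r'" "sheet z w \<in> ball y r1" using y y' w by auto
    then have "ball y r1 \<inter> ball y' r1 \<noteq> {}" using r' subset_ball[of r' r1 y'] by blast
    then have "y' = y" using r1(2) y y' by blast
    then have "\<forall>w\<in>star_dom \<inter> ball b e. sheet z w \<in> ball y r" using y'(3) subset_ball[OF r'(3)] by blast
    then show ?thesis using y'(1) by blast
  qed
  then show thesis using that y(2) by (auto simp: attached_def)
qed

lemma attached_unique:
  assumes "b \<in> branch_values" "attached z b y" "attached z b y'"
  shows "y = y'"
proof (rule ccontr)
  assume "y \<noteq> y'"
  define r where "r = dist y y' / 2"
  have r: "r > 0" using \<open>y \<noteq> y'\<close> by (simp add: r_def)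
  obtain e1 where e1: "e1 > 0" "\<forall>w\<in>star_dom \<inter> ball b e1. sheet z w \<in> ball y r"
    using assms(2) r unfolding attached_def by blast
  obtain e2 where e2: "e2 > 0" "\<forall>w\<in>star_dom \<inter> ball b e2. sheet z w \<in> ball y' r"
    using assms(3) r unfolding attached_def by blast
  obtain w where w: "w \<in> side 1 b" "w \<in> ball b (min e1 e2)"
    using side_near[OF assms(1), of 1 "min e1 e2"] e1 e2 by auto
  have "w \<in> star_dom" using w side_subset(3)[OF assms(1)] by blast
  then have "sheet z w \<in> ball y r \<inter> ball y' r" using e1 e2 w by auto
  moreover have "ball y r \<inter> ball y' r = {}" by (rule disjoint_ballI) (simp add: r_def)
  ultimately show False by blast
qed

text \<open>A lift across the ray inherits the limit of the sheet that it extends: it too stays in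
  one ball of the fibre, and \<open>side s b\<close> contains points arbitrarily near
  \<open>b\<close> that identify the ball.\<close>

lemma lift_attached:
  assumes "b \<in> branch_values" "z \<in> base_fibre" "s \<noteq> 0" "lift (inner_wedge b) h" "\<And>w. w \<in> side s b \<Longrightarrow> h w = sheet z w" "attached z b y" "r > 0"
  obtains e where "e > 0" "ball b e \<subseteq> wedge_at b" "\<And>x. x \<in> inner_wedge b \<inter> ball b e \<Longrightarrow> h x \<in> ball y r"
proof -
  obtain r1 where r1: "r1 > 0" "\<And>y y'. y \<in> fibre B b \<Longrightarrow> y' \<in> fibre B b \<Longrightarrow> y \<noteq> y' \<Longrightarrow> ball y r1 \<inter> ball y' r1 = {}"
    using fibre_separated[OF branch_values_D(1)[OF assms(1)]] by blast
  define r' where "r' = min r r1"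
  have r': "0 < r'" "r' \<le> r1" "r' \<le> r" using assms(7) r1 by (auto simp: r'_def)
  obtain e1 where e1: "e1 > 0" "ball b e1 \<subseteq> wedge_at b"
      "\<And>z. cmod z < 1 \<Longrightarrow> dist b (B z) < e1 \<Longrightarrow> \<exists>y\<in>fibre B b. dist y z < r'"
      using near_branch_values[OF assms(1) r'(1)] by blast
  obtain e2 where e2: "e2 > 0" "\<forall>w\<in>star_dom \<inter> ball b e2. sheet z w \<in> ball y r'"
    using assms(6) r'(1) unfolding attached_def by blast
  define e where "e = min e1 e2"
  have e: "e > 0" "ball b e \<subseteq> wedge_at b" using e1 e2 by (auto simp: e_def subset_eq)
  have near: "\<exists>y\<in>fibre B b. dist y z < r'" if "cmod z < 1" "dist b (B z) < e" for z
    using e1(3) that by (simp add: e_def)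
  have sep: "ball y r' \<inter> ball y' r' = {}" if "y \<in> fibre B b" "y' \<in> fibre B b" "y \<noteq> y'" for y y'
    using r1(2)[OF that] r'(2) subset_ball[of r' r1] by blast
  have sub: "ball b e - coray b \<subseteq> inner_wedge b" using e by (auto simp: inner_wedge_def)
  obtain y' where y': "y' \<in> fibre B b" "h ` (ball b e - coray b) \<subseteq> ball y' r'"
  proof (rule connected_lift_near[OF _ _ _ _ near sep])
    show "connected (ball b e - coray b)" using slit_ball(2)[OF assms(1) e(1)] starlike_imp_connected by blast
    show "ball b e - coray b \<noteq> {}" using slit_ball(2)[OF assms(1) e(1)] by (auto simp: starlike_def)
    show "lift (ball b e - coray b) h" using lift_subset[OF assms(4) sub] .
  qed auto
  obtain w where w: "w \<in> side s b" "w \<in> ball b e" using side_near[OF assms(1,3) e(1)] .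
  have wS: "w \<in> star_dom" using w(1) side_subset(3)[OF assms(1)] by blast
  have "w \<in> inner_wedge b" using w(1) side_subset(2) by blast
  then have "w \<in> ball b e - coray b" using w(2) by (simp add: inner_wedge_def)
  then have "h w \<in> ball y' r'" using y'(2) by blast
  moreover have "h w \<in> ball y r'" using e2(2) w(2) wS assms(5)[OF w(1)] by (simp add: e_def)
  ultimately have "ball y r' \<inter> ball y' r' \<noteq> {}" by blast
  then have "y' = y" using sep y'(1) assms(6) unfolding attached_def by blast
  show thesis
  proof (rule that[OF e])
    fix x assume "x \<in> inner_wedge b \<inter> ball b e"
    then have "x \<in> ball b e - coray b" by (simp add: inner_wedge_def)
    then have "h x \<in> ball y r'" using y'(2) \<open>y' = y\<close> by blast
    then show "h x \<in> ball y r" using subset_ball[OF r'(3)] by blast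
  qed
qed

text \<open>The lift across the ray has one limit at \<open>b\<close>, shared by the sheets on both
  of its sides.\<close>

lemma crossing_attached:
  assumes "b \<in> branch_values" "z \<in> base_fibre" "z' \<in> base_fibre" "s \<noteq> 0" "crossing s b z z'" "attached z b y"
  shows "attached z' b y"
proof -
  obtain h where h: "lift (inner_wedge b) h" "\<forall>w\<in>side (- s) b. h w = sheet z w" "\<forall>w\<in>side s b. h w = sheet z' w"
    using assms(5) unfolding crossing_def by (elim exE conjE)
  obtain y' where y': "attached z' b y'" using attached_exists[OF assms(1,3)] .
  have s: "- s \<noteq> 0" using assms(4) by simp
  have "y = y'"
  proof (rule ccontr)
    assume "y \<noteq> y'"
    define r where "r = dist y y' / 2"
    have r: "r > 0" using \<open>y \<noteq> y'\<close> by (simp add: r_def)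
    obtain e1 where e1: "e1 > 0" "\<And>x. x \<in> inner_wedge b \<inter> ball b e1 \<Longrightarrow> h x \<in> ball y r"
      using lift_attached[OF assms(1,2) s h(1) _ assms(6) r] h(2) by metis
    obtain e2 where e2: "e2 > 0" "\<And>x. x \<in> inner_wedge b \<inter> ball b e2 \<Longrightarrow> h x \<in> ball y' r"
      using lift_attached[OF assms(1,3,4) h(1) _ y' r] h(3) by metis
    obtain w where w: "w \<in> side 1 b" "w \<in> ball b (min e1 e2)"
      using side_near[OF assms(1), of 1 "min e1 e2"] e1 e2 by auto
    have "w \<in> inner_wedge b" using w side_subset(2) by blast
    then have "h w \<in> ball y r \<inter> ball y' r" using e1 e2 w by auto
    moreover have "ball y r \<inter> ball y' r = {}" by (rule disjoint_ballI) (simp add: r_def)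
    ultimately show False by blast
  qed
  then show ?thesis using y' by simp
qed

text \<open>By the open mapping theorem, values near \<open>b\<close> have preimages near
  \<open>y\<close>. Such a preimage lies on one of finitely many sheets, and with a radius
  \<open>E\<close> that works for all sheets its limit can only be \<open>y\<close>.\<close>

lemma attached_surj:
  assumes "b \<in> branch_values" "y \<in> fibre B b"
  obtains z where "z \<in> base_fibre" "attached z b y"
proof -
  obtain r1 where r1: "r1 > 0" "\<And>y y'. y \<in> fibre B b \<Longrightarrow> y' \<in> fibre B b \<Longrightarrow> y \<noteq> y' \<Longrightarrow> ball y r1 \<inter> ball y' r1 = {}"
    using fibre_separated[OF branch_values_D(1)[OF assms(1)]] by blast
  have "\<exists>e y. e > 0 \<and> attached z b y \<and> (\<forall>w\<in>star_dom \<inter> ball b e. sheet z w \<in> ball y r1)" if z: "z \<in> base_fibre" for z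
  proof -
    obtain y where y: "attached z b y" using attached_exists[OF assms(1) z] .
    then show ?thesis using r1(1) unfolding attached_def by blast
  qed
  then obtain e a where ea: "\<And>z. z \<in> base_fibre \<Longrightarrow> e z > 0" "\<And>z. z \<in> base_fibre \<Longrightarrow> attached z b (a z)"
    "\<And>z w. z \<in> base_fibre \<Longrightarrow> w \<in> star_dom \<inter> ball b (e z) \<Longrightarrow> sheet z w \<in> ball (a z) r1" by metis
  define E where "E = Min (insert 1 (e ` base_fibre))"
  have E: "E > 0" unfolding E_def using finite_base_fibre ea(1) by (subst Min_gr_iff) auto
  have Ele: "E \<le> e z" if "z \<in> base_fibre" for z unfolding E_def using finite_base_fibre that by (intro Min_le) auto
  have y: "cmod y < 1" "B y = b" using assms(2) by (auto simp: fibre_def)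
  define U where "U = ball 0 1 \<inter> ball y r1"
  have U: "open U" "U \<subseteq> ball 0 1" "y \<in> U" using r1(1) y by (auto simp: U_def)
  have "\<not> B constant_on ball 0 1"
  proof
    assume "B constant_on ball 0 1"
    then have "fibre B b = ball 0 1" using y by (auto simp: constant_on_def fibre_def)
    then have "finite (ball (0::complex) 1)" using finite_fibre[OF branch_values_D(1)[OF assms(1)]] by simp
    then show False using finite_imp_not_open[of "ball (0::complex) 1"] by simp
  qed
  then have "open (B ` U)" using open_mapping_thm[OF holB open_ball connected_ball U(1,2)] by blast
  moreover have "b \<in> B ` U" using U y by blast
  ultimately obtain d where d: "d > 0" "ball b d \<subseteq> B ` U" by (meson open_contains_ball)
  obtain w where w: "w \<in> side 1 b" "w \<in> ball b (min d E)"
    using side_near[OF assms(1), of 1 "min d E"] d E by auto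
  have wS: "w \<in> star_dom" using w side_subset(3)[OF assms(1)] by blast
  have "w \<in> B ` U" using d w by auto
  then obtain x where x: "x \<in> U" "B x = w" by blast
  then have "x \<in> fibre B w" using U by (auto simp: fibre_def)
  then obtain z where z: "z \<in> base_fibre" "x = sheet z w" using sheets_cover[OF wS] by (auto simp: bij_betw_def)
  have "x \<in> ball (a z) r1" using ea(3)[OF z(1)] wS w Ele[OF z(1)] z(2) by auto
  then have "ball (a z) r1 \<inter> ball y r1 \<noteq> {}" using x by (auto simp: U_def)
  then have "a z = y" using r1(2) ea(2)[OF z(1)] assms(2) unfolding attached_def by blast
  then show thesis using that z ea(2) by blast
qed

text \<open>The genuine cuts of the sheet \<open>z\<close>: across the rays of all other branch
  values it continues into itself. A leaf is a sheet with exactly one genuine cut.\<close>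

definition moved :: "complex \<Rightarrow> complex set" where
  "moved z = {b\<in>branch_values. \<not> crossing 1 b z z}"

lemma moved_iff: "s = 1 \<or> s = -1 \<Longrightarrow> b \<in> moved z \<longleftrightarrow> b \<in> branch_values \<and> \<not> crossing s b z z"
  using crossing_uminus[of 1 b z z] by (auto simp: moved_def)

lemma crossing_moved:
  assumes "s = 1 \<or> s = -1" "z \<in> base_fibre" "z' \<in> base_fibre" "b \<in> moved z" "crossing s b z z'"
  shows "b \<in> moved z'" "z' \<noteq> z"
proof -
  have b: "b \<in> branch_values" "\<not> crossing s b z z" using moved_iff[OF assms(1)] assms(4) by auto
  then show ne: "z' \<noteq> z" using assms(5) by auto
  have "\<not> crossing s b z' z'"
  proof
    assume "crossing s b z' z'"
    then have "crossing (- s) b z' z" "crossing (- s) b z' z'" using assms(5) by (simp_all add: crossing_uminus)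
    moreover have "- s \<noteq> 0" using assms(1) by auto
    ultimately have "z = z'" using crossing_unique[OF b(1) _ assms(2,3)] by blast
    then show False using ne by simp
  qed
  then show "b \<in> moved z'" using moved_iff[OF assms(1)] b by blast
qed

definition branch_fibres :: "complex set" where "branch_fibres = (\<Union>b\<in>branch_values. fibre B b)"

text \<open>These are the hyperedges. Sheets that reach \<open>y\<close> without being permuted are
  left out, so a hyperedge is empty or has at least two members.\<close>

definition moved_at :: "complex \<Rightarrow> complex set" where
  "moved_at y = {z\<in>base_fibre. attached z (B y) y \<and> B y \<in> moved z}"

lemma finite_branch_fibres: "finite branch_fibres"
  unfolding branch_fibres_def using finite_branch_values finite_fibre branch_values_D by auto

lemma branch_fibres_B: "y \<in> branch_fibres \<Longrightarrow> B y \<in> branch_values" "b \<in> branch_values \<Longrightarrow> y \<in> fibre B b \<Longrightarrow> y \<in> branch_fibres \<and> B y = b"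
  by (auto simp: branch_fibres_def fibre_def)

text \<open>Every point over a branch value has a sheet attached to it, so the excess of attached sheets
  is the Riemann--Hurwitz deficit.\<close>

lemma sum_moved_at: "(\<Sum>y\<in>branch_fibres. card (moved_at y) - 1) \<le> card base_fibre - 1"
proof -
  define At where "At = (\<lambda>y. {z\<in>base_fibre. attached z (B y) y})"
  have At: "finite (At y)" "moved_at y \<subseteq> At y" for y using finite_base_fibre by (auto simp: At_def moved_at_def)
  have fib: "(\<Sum>y\<in>fibre B b. card (At y) - 1) = n - card (fibre B b)" if b: "b \<in> branch_values" for b
  proof -
    have fin: "finite (fibre B b)" using finite_fibre branch_values_D[OF b] by simp
    have "base_fibre = (\<Union>y\<in>fibre B b. At y)"
    proof (intro equalityI subsetI)
      fix z assume z: "z \<in> base_fibre"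
      then obtain y where y: "attached z b y" using attached_exists[OF b] by blast
      then have "y \<in> fibre B b" by (simp add: attached_def)
      then show "z \<in> (\<Union>y\<in>fibre B b. At y)" using y z branch_fibres_B(2)[OF b] by (auto simp: At_def)
    qed (auto simp: At_def)
    then have "n = card (\<Union>y\<in>fibre B b. At y)" by (simp flip: card_base_fibre)
    also have "\<dots> = (\<Sum>y\<in>fibre B b. card (At y))"
    proof (rule card_UN_disjoint[OF fin])
      show "\<forall>i\<in>fibre B b. \<forall>j\<in>fibre B b. i \<noteq> j \<longrightarrow> At i \<inter> At j = {}"
        using attached_unique[OF b] branch_fibres_B(2)[OF b] by (auto simp: At_def)
    qed (use At in auto)
    also have "\<dots> = (\<Sum>y\<in>fibre B b. (card (At y) - 1) + 1)"
    proof (rule sum.cong[OF refl])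
      fix y assume y: "y \<in> fibre B b"
      then obtain z where "z \<in> base_fibre" "attached z b y" using attached_surj[OF b] by blast
      then have "z \<in> At y" using branch_fibres_B(2)[OF b y] by (simp add: At_def)
      then have "card (At y) > 0" using At(1) by (auto simp: card_gt_0_iff)
      then show "card (At y) = (card (At y) - 1) + 1" by simp
    qed
    also have "\<dots> = (\<Sum>y\<in>fibre B b. card (At y) - 1) + card (fibre B b)" by (simp only: sum.distrib) simp
    finally show ?thesis by simp
  qed
  have "(\<Sum>y\<in>branch_fibres. card (moved_at y) - 1) \<le> (\<Sum>y\<in>branch_fibres. card (At y) - 1)"
    using At by (intro sum_mono diff_le_mono card_mono) auto
  also have "\<dots> = (\<Sum>b\<in>branch_values. \<Sum>y\<in>fibre B b. card (At y) - 1)"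
    unfolding branch_fibres_def
  proof (rule sum.UNION_disjoint[OF finite_branch_values])
    show "\<forall>b\<in>branch_values. finite (fibre B b)" using finite_fibre branch_values_D by blast
    show "\<forall>i\<in>branch_values. \<forall>j\<in>branch_values. i \<noteq> j \<longrightarrow> fibre B i \<inter> fibre B j = {}" by (auto simp: fibre_def)
  qed
  also have "\<dots> = (\<Sum>b\<in>branch_values. n - card (fibre B b))" using fib by simp
  also have "\<dots> \<le> n - 1" using finite_branch_values branch_values_D by (intro Riemann_Hurwitz) auto
  finally show ?thesis by (simp add: card_base_fibre)
qed

lemma moved_at_moved:
  assumes "z \<in> base_fibre" "b \<in> moved z"
  obtains y where "y \<in> branch_fibres" "B y = b" "z \<in> moved_at y"
proof -
  have b: "b \<in> branch_values" using assms by (simp add: moved_def)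
  obtain y where y: "attached z b y" using attached_exists[OF b assms(1)] .
  then have "y \<in> fibre B b" by (simp add: attached_def)
  then show thesis using that[of y] branch_fibres_B(2)[OF b] y assms by (simp add: moved_at_def)
qed

lemma moved_at_same:
  assumes "y \<in> branch_fibres" "y' \<in> branch_fibres" "z \<in> moved_at y" "z \<in> moved_at y'" "B y = B y'" shows "y = y'"
  using assms attached_unique[of "B y" z y y'] branch_fibres_B(1) by (simp add: moved_at_def)

text \<open>Over each branch value the sheet has exactly one limit point, so vertex degrees in the
  hypergraph count genuine cuts.\<close>

lemma card_moved:
  assumes "z \<in> base_fibre" shows "card {y\<in>branch_fibres. z \<in> moved_at y} = card (moved z)"
proof -
  have "bij_betw B {y\<in>branch_fibres. z \<in> moved_at y} (moved z)"
    unfolding bij_betw_def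
  proof
    show "inj_on B {y\<in>branch_fibres. z \<in> moved_at y}"
    proof (rule inj_onI)
      fix y y' assume "y \<in> {y\<in>branch_fibres. z \<in> moved_at y}" "y' \<in> {y\<in>branch_fibres. z \<in> moved_at y}" "B y = B y'"
      then show "y = y'" using moved_at_same[of y y' z] by simp
    qed
    show "B ` {y\<in>branch_fibres. z \<in> moved_at y} = moved z"
    proof (intro equalityI subsetI)
      fix b assume "b \<in> moved z"
      then obtain y where "y \<in> branch_fibres" "B y = b" "z \<in> moved_at y" using moved_at_moved[OF assms] by blast
      then show "b \<in> B ` {y\<in>branch_fibres. z \<in> moved_at y}" by blast
    qed (auto simp: moved_at_def)
  qed
  then show ?thesis by (rule bij_betw_same_card)
qed

lemma moved_at_crossing:
  assumes "s = 1 \<or> s = -1" "y \<in> branch_fibres" "z \<in> moved_at y"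
  obtains z' where "z' \<in> moved_at y" "z' \<noteq> z" "crossing s (B y) z z'"
proof -
  have z: "z \<in> base_fibre" "attached z (B y) y" "B y \<in> moved z" using assms(3) by (auto simp: moved_at_def)
  have s: "s \<noteq> 0" using assms(1) by auto
  obtain z' where z': "z' \<in> base_fibre" "crossing s (B y) z z'" using crossing_exists[OF branch_fibres_B(1)[OF assms(2)] z(1) s] .
  have "B y \<in> moved z'" "z' \<noteq> z" using crossing_moved[OF assms(1) z(1) z'(1) z(3) z'(2)] by auto
  moreover have "attached z' (B y) y"
    using crossing_attached[OF branch_fibres_B(1)[OF assms(2)] z(1) z'(1) s z'(2) z(2)] .
  ultimately show thesis using that[of z'] z' by (simp add: moved_at_def)
qed

section \<open>Extending a sheet across the rays at which it is not permuted\<close>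

definition xdom :: "complex \<Rightarrow> complex set" where
  "xdom z = ball 0 1 - (\<Union>b\<in>moved z. ray b)"

lemma open_xdom: "open (xdom z)"
  unfolding xdom_def using finite_branch_values closed_ray by (intro open_Diff open_ball closed_UN) (auto simp: moved_def)

lemma ray_subset_wedge_at: assumes "b \<in> branch_values" "w \<in> ray b" "cmod w < 1" shows "w \<in> wedge_at b"
  using assms aperture(1)[OF assms(1)] by (auto simp: ray_def wedge_at_def wedge_def)

text \<open>Three kinds of pieces fit together: the sheet on the cut disc, its lift across each
  harmless ray, and its limit at the tip of that ray.\<close>

lemma extension_exists:
  assumes z: "z \<in> base_fibre"
  shows "\<exists>g. lift (xdom z) g \<and> (\<forall>w\<in>star_dom. g w = sheet z w)"
proof -
  define N where "N = branch_values - moved z"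
  have "\<exists>h. lift (inner_wedge b) h \<and> (\<forall>w\<in>side (- 1) b. h w = sheet z w) \<and> (\<forall>w\<in>side 1 b. h w = sheet z w)" if "b \<in> N" for b
    using that by (auto simp: N_def moved_def crossing_def)
  then obtain hh where hh: "\<And>b. b \<in> N \<Longrightarrow> lift (inner_wedge b) (hh b)"
    "\<And>b w. b \<in> N \<Longrightarrow> w \<in> side (- 1) b \<Longrightarrow> hh b w = sheet z w" 
    "\<And>b w. b \<in> N \<Longrightarrow> w \<in> side 1 b \<Longrightarrow> hh b w = sheet z w" by metis
  have "\<exists>y. attached z b y" if "b \<in> branch_values" for b using attached_exists[OF that z] by blast
  then obtain a where a: "\<And>b. b \<in> branch_values \<Longrightarrow> attached z b (a b)" by metis
  have NV: "b \<in> branch_values" if "b \<in> N" for b using that by (simp add: N_def)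
  define bb where "bb = (\<lambda>w. THE b. b \<in> branch_values \<and> w \<in> ray b)"
  have bb: "bb w = b" if "b \<in> branch_values" "w \<in> ray b" "cmod w < 1" for b w
    unfolding bb_def
  proof (rule the_equality)
    show "b' = b" if "b' \<in> branch_values \<and> w \<in> ray b'" for b'
      using wedge_at_other_ray[OF \<open>b \<in> branch_values\<close>, of b' w] that ray_subset_wedge_at[OF \<open>b \<in> branch_values\<close> \<open>w \<in> ray b\<close> \<open>cmod w < 1\<close>] by blast
  qed (use that in auto)
  define g where "g = (\<lambda>w. if w \<in> star_dom then sheet z w else if w \<in> branch_values then a w else hh (bb w) w)"
  have gS0: "g w = sheet z w" if "w \<in> star_dom" for w using that by (simp add: g_def)
  have gb: "g b = a b" if "b \<in> branch_values" for b using that star_dom_subset by (auto simp: g_def)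
  have gWin: "g w = hh b w" if b: "b \<in> N" and w: "w \<in> inner_wedge b" for b w
  proof (cases "Im (w / b) = 0")
    case True
    then have wr: "w \<in> ray b" using w by (auto simp: inner_wedge_def coray_def ray_def)
    then have "w \<notin> star_dom" using NV[OF b] by (auto simp: star_dom_def)
    moreover have "w \<notin> branch_values" "cmod w < 1" using inner_wedge_subset[OF NV[OF b]] w by auto
    ultimately show ?thesis using bb[OF NV[OF b] wr] by (simp add: g_def)
  next
    case False
    then have "w \<in> side 1 b \<or> w \<in> side (- 1) b" using w by (auto simp: side_def inner_wedge_def)
    then show ?thesis using gS0 side_subset(3)[OF NV[OF b]] hh(2,3)[OF b] by fastforce
  qed
  have cases: "w \<in> star_dom \<or> w \<in> N \<or> (\<exists>b\<in>N. w \<in> inner_wedge b)" if w: "w \<in> xdom z" for w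
  proof (rule ccontr)
    assume *: "\<not> (w \<in> star_dom \<or> w \<in> N \<or> (\<exists>b\<in>N. w \<in> inner_wedge b))"
    have w1: "cmod w < 1" using w by (simp add: xdom_def)
    then obtain b where b: "b \<in> branch_values" "w \<in> ray b" using * by (auto simp: star_dom_def)
    then have bN: "b \<in> N" using w by (auto simp: N_def xdom_def)
    have "Re (w / b) \<noteq> 1"
    proof
      assume "Re (w / b) = 1"
      then have "w / b = 1" using b(2) by (simp add: ray_def complex_eq_iff)
      then have "w = b" using branch_values_D(2)[OF b(1)] by simp
      then show False using * bN by simp
    qed
    then have "w \<in> inner_wedge b" using b ray_subset_wedge_at[OF b w1] by (auto simp: inner_wedge_def coray_def ray_def)
    then show False using * bN by blast
  qed
  have fib: "g w \<in> fibre B w" if "w \<in> xdom z" for w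
    using cases[OF that]
  proof (elim disjE bexE)
    show "g w \<in> fibre B w" if "w \<in> star_dom" using gS0[OF that] sheet(1)[OF z] that by (simp add: lift_def)
    show "g w \<in> fibre B w" if "w \<in> N" using gb[of w] a[of w] NV[OF that] by (simp add: attached_def)
    show "g w \<in> fibre B w" if "b \<in> N" "w \<in> inner_wedge b" for b using gWin[OF that] hh(1)[OF that(1)] that by (simp add: lift_def)
  qed
  have "isCont g w" if "w \<in> xdom z" for w
    using cases[OF that]
  proof (elim disjE bexE)
    assume w: "w \<in> star_dom"
    have "continuous_on star_dom g" using sheet(1)[OF z] gS0 by (simp add: lift_def cong: continuous_on_cong)
    then show "isCont g w" using open_star_dom w by (simp add: continuous_on_eq_continuous_at)
  next
    fix b assume b: "b \<in> N" "w \<in> inner_wedge b"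
    have "continuous_on (inner_wedge b) g" using hh(1)[OF b(1)] gWin[OF b(1)] by (simp add: lift_def cong: continuous_on_cong)
    then show "isCont g w" using open_inner_wedge b by (simp add: continuous_on_eq_continuous_at)
  next
    assume w: "w \<in> N"
    show "isCont g w"
      unfolding continuous_at_eps_delta
    proof (intro allI impI)
      fix r :: real assume r: "r > 0"
      obtain e1 where e1: "e1 > 0" "ball w e1 \<subseteq> wedge_at w" "\<And>x. x \<in> inner_wedge w \<inter> ball w e1 \<Longrightarrow> hh w x \<in> ball (a w) r"
        using lift_attached[OF NV[OF w] z, of 1 "hh w" "a w" r] hh(1,3)[OF w] a[OF NV[OF w]] r by (metis zero_neq_one)
      obtain e2 where e2: "e2 > 0" "\<forall>x\<in>star_dom \<inter> ball w e2. sheet z x \<in> ball (a w) r"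
        using a[OF NV[OF w]] r unfolding attached_def by blast
      show "\<exists>d>0. \<forall>x. dist x w < d \<longrightarrow> dist (g x) (g w) < r"
      proof (intro exI conjI allI impI)
        show "min e1 e2 > 0" using e1 e2 by simp
        fix x assume "dist x w < min e1 e2"
        then have x: "x \<in> ball w e1" "x \<in> ball w e2" by (auto simp: dist_commute)
        \<comment> \<open>Near the tip every other point is off the ray or strictly beyond the tip
          on it; in both cases the value is close to the common limit \<open>a w\<close>.\<close>
        have "x \<in> star_dom \<or> x = w \<or> x \<in> inner_wedge w"
        proof (rule ccontr)
          assume *: "\<not> (x \<in> star_dom \<or> x = w \<or> x \<in> inner_wedge w)"
          have xW: "x \<in> wedge_at w" using x e1 by blast
          then have "x \<in> ray w" "x \<in> coray w" using wedge_at_star_dom[OF NV[OF w]] * by (auto simp: inner_wedge_def)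
          then have "x / w = 1" by (simp add: ray_def coray_def complex_eq_iff)
          then show False using * branch_values_D(2)[OF NV[OF w]] by simp
        qed
        then have "g x \<in> ball (g w) r"
        proof (elim disjE)
          show "g x \<in> ball (g w) r" if "x \<in> star_dom" using gS0[OF that] gb[OF NV[OF w]] e2(2) that x by simp
          show "g x \<in> ball (g w) r" if "x = w" using that r by simp
          show "g x \<in> ball (g w) r" if "x \<in> inner_wedge w" using gWin[OF w that] gb[OF NV[OF w]] e1(3) that x by simp
        qed
        then show "dist (g x) (g w) < r" by (simp add: dist_commute)
      qed
    qed
  qed
  then have "continuous_on (xdom z) g" by (simp add: continuous_at_imp_continuous_on)
  then show ?thesis using fib gS0 unfolding lift_def by blast
qed

definition ext :: "complex \<Rightarrow> complex \<Rightarrow> complex" where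
  "ext z = (SOME g. lift (xdom z) g \<and> (\<forall>w\<in>star_dom. g w = sheet z w))"

lemma ext: assumes "z \<in> base_fibre" shows "lift (xdom z) (ext z)" "\<And>w. w \<in> star_dom \<Longrightarrow> ext z w = sheet z w"
  using someI_ex[OF extension_exists[OF assms]] unfolding ext_def by auto

end

subsection \<open>Gluing neighbouring sheets\<close>

context generic_disc_map
begin

text \<open>Off the branch values \<open>F\<close> is locally a holomorphic inverse of
  \<open>B\<close> composed with \<psi>. At the finitely many exceptional points continuity makes
  the singularity removable.\<close>

lemma lift_holomorphic:
  assumes T: "open T" and F: "continuous_on T F" "\<And>t. t \<in> T \<Longrightarrow> F t \<in> fibre B (\<psi> t)"
    and \<psi>: "\<psi> holomorphic_on T" "\<And>t. t \<in> T \<Longrightarrow> cmod (\<psi> t) < 1" and fin: "finite {t\<in>T. \<psi> t \<in> branch_values}"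
  shows "F holomorphic_on T"
proof (rule no_isolated_singularity[OF F(1) _ T fin])
  show "F holomorphic_on T - {t\<in>T. \<psi> t \<in> branch_values}"
    unfolding holomorphic_on_def
  proof
    fix t assume t: "t \<in> T - {t\<in>T. \<psi> t \<in> branch_values}"
    define z where "z = F t"
    have z: "cmod z < 1" "B z = \<psi> t" using F(2)[of t] t by (auto simp: z_def fibre_def)
    have "card (fibre B (\<psi> t)) = n" using t \<psi>(2)[of t] by (auto simp: branch_values_def)
    then have "deriv B z \<noteq> 0" using deriv_nz[of "\<psi> t" z] \<psi>(2)[of t] t z by (auto simp: fibre_def)
    then obtain r where r: "r > 0" "ball z r \<subseteq> ball 0 1" "inj_on B (ball z r)"
      using has_complex_derivative_locally_injective[OF holB, of z] z by auto
    have holr: "B holomorphic_on ball z r" using holB r(2) holomorphic_on_subset by blast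
    obtain g where g: "g holomorphic_on (B ` ball z r)" "\<And>x. x \<in> ball z r \<Longrightarrow> g (B x) = x"
      using holomorphic_has_inverse[OF holr open_ball r(3)] by metis
    define T' where "T' = T \<inter> F -` ball z r"
    have T': "open T'" "t \<in> T'" "T' \<subseteq> T"
      using continuous_open_preimage[OF F(1) T open_ball] t r(1) by (auto simp: T'_def z_def)
    have \<psi>T': "\<psi> ` T' \<subseteq> B ` ball z r"
    proof
      fix w assume "w \<in> \<psi> ` T'"
      then obtain x where x: "x \<in> T'" "w = \<psi> x" by blast
      then have "B (F x) = w" "F x \<in> ball z r" using F(2)[of x] by (auto simp: T'_def fibre_def)
      then show "w \<in> B ` ball z r" by blast
    qed
    have "(g \<circ> \<psi>) holomorphic_on T'"
      using \<psi>(1) T'(3) holomorphic_on_subset g(1) \<psi>T' by (intro holomorphic_on_compose_gen) auto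
    moreover have "(g \<circ> \<psi>) x = F x" if "x \<in> T'" for x
    proof -
      have "\<psi> x = B (F x)" "F x \<in> ball z r" using F(2)[of x] that by (auto simp: T'_def fibre_def)
      then show ?thesis using g(2) by simp
    qed
    ultimately have "F holomorphic_on T'" by (metis holomorphic_transform)
    then have "F field_differentiable at t" using T' by (simp add: holomorphic_on_imp_differentiable_at)
    then show "F field_differentiable (at t within T - {t\<in>T. \<psi> t \<in> branch_values})"
      by (rule field_differentiable_at_within)
  qed
qed

lemma ext_holomorphic: assumes "z \<in> base_fibre" shows "ext z holomorphic_on xdom z"
proof (rule lift_holomorphic[OF open_xdom, where \<psi> = "\<lambda>w. w"])
  show "continuous_on (xdom z) (ext z)" "\<And>t. t \<in> xdom z \<Longrightarrow> ext z t \<in> fibre B t"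
    using ext(1)[OF assms] by (auto simp: lift_def)
  show "finite {t \<in> xdom z. t \<in> branch_values}" using finite_branch_values by simp
qed (auto simp: xdom_def)

lemma half_disc_square: assumes "t \<in> half_disc" shows "\<not> (Im (t\<^sup>2) = 0 \<and> Re (t\<^sup>2) \<ge> 0)"
proof
  assume *: "Im (t\<^sup>2) = 0 \<and> Re (t\<^sup>2) \<ge> 0"
  have "Im t > 0" using assms by (simp add: half_disc_def)
  moreover have "Re t = 0" using * \<open>Im t > 0\<close> by (simp add: Im_power2)
  ultimately show False using * by (simp add: Re_power2)
qed

text \<open>The sheet extends to the disc minus the slit from \<open>u / 49\<close> to
  \<open>u\<close>, and \<open>u * m t\<close> parametrises this slit disc by the half-disc. A sheet
  without cuts is included.\<close>

lemma outer_slit_bound: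
  assumes z: "z \<in> base_fibre" and u: "cmod u = 1"
    and out: "\<And>b. b \<in> moved z \<Longrightarrow> b = of_real (cmod b) * u \<and> cmod b \<ge> 1/49"
  shows "\<exists>z\<in>ball 0 1. 0.695356 \<le> cmod (deriv B z) * (1 - (cmod z)\<^sup>2)"
proof -
  define m where "m = (\<lambda>t::complex. (t\<^sup>2 + 1/49) / (1 + t\<^sup>2 / 49))"
  have den: "1 + t\<^sup>2 / 49 \<noteq> 0" and m1: "cmod (m t) < 1" if "t \<in> half_disc" for t
  proof -
    have t1: "cmod (t\<^sup>2) < 1" using that by (simp add: half_disc_def norm_power abs_square_less_1)
    show d: "1 + t\<^sup>2 / 49 \<noteq> 0"
    proof
      assume "1 + t\<^sup>2 / 49 = 0"
      moreover have "t\<^sup>2 = 49 * (1 + t\<^sup>2 / 49) - 49" by simp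
      ultimately have "t\<^sup>2 = - 49" by simp
      then show False using t1 by simp
    qed
    have "(cmod (t\<^sup>2 + 1/49))\<^sup>2 < (cmod (1 + t\<^sup>2/49))\<^sup>2"
    proof -
      define x where "x = Re (t\<^sup>2)"
      define y where "y = Im (t\<^sup>2)"
      have "x\<^sup>2 + y\<^sup>2 < 1" using t1 by (simp add: x_def y_def abs_square_less_1 flip: cmod_power2)
      moreover have "(cmod (1 + t\<^sup>2/49))\<^sup>2 - (cmod (t\<^sup>2 + 1/49))\<^sup>2 = (1 - 1/2401) * (1 - (x\<^sup>2 + y\<^sup>2))"
        unfolding cmod_power2 by (simp add: x_def y_def algebra_simps power2_eq_square[of "_ + _"] power2_eq_square[of "_ / _"] del: Re_power2 Im_power2)
          (simp add: power2_eq_square)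
      ultimately show ?thesis by simp
    qed
    then have "cmod (t\<^sup>2 + 1/49) < cmod (1 + t\<^sup>2/49)" by (rule power2_less_imp_less) simp
    then show "cmod (m t) < 1" using d by (simp add: m_def norm_divide)
  qed
  have in_xdom: "u * m t \<in> xdom z" if t: "t \<in> half_disc" for t
  proof -
    have "cmod (u * m t) < 1" using m1[OF t] u by (simp add: norm_mult)
    moreover have "u * m t \<notin> ray b" if b: "b \<in> moved z" for b
    proof
      assume r: "u * m t \<in> ray b"
      define v where "v = Re (m t)"
      have cb: "cmod b > 0" using out[OF b] by linarith
      have "u \<noteq> 0" using u by auto
      then have "u * m t / b = m t / of_real (cmod b)"
        using out[OF b] cb by (metis mult_divide_mult_cancel_right mult.commute)
      then have "Im (m t) / cmod b = 0" "v / cmod b \<ge> 1" using r by (simp_all add: ray_def v_def)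
      then have mv: "m t = of_real v" "v \<ge> cmod b" using cb by (auto simp: v_def complex_eq_iff pos_le_divide_eq)
      then have v: "v \<ge> 1/49" "v < 1" using out[OF b] m1[OF t] by auto
      have "t\<^sup>2 + 1/49 = of_real v * (1 + t\<^sup>2 / 49)" using mv(1) den[OF t] by (metis m_def nonzero_divide_eq_eq)
      \<comment> \<open>Solving \<open>m t = v\<close> for \<open>t^2\<close> gives a nonnegative
        real, but squares of half-disc points avoid the nonnegative axis.\<close>
      then have "t\<^sup>2 * of_real (1 - v / 49) = of_real (v - 1/49)" by (simp add: algebra_simps)
      then have "t\<^sup>2 = of_real (v - 1/49) / of_real (1 - v / 49)" using v by (simp add: eq_divide_eq del: of_real_diff)
      also have "\<dots> = of_real ((v - 1/49) / (1 - v / 49))" by simp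
      finally have t2: "t\<^sup>2 = of_real ((v - 1/49) / (1 - v / 49))" .
      have "(v - 1/49) / (1 - v / 49) \<ge> 0" using v by simp
      then show False using half_disc_square[OF t] unfolding t2 by (simp del: of_real_divide of_real_diff)
    qed
    ultimately show ?thesis by (auto simp: xdom_def)
  qed
  have holm: "(\<lambda>t. u * m t) holomorphic_on half_disc"
    unfolding m_def using den by (auto intro!: holomorphic_intros)
  have "(ext z \<circ> (\<lambda>t. u * m t)) holomorphic_on half_disc"
    using holm ext_holomorphic[OF z] in_xdom by (intro holomorphic_on_compose_gen) auto
  moreover have "cmod ((ext z \<circ> (\<lambda>t. u * m t)) t) < 1 \<and> B ((ext z \<circ> (\<lambda>t. u * m t)) t) = u * m t" if "t \<in> half_disc" for t
    using ext(1)[OF z] in_xdom[OF that] by (auto simp: lift_def fibre_def)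
  ultimately show ?thesis
    using Bloch_from_slit_disc_lift[OF holB _ _ u, of "ext z \<circ> (\<lambda>t. u * m t)"] unfolding m_def by blast
qed

lemma in_ray_iff:
  assumes "b \<noteq> 0" shows "w \<in> ray b \<longleftrightarrow> (\<exists>r\<ge>1. w = of_real r * b)"
proof
  assume "w \<in> ray b"
  then have "w / b = of_real (Re (w / b))" "Re (w / b) \<ge> 1" by (auto simp: ray_def complex_eq_iff)
  then show "\<exists>r\<ge>1. w = of_real r * b" using assms by (metis nonzero_divide_eq_eq)
qed (use assms in \<open>auto simp: ray_def\<close>)

text \<open>A half-turn starting at the ray of \<open>b1\<close>, counterclockwise for
  \<open>s = 1\<close>, outside the threshold radius.\<close>

definition half_ring :: "real \<Rightarrow> complex \<Rightarrow> complex set" where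
  "half_ring s b = {w. cmod w < 1 \<and> 1/49 < cmod w \<and> s * Im (w / b) > 0}"

lemma open_half_ring: "open (half_ring s b)"
  unfolding half_ring_def divide_inverse by (intro open_Collect_conj open_Collect_less continuous_intros)

text \<open>Starting next to the ray of \<open>b1\<close> on the sheet \<open>J\<close>, one reaches at most one further ray at which \<open>J\<close> has to be left,
  because the next sheet \<open>J'\<close> is a leaf.\<close>

lemma half_ring_continuation:
  assumes s: "s = 1 \<or> s = -1" and b1: "b1 \<in> branch_values" and J: "J \<in> base_fibre"
    and nxt: "\<And>b. b \<in> moved J \<Longrightarrow> s * Im (b / b1) > 0 \<Longrightarrow>
      cmod b < 1/49 \<and> (\<exists>J'\<in>base_fibre. crossing s b J J' \<and> moved J' = {b})"
  obtains G where "lift (half_ring s b1) G" "\<And>w. w \<in> half_ring s b1 \<Longrightarrow> w \<in> side s b1 \<Longrightarrow> G w = sheet J w"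
proof -
  have b10: "b1 \<noteq> 0" using branch_values_D[OF b1] by simp
  have s0: "s \<noteq> 0" "s * s = 1" using s by auto
  define A where "A = {b\<in>moved J. s * Im (b / b1) > 0}"
  have sideS: "w \<in> star_dom" if "w \<in> side s b1" for w using that side_subset(3)[OF b1] by blast
  have Im_scale: "Im (of_real r * b / c) = r * Im (b / c)" for r and b c :: complex
    by (simp flip: times_divide_eq_right)
  show thesis
  proof (cases "A = {}")
    case True
    have "half_ring s b1 \<subseteq> xdom J"
    proof
      fix w assume w: "w \<in> half_ring s b1"
      have "w \<notin> ray b" if b: "b \<in> moved J" for b
      proof
        have "b \<noteq> 0" using b branch_values_D(2) by (auto simp: moved_def)
        moreover assume "w \<in> ray b"
        ultimately obtain r where r: "r \<ge> 1" "w = of_real r * b" by (auto simp: in_ray_iff)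
        then have "0 < s * (r * Im (b / b1))" using w by (simp add: half_ring_def Im_scale)
        then have "0 < r * (s * Im (b / b1))" by (simp add: mult.left_commute)
        then have "s * Im (b / b1) > 0" using r(1) by (simp add: zero_less_mult_iff)
        then show False using True b by (auto simp: A_def)
      qed
      then show "w \<in> xdom J" using w by (auto simp: xdom_def half_ring_def)
    qed
    then have "lift (half_ring s b1) (ext J)" using lift_subset[OF ext(1)[OF J]] by blast
    then show thesis using that ext(2)[OF J] sideS by blast
  next
    case False
    \<comment> \<open>The cotangent of the angle from \<open>b1\<close>, measured in direction
      \<open>s\<close>. It decreases along the half-turn, so its maximum over \<open>A\<close> marks
      the first ray met.\<close>
    define c where "c = (\<lambda>w. Re (w / b1) / (s * Im (w / b1)))"
    have finA: "finite A" using finite_branch_values by (auto simp: A_def moved_def)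
    obtain b2 where b2': "b2 \<in> A" "c b2 = Max (c ` A)"
      using Max_in[of "c ` A"] finA False by fastforce
    then have "c b \<le> c b2" if "b \<in> A" for b using finA that by simp
    then have b2: "b2 \<in> moved J" "b2 \<in> branch_values" "s * Im (b2 / b1) > 0" and b2max: "\<And>b. b \<in> A \<Longrightarrow> c b \<le> c b2"
      using b2'(1) by (auto simp: A_def moved_def)
    have b20: "b2 \<noteq> 0" using branch_values_D[OF b2(2)] by simp
    have cancel: "x * (a / x) = a" if "x > 0" for x a :: real using that by simp
    have quot_pos: "x * y * d / k > 0" if "x > 0" "y > 0" "d > 0" "k > 0" for x y d k :: real using that by simp
    have quot_neg: "x * y * d / k < 0" if "x > 0" "y > 0" "d < 0" "k > 0" for x y d k :: real
      using quot_pos[of x y "- d" k] that by simp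
    text \<open>For points of the half-plane, the sign of the imaginary part of a quotient compares
      the cotangents of their angles with \<open>b1\<close>.\<close>
    have cmp: "s * Im (w / b) = s * Im (w / b1) * (s * Im (b / b1)) * (c b - c w) / (cmod (b / b1))\<^sup>2"
      if "s * Im (w / b1) > 0" "s * Im (b / b1) > 0" for w b
    proof -
      define \<omega> where "\<omega> = w / b1"
      define \<beta> where "\<beta> = b / b1"
      have "w / b = \<omega> / \<beta>" using b10 by (simp add: \<omega>_def \<beta>_def)
      also have "\<dots> = \<omega> * cnj \<beta> / of_real ((cmod \<beta>)\<^sup>2)" by (rule complex_div_cnj)
      finally have "Im (w / b) = Im (\<omega> * cnj \<beta>) / (cmod \<beta>)\<^sup>2" by (simp only: Im_divide_of_real)
      moreover have "s * Im (\<omega> * cnj \<beta>) = s * Im \<omega> * (s * Im \<beta>) * (c b - c w)"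
      proof -
        have "s * Im \<omega> * (s * Im \<beta>) * (c b - c w) = s * Im \<omega> * ((s * Im \<beta>) * c b) - (s * Im \<beta>) * ((s * Im \<omega>) * c w)"
          by (simp add: algebra_simps)
        also have "(s * Im \<beta>) * c b = Re \<beta>" unfolding c_def \<beta>_def by (rule cancel[OF that(2)])
        also have "(s * Im \<omega>) * c w = Re \<omega>" unfolding c_def \<omega>_def by (rule cancel[OF that(1)])
        finally show ?thesis by (simp add: algebra_simps)
      qed
      ultimately show ?thesis by (simp add: \<omega>_def \<beta>_def)
    qed
    \<comment> \<open>All other rays of \<open>A\<close> come strictly after that of
      \<open>b2\<close>, because distinct branch values have distinct rays. Hence before
      \<open>b2\<close> nothing obstructs the sheet \<open>J\<close>.\<close>
    have far: "s * Im (b / b2) > 0" if b: "b \<in> A" "b \<noteq> b2" for b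
    proof -
      have bs: "s * Im (b / b1) > 0" "b \<in> branch_values" using b by (auto simp: A_def moved_def)
      have "c b \<noteq> c b2"
      proof
        assume ceq: "c b = c b2"
        have "s * Im (b / b2) = 0" using cmp[OF bs(1) b2(3)] ceq by simp
        then have im0: "Im (b / b2) = 0" using s0 by simp
        then have "b / b2 = of_real (Re (b / b2))" by (simp add: complex_eq_iff)
        then have "b = of_real (Re (b / b2)) * b2" using b20 by (metis nonzero_divide_eq_eq)
        then have "Im (b / b1) = Re (b / b2) * Im (b2 / b1)" by (metis Im_scale)
        then have "0 < Re (b / b2) * (s * Im (b2 / b1))" using bs by (simp add: mult.left_commute)
        then have "Re (b / b2) > 0" using b2(3) by (simp add: zero_less_mult_iff)
        then show False using branch_values_rays[OF b2(2) bs(2) im0] b(2) by simp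
      qed
      then have "c b2 - c b > 0" using b2max[OF b(1)] by simp
      moreover have "(cmod (b2 / b1))\<^sup>2 > 0" using b10 b20 by simp
      ultimately show ?thesis unfolding cmp[OF bs(1) b2(3)] by (rule quot_pos[OF bs(1) b2(3)])
    qed
    obtain J' where J': "J' \<in> base_fibre" "crossing s b2 J J'" "moved J' = {b2}" and b2small: "cmod b2 < 1/49"
      using nxt[OF b2(1,3)] by blast
    obtain h where h: "lift (inner_wedge b2) h" "\<forall>w\<in>side (- s) b2. h w = sheet J w" "\<forall>w\<in>side s b2. h w = sheet J' w"
      using J'(2) unfolding crossing_def by (elim exE conjE)
    \<comment> \<open>\<open>J\<close> is used before the ray of \<open>b2\<close>, the leaf
      \<open>J'\<close> after it, and the lift \<open>h\<close> on the ray itself, where it joins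
      the two.\<close>
    define G where "G = (\<lambda>w. if s * Im (w / b2) < 0 then ext J w else if s * Im (w / b2) > 0 then ext J' w else h w)"
    define R1 where "R1 = half_ring s b1 \<inter> {w. s * Im (w / b2) < 0}"
    define R2 where "R2 = half_ring s b1 \<inter> inner_wedge b2"
    define R3 where "R3 = half_ring s b1 \<inter> {w. s * Im (w / b2) > 0}"
    have op: "open R1" "open R2" "open R3"
      unfolding R1_def R2_def R3_def divide_inverse
      by (intro open_Int open_half_ring open_inner_wedge open_Collect_less continuous_intros)+
    have R1: "R1 \<subseteq> xdom J"
    proof
      fix w assume w: "w \<in> R1"
      have "w \<notin> ray b" if b: "b \<in> moved J" for b
      proof
        have "b \<noteq> 0" using b branch_values_D(2) by (auto simp: moved_def)
        moreover assume "w \<in> ray b"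
        ultimately obtain r where r: "r \<ge> 1" "w = of_real r * b" by (auto simp: in_ray_iff)
        then have "0 < r * (s * Im (b / b1))" "r * (s * Im (b / b2)) < 0"
          using w by (simp_all add: half_ring_def R1_def Im_scale mult.left_commute)
        then have "s * Im (b / b1) > 0" "s * Im (b / b2) < 0" using r(1) by (simp_all add: zero_less_mult_iff mult_less_0_iff)
        then have "b \<in> A" "b \<noteq> b2" using b b20 by (auto simp: A_def)
        then show False using far \<open>s * Im (b / b2) < 0\<close> by fastforce
      qed
      then show "w \<in> xdom J" using w by (auto simp: xdom_def half_ring_def R1_def)
    qed
    have R3: "R3 \<subseteq> xdom J'"
      by (auto simp: R3_def xdom_def half_ring_def J'(3) ray_def)
    have cover: "w \<in> R1 \<or> w \<in> R2 \<or> w \<in> R3" if w: "w \<in> half_ring s b1" for w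
    proof (cases "s * Im (w / b2) = 0")
      case True
      then have im0: "Im (w / b2) = 0" using s0 by simp
      define r where "r = Re (w / b2)"
      have "w / b2 = of_real r" using im0 by (simp add: r_def complex_eq_iff)
      then have wr: "w = of_real r * b2" using b20 by (metis nonzero_divide_eq_eq)
      then have "Im (w / b1) = r * Im (b2 / b1)" by (metis Im_scale)
      then have "0 < r * (s * Im (b2 / b1))" using w by (simp add: half_ring_def mult.left_commute)
      then have r0: "r > 0" using b2(3) by (simp add: zero_less_mult_iff)
      have "cmod w = r * cmod b2" unfolding wr using r0 by (simp add: norm_mult)
      then have "r * cmod b2 < 1" "1/49 < r * cmod b2" using w by (auto simp: half_ring_def)
      moreover have "r > 1"
      proof (rule ccontr)
        assume "\<not> r > 1"
        then have "r * cmod b2 \<le> 1 * cmod b2" by (intro mult_right_mono) auto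
        then show False using \<open>1/49 < r * cmod b2\<close> b2small by simp
      qed
      ultimately have "w \<in> inner_wedge b2"
        using wedge_at_real[OF b2(2) r0] b20 unfolding wr by (auto simp: inner_wedge_def coray_def)
      then show ?thesis using w by (simp add: R2_def)
    qed (use w in \<open>auto simp: R1_def R3_def\<close>)
    have G1: "G w = ext J w" if "w \<in> R1" for w using that by (simp add: G_def R1_def)
    have G3: "G w = ext J' w" if "w \<in> R3" for w using that by (simp add: G_def R3_def)
    have G2: "G w = h w" if w: "w \<in> R2" for w
    proof -
      have wedge_at: "w \<in> wedge_at b2" using w by (simp add: R2_def inner_wedge_def)
      consider "s * Im (w / b2) < 0" | "s * Im (w / b2) > 0" | "s * Im (w / b2) = 0" by linarith
      then show ?thesis
      proof cases
        case 1
        then have "w \<in> side (- s) b2" using wedge_at by (simp add: side_def)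
        then show ?thesis using 1 h(2) side_subset(3)[OF b2(2)] ext(2)[OF J] by (auto simp: G_def)
      next
        case 2
        then have "w \<in> side s b2" using wedge_at by (simp add: side_def)
        then show ?thesis using 2 h(3) side_subset(3)[OF b2(2)] ext(2)[OF J'(1)] by (auto simp: G_def)
      next
        case 3
        show ?thesis unfolding G_def 3 by simp
      qed
    qed
    have l1: "lift R1 (ext J)" using lift_subset[OF ext(1)[OF J] R1] .
    have l2: "lift R2 h" using lift_subset[OF h(1)] by (simp add: R2_def)
    have l3: "lift R3 (ext J')" using lift_subset[OF ext(1)[OF J'(1)] R3] .
    have eqU: "half_ring s b1 = R1 \<union> (R2 \<union> R3)" using cover by (auto simp: R1_def R2_def R3_def)
    have "lift R1 G" "lift R2 G" "lift R3 G"
      using l1 l2 l3 G1 G2 G3 by (auto simp: lift_def cong: continuous_on_cong)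
    then have "lift (half_ring s b1) G"
      unfolding eqU lift_def using op by (auto intro!: continuous_on_open_Un open_Un)
    moreover have "G w = sheet J w" if w: "w \<in> half_ring s b1" "w \<in> side s b1" for w
    proof -
      have w1: "s * Im (w / b1) > 0" using w by (simp add: half_ring_def)
      have e: "\<bar>Im (w / b1)\<bar> < aperture b1 * Re (w / b1)" using w by (simp add: side_def wedge_at_def wedge_def)
      have absI: "s * Im v = \<bar>Im v\<bar>" if "s * Im v > 0" for v using that s by auto
      \<comment> \<open>The wedge of \<open>b1\<close> contains no other branch value, so on its
        side \<open>s\<close> every point comes before the ray of \<open>b2\<close>, where
        \<open>G\<close> is still \<open>J\<close>.\<close>
      have "b2 \<noteq> b1" using b2(3) b10 by auto
      then have "\<not> \<bar>Im (b2 / b1)\<bar> < aperture b1 * Re (b2 / b1)" using aperture(2)[OF b1 b2(2)] by simp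
      then have "aperture b1 * Re (b2 / b1) \<le> s * Im (b2 / b1)" using absI[OF b2(3)] by simp
      then have "aperture b1 * c b2 \<le> 1" using b2(3) by (simp add: c_def pos_divide_le_eq)
      moreover have "aperture b1 * c w > 1" using e w1 absI[OF w1] by (simp add: c_def pos_less_divide_eq)
      ultimately have "aperture b1 * c b2 < aperture b1 * c w" by simp
      then have "c b2 < c w" using aperture(1)[OF b1] by simp
      then have "c b2 - c w < 0" by simp
      moreover have "(cmod (b2 / b1))\<^sup>2 > 0" using b10 b20 by simp
      ultimately have "s * Im (w / b2) < 0" unfolding cmp[OF w1 b2(3)] by (rule quot_neg[OF w1 b2(3)])
      then show ?thesis using ext(2)[OF J sideS[OF w(2)]] by (simp add: G_def)
    qed
    ultimately show thesis using that by blast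
  qed
qed

end

section \<open>The bound from a leaf near the centre, and the case analysis over leaves\<close>

context generic_disc_map
begin

text \<open>The lift over \<open>notched_disc\<close> uses the leaf \<open>L\<close> on the upper
  half, which squares to a full turn around the cut. Across the negative axis it passes through the
  cut to \<open>J\<close>, and on the third quadrant it follows the half-turn continuation of
  \<open>J\<close>.\<close>

lemma leaf_bound:
  assumes s: "s = 1 \<or> s = -1" and L: "L \<in> base_fibre" and J: "J \<in> base_fibre"
    and mL: "moved L = {b1}" and small: "cmod b1 < 1/49" and cr: "crossing s b1 L J"
    and nxt: "\<And>b. b \<in> moved J \<Longrightarrow> s * Im (b / b1) > 0 \<Longrightarrow>
      cmod b < 1/49 \<and> (\<exists>J'\<in>base_fibre. crossing s b J J' \<and> moved J' = {b})"
  shows "\<exists>z\<in>ball 0 1. 0.695356 \<le> cmod (deriv B z) * (1 - (cmod z)\<^sup>2)"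
proof -
  have b1: "b1 \<in> branch_values" using mL by (auto simp: moved_def)
  have b10: "b1 \<noteq> 0" "cmod b1 > 0" using branch_values_D(2)[OF b1] by auto
  define u where "u = b1 / of_real (cmod b1)"
  have u: "cmod u = 1" "u \<noteq> 0" using b10 by (auto simp: u_def norm_divide)
  \<comment> \<open>For \<open>s = -1\<close> the picture is mirrored: conjugation lets the same
    \<open>notched_disc\<close> describe a clockwise continuation.\<close>
  define \<kappa> where "\<kappa> = (\<lambda>w. if s = 1 then w else cnj w)"
  have \<kappa>: "Re (\<kappa> w) = Re w" "s * Im (\<kappa> w) = Im w" "cmod (\<kappa> w) = cmod w" for w
    using s by (auto simp: \<kappa>_def)
  have cont_\<kappa>: "continuous_on A (\<lambda>x. \<kappa> (f x))" if "continuous_on A f" for A and f :: "complex \<Rightarrow> complex"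
    using that unfolding \<kappa>_def by (cases "s = 1") (auto intro!: continuous_intros)
  define \<psi> where "\<psi> = (\<lambda>\<zeta>. u * \<kappa> (\<zeta>\<^sup>2))"
  have cont_\<psi>: "continuous_on A \<psi>" for A
    unfolding \<psi>_def by (intro continuous_intros cont_\<kappa>)
  have \<psi>b: "\<psi> \<zeta> / b1 = \<kappa> (\<zeta>\<^sup>2) / of_real (cmod b1)" for \<zeta> using b10 by (simp add: \<psi>_def u_def)
  have Re\<psi>: "Re (\<psi> \<zeta> / b1) = Re (\<zeta>\<^sup>2) / cmod b1" for \<zeta> unfolding \<psi>b Re_divide_of_real \<kappa> ..
  have Im\<psi>: "s * Im (\<psi> \<zeta> / b1) = Im (\<zeta>\<^sup>2) / cmod b1" for \<zeta>
    unfolding \<psi>b Im_divide_of_real times_divide_eq_right \<kappa> ..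
  have cm\<psi>: "cmod (\<psi> \<zeta>) = (cmod \<zeta>)\<^sup>2" for \<zeta> using u by (simp add: \<psi>_def norm_mult \<kappa> norm_power)
  obtain h where h: "lift (inner_wedge b1) h" "\<forall>w\<in>side (- s) b1. h w = sheet L w" "\<forall>w\<in>side s b1. h w = sheet J w"
    using cr unfolding crossing_def by (elim exE conjE)
  obtain G where G: "lift (half_ring s b1) G" "\<And>w. w \<in> half_ring s b1 \<Longrightarrow> w \<in> side s b1 \<Longrightarrow> G w = sheet J w"
    using half_ring_continuation[OF s b1 J nxt] by blast
  define Q1 where "Q1 = notched_disc \<inter> {\<zeta>. Im \<zeta> > 0}"
  define Q2 where "Q2 = notched_disc \<inter> {\<zeta>. Im \<zeta> < 0}"
  \<comment> \<open>A neighbourhood of the negative axis on which \<open>h\<close> is available.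
    There \<open>|\<zeta>| > 1/7\<close>, so the square has modulus above \<open>1/49\<close> and
    lies beyond the tip \<open>b1\<close>.\<close>
  define Q3 where "Q3 = notched_disc \<inter> {\<zeta>. Re \<zeta> < 0} \<inter> {\<zeta>. cmod \<zeta> > 1/7} \<inter> \<psi> -` (inner_wedge b1)"
  have Q1: "\<psi> \<zeta> \<in> xdom L" if \<zeta>: "\<zeta> \<in> Q1" for \<zeta>
  proof -
    have hd: "\<zeta> \<in> half_disc" using \<zeta> by (simp add: Q1_def notched_disc_def half_disc_def)
    have "\<psi> \<zeta> \<notin> ray b1"
    proof
      assume r: "\<psi> \<zeta> \<in> ray b1"
      then have "Im (\<zeta>\<^sup>2) / cmod b1 = 0" unfolding Im\<psi>[symmetric] by (simp add: ray_def)
      moreover have "1 \<le> Re (\<zeta>\<^sup>2) / cmod b1" using r unfolding Re\<psi>[symmetric] by (simp add: ray_def)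
      ultimately have "Im (\<zeta>\<^sup>2) = 0" "cmod b1 \<le> Re (\<zeta>\<^sup>2)" using b10 by (simp_all add: pos_le_divide_eq)
      then show False using half_disc_square[OF hd] b10(2) by linarith
    qed
    moreover have "cmod (\<psi> \<zeta>) < 1" using hd by (simp add: cm\<psi> half_disc_def abs_square_less_1)
    ultimately show ?thesis by (simp add: xdom_def mL)
  qed
  have Q2: "\<psi> \<zeta> \<in> half_ring s b1" if \<zeta>: "\<zeta> \<in> Q2" for \<zeta>
  proof -
    have z: "cmod \<zeta> < 1" "Im \<zeta> < 0" "Re \<zeta> < 0" "1/7 < cmod \<zeta>" using \<zeta> by (auto simp: Q2_def notched_disc_def)
    have "(1/7)\<^sup>2 < (cmod \<zeta>)\<^sup>2" using z(4) by (intro power_strict_mono) auto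
    then have "1/49 < cmod (\<psi> \<zeta>)" by (simp add: cm\<psi> power2_eq_square)
    moreover have "cmod (\<psi> \<zeta>) < 1" using z by (simp add: cm\<psi> abs_square_less_1)
    moreover have "s * Im (\<psi> \<zeta> / b1) > 0"
      unfolding Im\<psi> using z b10 by (simp add: Im_power2 mult_neg_neg)
    ultimately show ?thesis by (simp add: half_ring_def)
  qed
  have cover: "\<zeta> \<in> Q1 \<or> \<zeta> \<in> Q2 \<or> \<zeta> \<in> Q3" if \<zeta>: "\<zeta> \<in> notched_disc" for \<zeta>
  proof (cases "Im \<zeta> = 0")
    case True
    then have z: "cmod \<zeta> < 1" "Re \<zeta> < 0" "1/7 < cmod \<zeta>" using \<zeta> by (auto simp: notched_disc_def)
    have sq: "Re (\<zeta>\<^sup>2) = (cmod \<zeta>)\<^sup>2" "Im (\<zeta>\<^sup>2) = 0" using True by (simp_all add: Re_power2 Im_power2 cmod_power2)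
    define r where "r = (cmod \<zeta>)\<^sup>2 / cmod b1"
    have "(1/7)\<^sup>2 < (cmod \<zeta>)\<^sup>2" using z(3) by (intro power_strict_mono) auto
    then have "cmod b1 < (cmod \<zeta>)\<^sup>2" using small by (simp add: power2_eq_square)
    then have r: "r > 1" using b10 by (simp add: r_def)
    have "s * Im (\<psi> \<zeta> / b1) = 0" unfolding Im\<psi> sq by simp
    then have "Im (\<psi> \<zeta> / b1) = 0" using s by auto
    moreover have "Re (\<psi> \<zeta> / b1) = r" unfolding Re\<psi> sq r_def ..
    ultimately have "\<psi> \<zeta> / b1 = of_real r" by (simp add: complex_eq_iff)
    then have \<psi>r: "\<psi> \<zeta> = of_real r * b1" using b10 by (metis nonzero_divide_eq_eq)
    have "r * cmod b1 < 1" using z b10 by (simp add: r_def abs_square_less_1)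
    then have "\<psi> \<zeta> \<in> inner_wedge b1"
      using wedge_at_real[OF b1, of r] r b10 unfolding \<psi>r by (auto simp: inner_wedge_def coray_def)
    then show ?thesis using \<zeta> z by (simp add: Q3_def)
  qed (use \<zeta> in \<open>auto simp: Q1_def Q2_def\<close>)
  define F where "F = (\<lambda>\<zeta>. if Im \<zeta> > 0 then ext L (\<psi> \<zeta>) else if Im \<zeta> < 0 then G (\<psi> \<zeta>) else h (\<psi> \<zeta>))"
  have F1: "F \<zeta> = ext L (\<psi> \<zeta>)" if "\<zeta> \<in> Q1" for \<zeta> using that by (simp add: F_def Q1_def)
  have F2: "F \<zeta> = G (\<psi> \<zeta>)" if "\<zeta> \<in> Q2" for \<zeta> using that by (simp add: F_def Q2_def)
  have F3: "F \<zeta> = h (\<psi> \<zeta>)" if \<zeta>: "\<zeta> \<in> Q3" for \<zeta>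
  proof -
    have z: "\<zeta> \<in> notched_disc" "Re \<zeta> < 0" "\<psi> \<zeta> \<in> wedge_at b1" using \<zeta> by (auto simp: Q3_def inner_wedge_def)
    consider "Im \<zeta> > 0" | "Im \<zeta> < 0" | "Im \<zeta> = 0" by linarith
    then show ?thesis
    proof cases
      case 1
      have "Im (\<zeta>\<^sup>2) < 0" using 1 z by (simp add: Im_power2 mult_neg_pos)
      then have "s * Im (\<psi> \<zeta> / b1) < 0" unfolding Im\<psi> using b10 by (simp add: divide_neg_pos)
      then have sd: "\<psi> \<zeta> \<in> side (- s) b1" using z by (simp add: side_def)
      then have "\<psi> \<zeta> \<in> star_dom" using side_subset(3)[OF b1] by blast
      then show ?thesis using 1 h(2) sd ext(2)[OF L] by (simp add: F_def)
    next
      case 2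
      then have "\<zeta> \<in> Q2" using z by (simp add: Q2_def)
      then have hr: "\<psi> \<zeta> \<in> half_ring s b1" by (rule Q2)
      then have sd: "\<psi> \<zeta> \<in> side s b1" using z by (simp add: side_def half_ring_def)
      then show ?thesis using 2 G(2)[OF hr] h(3) by (simp add: F_def)
    qed (simp add: F_def)
  qed
  have op: "open Q1" "open Q2" "open Q3"
  proof -
    show "open Q1" "open Q2" unfolding Q1_def Q2_def
      by (intro open_Int open_notched_disc open_halfspace_Im_gt open_halfspace_Im_lt)+
    have "open (\<psi> -` inner_wedge b1)" using open_inner_wedge cont_\<psi>[of UNIV] by (simp add: open_vimage)
    moreover have "open {\<zeta>::complex. cmod \<zeta> > 1/7}" by (intro open_Collect_less continuous_intros)
    ultimately show "open Q3" unfolding Q3_def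
      by (intro open_Int open_notched_disc open_halfspace_Re_lt)
  qed
  have c: "continuous_on Q1 F" "continuous_on Q2 F" "continuous_on Q3 F"
  proof -
    have "continuous_on Q1 (\<lambda>\<zeta>. ext L (\<psi> \<zeta>))"
      by (rule continuous_on_compose2[of "xdom L"]) (use ext(1)[OF L] cont_\<psi> Q1 in \<open>auto simp: lift_def\<close>)
    then show "continuous_on Q1 F" by (simp add: F1 cong: continuous_on_cong)
    have "continuous_on Q2 (\<lambda>\<zeta>. G (\<psi> \<zeta>))"
      by (rule continuous_on_compose2[of "half_ring s b1"]) (use G(1) cont_\<psi> Q2 in \<open>auto simp: lift_def\<close>)
    then show "continuous_on Q2 F" by (simp add: F2 cong: continuous_on_cong)
    have "continuous_on Q3 (\<lambda>\<zeta>. h (\<psi> \<zeta>))"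
      by (rule continuous_on_compose2[of "inner_wedge b1"]) (use h(1) cont_\<psi> in \<open>auto simp: lift_def Q3_def\<close>)
    then show "continuous_on Q3 F" by (simp add: F3 cong: continuous_on_cong)
  qed
  have eqU: "notched_disc = Q1 \<union> (Q2 \<union> Q3)" using cover by (auto simp: Q1_def Q2_def Q3_def)
  have contF: "continuous_on notched_disc F"
    unfolding eqU using op c by (intro continuous_on_open_Un open_Un)
  have fibF: "F \<zeta> \<in> fibre B (\<psi> \<zeta>)" if "\<zeta> \<in> notched_disc" for \<zeta>
    using cover[OF that]
  proof (elim disjE)
    show "F \<zeta> \<in> fibre B (\<psi> \<zeta>)" if "\<zeta> \<in> Q1" using F1[OF that] Q1[OF that] ext(1)[OF L] by (simp add: lift_def)
    show "F \<zeta> \<in> fibre B (\<psi> \<zeta>)" if "\<zeta> \<in> Q2" using F2[OF that] Q2[OF that] G(1) by (simp add: lift_def)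
    show "F \<zeta> \<in> fibre B (\<psi> \<zeta>)" if "\<zeta> \<in> Q3"
    proof -
      have "\<psi> \<zeta> \<in> inner_wedge b1" using that by (simp add: Q3_def)
      then show ?thesis using F3[OF that] h(1) by (simp add: lift_def)
    qed
  qed
  have fin: "finite {t. v * t\<^sup>2 \<in> branch_values}" if "v \<noteq> 0" for v
  proof (rule finite_subset)
    show "finite (\<Union>b\<in>branch_values. {csqrt (b / v), - csqrt (b / v)})" using finite_branch_values by simp
    show "{t. v * t\<^sup>2 \<in> branch_values} \<subseteq> (\<Union>b\<in>branch_values. {csqrt (b / v), - csqrt (b / v)})"
    proof
      fix t assume t: "t \<in> {t. v * t\<^sup>2 \<in> branch_values}"
      define b where "b = v * t\<^sup>2"
      have "t\<^sup>2 = (csqrt (b / v))\<^sup>2" using that by (simp add: b_def)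
      then have "t = csqrt (b / v) \<or> t = - csqrt (b / v)" by (simp only: power2_eq_iff)
      then show "t \<in> (\<Union>b\<in>branch_values. {csqrt (b / v), - csqrt (b / v)})" using t unfolding b_def by blast
    qed
  qed
  show ?thesis
  proof (cases "s = 1")
    case True
    then have \<psi>1: "\<psi> = (\<lambda>\<zeta>. u * \<zeta>\<^sup>2)" by (simp add: \<psi>_def \<kappa>_def)
    have "F holomorphic_on notched_disc"
    proof (rule lift_holomorphic[OF open_notched_disc contF fibF])
      show "\<psi> holomorphic_on notched_disc" unfolding \<psi>1 by (intro holomorphic_intros)
      show "cmod (\<psi> t) < 1" if "t \<in> notched_disc" for t using that by (simp add: cm\<psi> notched_disc_def abs_square_less_1)
      show "finite {t \<in> notched_disc. \<psi> t \<in> branch_values}" unfolding \<psi>1 by (rule finite_subset[OF _ fin[OF u(2)]]) auto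
    qed
    moreover have "cmod (F \<zeta>) < 1" if "\<zeta> \<in> notched_disc" for \<zeta>
      using fibF[OF that] by (simp add: fibre_def)
    moreover have "B (F \<zeta>) = u * \<zeta>\<^sup>2" if "\<zeta> \<in> notched_disc" for \<zeta>
      using fibF[OF that] by (simp add: fibre_def \<psi>1)
    ultimately show ?thesis by (rule Bloch_from_notched_disc_lift[OF holB _ _ u(1)])
  next
    case False
    \<comment> \<open>Now \<psi> is antiholomorphic. Conjugating both \<open>F\<close> and
      \<open>B\<close> restores a holomorphic lift, and the conjugated map
      \<open>cnj \<circ> B \<circ> cnj\<close> has the same weighted derivative at conjugate
      points.\<close>
    then have \<psi>2: "\<psi> = (\<lambda>\<zeta>. u * cnj (\<zeta>\<^sup>2))" by (simp add: \<psi>_def \<kappa>_def)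
    define T where "T = cnj -` notched_disc"
    have T: "t \<in> T \<longleftrightarrow> cnj t \<in> notched_disc" for t by (simp add: T_def)
    have opT: "open T" unfolding T_def by (intro open_vimage open_notched_disc continuous_intros)
    have holFc: "(F \<circ> cnj) holomorphic_on T"
    proof (rule lift_holomorphic[OF opT, where \<psi> = "\<lambda>t. u * t\<^sup>2"])
      show "continuous_on T (F \<circ> cnj)"
      proof (rule continuous_on_compose)
        show "continuous_on (cnj ` T) F" by (rule continuous_on_subset[OF contF]) (auto simp: T_def)
      qed (intro continuous_intros)
      show "(F \<circ> cnj) t \<in> fibre B (u * t\<^sup>2)" if "t \<in> T" for t using fibF[of "cnj t"] that T[of t] by (simp add: \<psi>2)
      show "(\<lambda>t. u * t\<^sup>2) holomorphic_on T" by (intro holomorphic_intros)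
      show "cmod (u * t\<^sup>2) < 1" if "t \<in> T" for t
        using that T[of t] u by (simp add: norm_mult norm_power notched_disc_def abs_square_less_1)
      show "finite {t \<in> T. u * t\<^sup>2 \<in> branch_values}" by (rule finite_subset[OF _ fin[OF u(2)]]) auto
    qed
    have "cnj \<circ> (F \<circ> cnj) \<circ> cnj holomorphic_on notched_disc"
    proof (rule holomorphic_on_compose_cnj_cnj)
      show "F \<circ> cnj holomorphic_on cnj ` notched_disc"
        using holFc unfolding T_def image_cnj_conv_vimage_cnj .
    qed (rule open_notched_disc)
    then have holF': "(cnj \<circ> F) holomorphic_on notched_disc" by (simp add: o_def)
    have "cnj ` ball 0 1 = ball (0::complex) 1" unfolding image_cnj_conv_vimage_cnj by auto
    then have holB': "(cnj \<circ> B \<circ> cnj) holomorphic_on ball 0 1"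
      using holB by (intro holomorphic_on_compose_cnj_cnj open_ball) simp
    have 1: "cmod ((cnj \<circ> F) \<zeta>) < 1" if "\<zeta> \<in> notched_disc" for \<zeta>
      using fibF[OF that] by (simp add: fibre_def)
    have 2: "(cnj \<circ> B \<circ> cnj) ((cnj \<circ> F) \<zeta>) = cnj u * \<zeta>\<^sup>2" if "\<zeta> \<in> notched_disc" for \<zeta>
      using fibF[OF that] by (simp add: fibre_def \<psi>2)
    have "cmod (cnj u) = 1" using u by simp
    from Bloch_from_notched_disc_lift[OF holB' holF' 1 this 2]
    obtain z where z: "z \<in> ball 0 1" "0.695356 \<le> cmod (deriv (cnj \<circ> B \<circ> cnj) z) * (1 - (cmod z)\<^sup>2)" by blast
    have "(B has_field_derivative deriv B (cnj z)) (at (cnj z))"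
      using z(1) by (intro holomorphic_derivI[OF holB open_ball]) auto
    then have "((cnj \<circ> B \<circ> cnj) has_field_derivative cnj (deriv B (cnj z))) (at z)"
      by (rule has_field_derivative_cnj_cnj)
    then have "deriv (cnj \<circ> B \<circ> cnj) z = cnj (deriv B (cnj z))" by (simp add: DERIV_imp_deriv)
    then show ?thesis using z by (intro bexI[of _ "cnj z"]) auto
  qed
qed

lemma deg_1: "z \<in> base_fibre \<Longrightarrow> card {y\<in>branch_fibres. z \<in> moved_at y} = 1 \<Longrightarrow> \<exists>b. moved z = {b}"
  using card_moved by (simp add: card_1_singleton_iff)

theorem generic_bound: "\<exists>z\<in>ball 0 1. 0.695356 \<le> cmod (deriv B z) * (1 - (cmod z)\<^sup>2)"
\<comment> \<open>The first case covers a sheet without cuts, for which \<open>b\<close> is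
  arbitrary, and a leaf with a tip outside the threshold. In the second case all leaves have small
  tips.\<close>
proof (cases "\<exists>z\<in>base_fibre. \<exists>b. moved z \<subseteq> {b} \<and> (b \<in> moved z \<longrightarrow> cmod b \<ge> 1/49)")
  case True
  then obtain z b where zb: "z \<in> base_fibre" "moved z \<subseteq> {b}" "b \<in> moved z \<Longrightarrow> cmod b \<ge> 1/49" by blast
  \<comment> \<open>\<open>b\<close> can be \<open>0\<close> only if the sheet has no cut; any unit
    vector then serves.\<close>
  define u where "u = (if b = 0 then 1 else b / of_real (cmod b))"
  have "cmod u = 1" by (simp add: u_def norm_divide)
  moreover have "b' = of_real (cmod b') * u \<and> cmod b' \<ge> 1/49" if "b' \<in> moved z" for b'
  proof -
    have "b' = b" using zb(2) that by blast
    then show ?thesis using zb(3) that by (auto simp: u_def)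
  qed
  ultimately show ?thesis using outer_slit_bound[OF zb(1)] by blast
next
  case False
  have leaf: "\<exists>b. moved z = {b} \<and> cmod b < 1/49" if "z \<in> base_fibre" "card {y\<in>branch_fibres. z \<in> moved_at y} = 1" for z
    using deg_1[OF that] False that(1) by (metis insertI1 not_le order_refl)
  have HI: "moved_at y \<subseteq> base_fibre" for y by (auto simp: moved_at_def)
  have Hmoved: "B y \<in> moved z" if "z \<in> moved_at y" for z y using that by (simp add: moved_at_def)
  have leafH: "moved z = {B y} \<and> cmod (B y) < 1/49" if z: "z \<in> moved_at y" "card {y\<in>branch_fibres. z \<in> moved_at y} = 1" for z y
  proof -
    have "z \<in> base_fibre" using z(1) HI by blast
    then obtain b where b: "moved z = {b}" "cmod b < 1/49" using leaf z(2) by blast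
    then have "B y = b" using Hmoved[OF z(1)] by simp
    then show ?thesis using b by simp
  qed
  have In: "base_fibre \<noteq> {}" using card_base_fibre n_pos by auto
  show ?thesis
  proof (rule hypergraph_leaf[OF finite_branch_fibres finite_base_fibre HI sum_moved_at In])
    fix z assume z: "z \<in> base_fibre" "\<And>y. y \<in> branch_fibres \<Longrightarrow> z \<notin> moved_at y"
    have "moved z = {}" using moved_at_moved[OF z(1)] z(2) by blast
    then have False using False z(1) by auto
    then show ?thesis ..
  next
    fix y assume y: "y \<in> branch_fibres" "moved_at y \<noteq> {}" "\<And>z. z \<in> moved_at y \<Longrightarrow> card {y\<in>branch_fibres. z \<in> moved_at y} = 1"
    obtain L where L: "L \<in> moved_at y" using y(2) by blast
    \<comment> \<open>Here the neighbour \<open>J\<close> is a leaf too, with the same cut, so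
      either side would do and no further ray is met.\<close>
    obtain J where J: "J \<in> moved_at y" "crossing 1 (B y) L J" using moved_at_crossing[OF _ y(1) L, of 1] by auto
    have mL: "moved L = {B y}" "cmod (B y) < 1/49" using leafH[OF L y(3)[OF L]] by auto
    have mJ: "moved J = {B y}" using leafH[OF J(1) y(3)[OF J(1)]] by auto
    show ?thesis
    proof (rule leaf_bound[OF _ _ _ mL J(2)])
      show "L \<in> base_fibre" "J \<in> base_fibre" using L J HI by blast+
      fix b assume "b \<in> moved J" and Im: "1 * Im (b / B y) > 0"
      then have "b = B y" using mJ by simp
      then have "Im (b / B y) = 0" by (cases "B y = 0") auto
      then show "cmod b < 1/49 \<and> (\<exists>J'\<in>base_fibre. crossing 1 b J J' \<and> moved J' = {b})" using Im by simp
    qed simp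
  next
    fix M y assume M: "M \<in> base_fibre" and y: "y \<in> branch_fibres" "M \<in> moved_at y"
      and lf: "\<And>z. z \<in> moved_at y \<Longrightarrow> z \<noteq> M \<Longrightarrow> card {y\<in>branch_fibres. z \<in> moved_at y} = 1"
      and ex: "card {y'\<in>branch_fibres. M \<in> moved_at y' \<and> (\<exists>z\<in>moved_at y'. z \<noteq> M \<and> card {y\<in>branch_fibres. z \<in> moved_at y} \<noteq> 1)} \<le> 1"
    \<comment> \<open>The hyperedges at which \<open>M\<close> meets another non-leaf. There is at
      most one, and \<open>s\<close> is chosen so that its ray does not lie in the half-turn to be
      traversed.\<close>
    define X where "X = {y'\<in>branch_fibres. M \<in> moved_at y' \<and> (\<exists>z\<in>moved_at y'. z \<noteq> M \<and> card {y\<in>branch_fibres. z \<in> moved_at y} \<noteq> 1)}"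
    have finX: "finite X" using finite_branch_fibres by (simp add: X_def)
    have X1: "y' = y''" if "y' \<in> X" "y'' \<in> X" for y' y''
      using ex that finX card_le_Suc0_iff_eq[of X] by (simp add: X_def)
    obtain s :: real where s: "s = 1 \<or> s = -1" "\<And>y'. y' \<in> X \<Longrightarrow> \<not> s * Im (B y' / B y) > 0"
    proof (cases "X = {}")
      case True
      then show thesis using that[of 1] by simp
    next
      case False
      then obtain y' where y': "y' \<in> X" by blast
      show thesis
      proof (cases "Im (B y' / B y) > 0")
        case True
        show thesis
        proof (rule that[of "-1"])
          fix y'' assume "y'' \<in> X"
          then have "y'' = y'" using X1 y' by blast
          then show "\<not> (-1) * Im (B y'' / B y) > 0" using True by simp
        qed simp
      next
        case False
        show thesis
        proof (rule that[of 1])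
          fix y'' assume "y'' \<in> X"
          then have "y'' = y'" using X1 y' by blast
          then show "\<not> 1 * Im (B y'' / B y) > 0" using False by simp
        qed simp
      qed
    qed
    have ms: "- s = 1 \<or> - s = -1" using s(1) by auto
    \<comment> \<open>The leaf is found by going backwards from \<open>M\<close>, so that crossing
      its cut in direction \<open>s\<close> leads to \<open>M\<close>.\<close>
    obtain L where L: "L \<in> moved_at y" "L \<noteq> M" "crossing (- s) (B y) M L" using moved_at_crossing[OF ms y] by blast
    have crL: "crossing s (B y) L M" using L(3) by (simp add: crossing_uminus)
    have mL: "moved L = {B y}" "cmod (B y) < 1/49" using leafH[OF L(1) lf[OF L(1,2)]] by auto
    show ?thesis
    proof (rule leaf_bound[OF s(1) _ M mL crL])
      show "L \<in> base_fibre" using L HI by blast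
      fix b assume b: "b \<in> moved M" "s * Im (b / B y) > 0"
      obtain y' where y': "y' \<in> branch_fibres" "B y' = b" "M \<in> moved_at y'" using moved_at_moved[OF M b(1)] by blast
      then have "y' \<notin> X" using s(2) b(2) by blast
      then have lf': "\<And>z. z \<in> moved_at y' \<Longrightarrow> z \<noteq> M \<Longrightarrow> card {y\<in>branch_fibres. z \<in> moved_at y} = 1" using y' by (auto simp: X_def)
      obtain J' where J': "J' \<in> moved_at y'" "J' \<noteq> M" "crossing s (B y') M J'" using moved_at_crossing[OF s(1) y'(1,3)] by blast
      have "moved J' = {b}" "cmod b < 1/49" using leafH[OF J'(1) lf'[OF J'(1,2)]] y'(2) by auto
      then show "cmod b < 1/49 \<and> (\<exists>J'\<in>base_fibre. crossing s b M J' \<and> moved J' = {b})"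
        using J' HI y'(2) by blast
    qed
  qed
qed

end

subsection \<open>Reduction to branch values in general position\<close>

definition mob :: "complex \<Rightarrow> complex \<Rightarrow> complex" where
  "mob a w = (w - a) / (1 - cnj a * w)"

lemma mob_denom: assumes "cmod a < 1" "cmod w \<le> 1" shows "1 - cnj a * w \<noteq> 0"
proof
  assume "1 - cnj a * w = 0"
  then have "cmod (cnj a * w) = 1" by (metis norm_one eq_iff_diff_eq_0)
  moreover have "cmod a * cmod w \<le> cmod a * 1" using assms by (intro mult_left_mono) auto
  ultimately show False using assms by (simp add: norm_mult)
qed

lemma mob_less: "cmod a < 1 \<Longrightarrow> cmod w < 1 \<Longrightarrow> cmod (mob a w) < 1"
  using Moebius_function_norm_lt_1[of a w 0] by (simp add: mob_def Moebius_function_simple)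

lemma mob_inverse: "cmod a < 1 \<Longrightarrow> cmod w < 1 \<Longrightarrow> mob (- a) (mob a w) = w"
  using Moebius_function_compose[of "- a" a w] by (simp add: mob_def Moebius_function_simple)

lemma mob_circle: assumes "cmod a < 1" "cmod w = 1" shows "cmod (mob a w) = 1"
proof -
  have "w * cnj w = 1" using assms by (simp add: complex_norm_square[symmetric])
  then have "1 - cnj a * w = w * cnj (w - a)" by (simp add: algebra_simps)
  then have "cmod (1 - cnj a * w) = cmod (w - a)" using assms by (simp add: norm_mult del: complex_cnj_diff)
  moreover have "w - a \<noteq> 0" using assms by auto
  ultimately show ?thesis by (simp add: mob_def norm_divide)
qed

lemma mob_deriv:
  assumes "cmod a < 1" "cmod w \<le> 1"
  shows "(mob a has_field_derivative (of_real (1 - (cmod a)\<^sup>2) / (1 - cnj a * w)\<^sup>2)) (at w)"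
proof -
  note d = mob_denom[OF assms]
  have "((\<lambda>w. w - a) has_field_derivative 1) (at w)" "((\<lambda>w. 1 - cnj a * w) has_field_derivative (- cnj a)) (at w)"
    by (auto intro!: derivative_eq_intros)
  then have "((\<lambda>w. (w - a) / (1 - cnj a * w)) has_field_derivative
      ((1 * (1 - cnj a * w) - (w - a) * (- cnj a)) / ((1 - cnj a * w) * (1 - cnj a * w)))) (at w)"
    by (rule DERIV_divide) (rule d)
  moreover have "1 * (1 - cnj a * w) - (w - a) * (- cnj a) = of_real (1 - (cmod a)\<^sup>2)"
    by (subst of_real_diff, subst complex_norm_square) (simp add: algebra_simps)
  ultimately show ?thesis by (simp only: mob_def[abs_def] power2_eq_square)
qed

lemma fibre_mob:
  assumes a: "cmod a < 1" and v: "cmod v < 1" and into: "\<And>z. cmod z < 1 \<Longrightarrow> cmod (B z) < 1"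
  shows "fibre (\<lambda>z. mob a (B z)) v = fibre B (mob (- a) v)"
proof -
  have "mob a (B z) = v \<longleftrightarrow> B z = mob (- a) v" if "cmod z < 1" for z
    using mob_inverse[OF a into[OF that]] mob_inverse[of "- a" v] a v by auto
  then show ?thesis by (auto simp: fibre_def)
qed

text \<open>In the direction \<open>e\<close> chosen below all points of \<open>branch_values\<close> off the origin have nonzero imaginary part
  after rotation; then the diameter through \<open>e\<close> contains no geodesic spanned by two points of \<open>branch_values\<close>.\<close>

lemma mob_not_collinear:
  fixes c c' :: complex
  assumes c: "cmod c < 1" "cmod c' < 1" "c \<noteq> c'" and im: "Im c = 0 \<Longrightarrow> c = 0" "Im c' = 0 \<Longrightarrow> c' = 0"
  shows "eventually (\<lambda>\<epsilon>::real. Im (mob (of_real \<epsilon>) c' / mob (of_real \<epsilon>) c) \<noteq> 0 \<or> mob (of_real \<epsilon>) c = 0) (at_right 0)"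
proof -
  define x y x' y' where "x = Re c" and "y = Im c" and "x' = Re c'" and "y' = Im c'"
  define A where "A = y' * x - y * x'"
  define C where "C = y' * (1 + (x\<^sup>2 + y\<^sup>2)) - y * (1 + (x'\<^sup>2 + y'\<^sup>2))"
  have key: "(Im (mob (of_real \<epsilon>) c' / mob (of_real \<epsilon>) c) \<noteq> 0 \<or> mob (of_real \<epsilon>) c = 0)"
    if e: "0 < \<epsilon>" "\<epsilon> < 1" and nz: "A * (1 + \<epsilon>\<^sup>2) - \<epsilon> * C \<noteq> 0" for \<epsilon> :: real
  proof (rule ccontr)
    assume "\<not> (Im (mob (of_real \<epsilon>) c' / mob (of_real \<epsilon>) c) \<noteq> 0 \<or> mob (of_real \<epsilon>) c = 0)"
    then have 0: "Im (mob (of_real \<epsilon>) c' / mob (of_real \<epsilon>) c) = 0" "mob (of_real \<epsilon>) c \<noteq> 0" by auto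
    have num: "mob (of_real \<epsilon>) d = (d - of_real \<epsilon>) * (1 - of_real \<epsilon> * cnj d) / of_real ((cmod (1 - of_real \<epsilon> * d))\<^sup>2)" for d
    proof -
      have "mob (of_real \<epsilon>) d = (d - of_real \<epsilon>) * cnj (1 - of_real \<epsilon> * d) / of_real ((cmod (1 - of_real \<epsilon> * d))\<^sup>2)"
        unfolding mob_def complex_cnj_complex_of_real by (rule complex_div_cnj)
      then show ?thesis by simp
    qed
    define k where "k = (cmod (1 - of_real \<epsilon> * c))\<^sup>2"
    define k' where "k' = (cmod (1 - of_real \<epsilon> * c'))\<^sup>2"
    have kk: "k > 0" "k' > 0"
      unfolding k_def k'_def using mob_denom[of "of_real \<epsilon>" c] mob_denom[of "of_real \<epsilon>" c'] e c by auto
    have "Im (mob (of_real \<epsilon>) c' * cnj (mob (of_real \<epsilon>) c)) = 0"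
    proof -
      have "mob (of_real \<epsilon>) c' / mob (of_real \<epsilon>) c = mob (of_real \<epsilon>) c' * cnj (mob (of_real \<epsilon>) c) / of_real ((cmod (mob (of_real \<epsilon>) c))\<^sup>2)"
        by (rule complex_div_cnj)
      then show ?thesis using 0 by (simp only: Im_divide_of_real) simp
    qed
    moreover have "mob (of_real \<epsilon>) c' * cnj (mob (of_real \<epsilon>) c)
      = ((c' - of_real \<epsilon>) * (1 - of_real \<epsilon> * cnj c')) * cnj ((c - of_real \<epsilon>) * (1 - of_real \<epsilon> * cnj c)) / of_real (k' * k)"
      unfolding num k_def[symmetric] k'_def[symmetric] by simp
    ultimately have "Im (((c' - of_real \<epsilon>) * (1 - of_real \<epsilon> * cnj c')) * cnj ((c - of_real \<epsilon>) * (1 - of_real \<epsilon> * cnj c))) / (k' * k) = 0"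
      by (simp only: Im_divide_of_real)
    then have "Im (((c' - of_real \<epsilon>) * (1 - of_real \<epsilon> * cnj c')) * cnj ((c - of_real \<epsilon>) * (1 - of_real \<epsilon> * cnj c))) = 0"
      using kk by simp
    moreover have "Im (p * cnj q) = Im p * Re q - Re p * Im q" for p q by simp
    moreover have "Re ((d - of_real \<epsilon>) * (1 - of_real \<epsilon> * cnj d)) = Re d * (1 + \<epsilon>\<^sup>2) - \<epsilon> * (1 + ((Re d)\<^sup>2 + (Im d)\<^sup>2))"
      "Im ((d - of_real \<epsilon>) * (1 - of_real \<epsilon> * cnj d)) = Im d * (1 - \<epsilon>\<^sup>2)" for d
      by (simp_all add: algebra_simps power2_eq_square)
    ultimately have "y' * (1 - \<epsilon>\<^sup>2) * (x * (1 + \<epsilon>\<^sup>2) - \<epsilon> * (1 + (x\<^sup>2 + y\<^sup>2)))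
        - (x' * (1 + \<epsilon>\<^sup>2) - \<epsilon> * (1 + (x'\<^sup>2 + y'\<^sup>2))) * (y * (1 - \<epsilon>\<^sup>2)) = 0"
      unfolding x_def y_def x'_def y'_def by (simp only:)
    moreover have "y' * (1 - \<epsilon>\<^sup>2) * (x * (1 + \<epsilon>\<^sup>2) - \<epsilon> * (1 + (x\<^sup>2 + y\<^sup>2)))
        - (x' * (1 + \<epsilon>\<^sup>2) - \<epsilon> * (1 + (x'\<^sup>2 + y'\<^sup>2))) * (y * (1 - \<epsilon>\<^sup>2))
        = (1 - \<epsilon>\<^sup>2) * (A * (1 + \<epsilon>\<^sup>2) - \<epsilon> * C)"
      by (simp add: A_def C_def algebra_simps)
    ultimately have "(1 - \<epsilon>\<^sup>2) * (A * (1 + \<epsilon>\<^sup>2) - \<epsilon> * C) = 0" by simp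
    moreover have "1 - \<epsilon>\<^sup>2 \<noteq> 0" using e abs_square_less_1[of \<epsilon>] by simp
    ultimately show False using nz by simp
  qed
  have AC: "A \<noteq> 0 \<or> C \<noteq> 0"
  proof (rule ccontr)
    assume "\<not> (A \<noteq> 0 \<or> C \<noteq> 0)"
    then have A0: "y' * x = y * x'" and C0: "y' * (1 + (x\<^sup>2 + y\<^sup>2)) = y * (1 + (x'\<^sup>2 + y'\<^sup>2))"
      by (auto simp: A_def C_def)
    have pos: "1 + (x\<^sup>2 + y\<^sup>2) > 0" "1 + (x'\<^sup>2 + y'\<^sup>2) > 0" by (simp_all add: add_pos_nonneg)
    have y0: "y \<noteq> 0"
    proof
      assume "y = 0"
      then have "y' = 0" using C0 pos by auto
      then show False using im \<open>y = 0\<close> c(3) by (auto simp: y_def y'_def)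
    qed
    then have "y * (1 + (x'\<^sup>2 + y'\<^sup>2)) \<noteq> 0" using pos by simp
    then have y0': "y' \<noteq> 0" unfolding C0[symmetric] by auto
    have "y' * x * x = y * x' * x" "y * x' * x' = y' * x * x'" using A0 by simp_all
    \<comment> \<open>Given \<open>A = C = 0\<close>, this identity leaves \<open>y = y'\<close>,
      which forces \<open>c = c'\<close>, or a real inner product equal to 1, impossible for two
      points of the open disc.\<close>
    moreover have "(y' - y) * (1 - (x * x' + y * y'))
      = (y' * (1 + (x\<^sup>2 + y\<^sup>2)) - y * (1 + (x'\<^sup>2 + y'\<^sup>2))) - (y' * x * x - y * x' * x) + (y * x' * x' - y' * x * x')"
      by (simp add: algebra_simps power2_eq_square)
    ultimately have "(y' - y) * (1 - (x * x' + y * y')) = 0" using C0 by linarith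
    moreover have "y' \<noteq> y"
    proof
      assume "y' = y"
      then have "x = x'" using A0 y0 by simp
      then show False using \<open>y' = y\<close> c(3) by (simp add: complex_eq_iff x_def x'_def y_def y'_def)
    qed
    ultimately have 1: "x * x' + y * y' = 1" using y0 y0' by simp
    have "x * x' + y * y' = Re (c * cnj c')" by (simp add: x_def x'_def y_def y'_def)
    also have "\<dots> \<le> cmod (c * cnj c')" by (rule complex_Re_le_cmod)
    also have "\<dots> < 1" using c by (metis complex_mod_cnj mult_strict_mono' mult_1 norm_ge_zero norm_mult)
    finally show False using 1 by simp
  qed
  have "eventually (\<lambda>\<epsilon>::real. A * (1 + \<epsilon>\<^sup>2) - \<epsilon> * C \<noteq> 0) (at_right 0)"
  proof (cases "A = 0")
    case True
    then have "C \<noteq> 0" using AC by simp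
    then have "A * (1 + \<epsilon>\<^sup>2) - \<epsilon> * C \<noteq> 0" if "\<epsilon> > 0" for \<epsilon> :: real using True that by simp
    then show ?thesis by (simp add: eventually_at_right_less eventually_at_filter)
  next
    case False
    have "((\<lambda>\<epsilon>::real. A * (1 + \<epsilon>\<^sup>2) - \<epsilon> * C) \<longlongrightarrow> A * (1 + 0\<^sup>2) - 0 * C) (at_right 0)"
      by (intro tendsto_intros)
    then show ?thesis using False by (intro tendsto_imp_eventually_ne) auto
  qed
  moreover have "eventually (\<lambda>\<epsilon>::real. 0 < \<epsilon> \<and> \<epsilon> < 1) (at_right 0)"
    by (intro eventually_conj eventually_at_right_less eventually_at_rightI[of 0 1]) auto
  ultimately show ?thesis by eventually_elim (use key in auto)
qed

context proper_disc_map
begin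

lemma mob_B_deriv:
  assumes "cmod a < 1" "cmod z < 1"
  shows "((\<lambda>z. mob a (B z)) has_field_derivative
      (of_real (1 - (cmod a)\<^sup>2) / (1 - cnj a * B z)\<^sup>2 * deriv B z)) (at z)"
proof -
  have "(B has_field_derivative deriv B z) (at z)"
    using holomorphic_derivI[OF holB open_ball] assms(2) by simp
  then show ?thesis using DERIV_chain2[OF mob_deriv[OF assms(1)]] intoB[OF assms(2)] by simp
qed

text \<open>Fibres are only relabelled: the fibre over \<open>w\<close> becomes the old fibre over
  \<open>mob (- a) w\<close>, and the deficit sum is reindexed along this injection.\<close>

lemma proper_disc_map_mob:
  assumes a: "cmod a < 1" shows "proper_disc_map (\<lambda>z. mob a (B z)) n"
proof
  have fm: "fibre (\<lambda>z. mob a (B z)) w = fibre B (mob (- a) w)" if "cmod w < 1" for w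
    by (rule fibre_mob[OF a that intoB])
  have a': "cmod (- a) < 1" using a by simp
  have m': "cmod (mob (- a) w) < 1" if "cmod w < 1" for w by (rule mob_less[OF a' that])
  note D = mob_B_deriv[OF a]
  show "(\<lambda>z. mob a (B z)) holomorphic_on ball 0 1"
    unfolding holomorphic_on_def field_differentiable_def
    using D has_field_derivative_at_within by (metis mem_ball_0)
  show "continuous_on (cball 0 1) (\<lambda>z. mob a (B z))"
    unfolding mob_def
  proof (intro continuous_intros contB ballI)
    fix z :: complex assume "z \<in> cball 0 1"
    then have "cmod (B z) \<le> 1" using bdryB[of z] intoB[of z] by fastforce
    then show "1 - cnj a * B z \<noteq> 0" by (rule mob_denom[OF a])
  qed
  show "cmod (mob a (B z)) = 1" if "cmod z = 1" for z using mob_circle[OF a bdryB[OF that]] .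
  show "cmod (mob a (B z)) < 1" if "cmod z < 1" for z using mob_less[OF a intoB[OF that]] .
  show "1 \<le> n" by (rule n_pos)
  show "finite (fibre (\<lambda>z. mob a (B z)) w)" "card (fibre (\<lambda>z. mob a (B z)) w) \<le> n" if "cmod w < 1" for w
    using fm[OF that] finite_fibre card_fibre_le m'[OF that] by auto
  show "deriv (\<lambda>z. mob a (B z)) z \<noteq> 0"
    if w: "cmod w < 1" "card (fibre (\<lambda>z. mob a (B z)) w) = n" "z \<in> fibre (\<lambda>z. mob a (B z)) w" for w z
  proof -
    have z: "cmod z < 1" using w(3) by (simp add: fibre_def)
    have nz: "deriv B z \<noteq> 0" using deriv_nz[OF m'[OF w(1)], of z] w fm[OF w(1)] by simp
    have "1 - (cmod a)\<^sup>2 \<noteq> 0" using a abs_square_less_1[of "cmod a"] by simp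
    then have "(of_real (1 - (cmod a)\<^sup>2) :: complex) \<noteq> 0" by (simp only: of_real_eq_0_iff) simp
    moreover have "1 - cnj a * B z \<noteq> 0" using mob_denom[OF a] intoB[OF z] by simp
    ultimately show ?thesis using DERIV_imp_deriv[OF D[OF z]] nz by simp
  qed
  fix W :: "complex set" assume W: "finite W" "W \<subseteq> ball 0 1"
  have inj: "inj_on (mob (- a)) W"
  proof (rule inj_onI)
    fix v w assume vw: "v \<in> W" "w \<in> W" "mob (- a) v = mob (- a) w"
    have "mob a (mob (- a) u) = u" if "u \<in> W" for u
      using mob_inverse[OF a', of u] W(2) that by auto
    then show "v = w" using vw by metis
  qed
  have "(\<Sum>w\<in>W. n - card (fibre (\<lambda>z. mob a (B z)) w)) = (\<Sum>w\<in>W. n - card (fibre B (mob (- a) w)))"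
    using fm W(2) by (intro sum.cong) auto
  also have "\<dots> = (\<Sum>w\<in>mob (- a) ` W. n - card (fibre B w))" using inj by (simp add: sum.reindex)
  also have "\<dots> \<le> n - 1" using W m' by (intro Riemann_Hurwitz) auto
  finally show "(\<Sum>w\<in>W. n - card (fibre (\<lambda>z. mob a (B z)) w)) \<le> n - 1" .
qed

lemma generic_direction:
  obtains e where "cmod e = 1" "\<And>b. b \<in> branch_values \<Longrightarrow> Im (b * cnj e) = 0 \<Longrightarrow> b = 0"
proof -
  define X where "X = (\<Union>b\<in>branch_values. {b / of_real (cmod b), - b / of_real (cmod b)})"
  have "finite X" unfolding X_def using finite_branch_values by simp
  moreover have "infinite (cis ` {0..1::real})"
  proof -
    have "inj_on cis {0..1::real}"
    proof (rule inj_onI)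
      fix s t :: real assume st: "s \<in> {0..1}" "t \<in> {0..1}" "cis s = cis t"
      have "cos s = cos t" using st(3) by (simp add: complex_eq_iff)
      moreover have "(1::real) \<le> pi" using pi_ge_two by linarith
      ultimately show "s = t" using st cos_inj_pi[of s t] by auto
    qed
    then show ?thesis by (simp add: finite_image_iff infinite_Icc)
  qed
  ultimately have "\<not> cis ` {0..1::real} \<subseteq> X" using finite_subset[of "cis ` {0..1::real}" X] by blast
  then obtain e where e: "e \<in> cis ` {0..1::real}" "e \<notin> X" by blast
  have e1: "cmod e = 1" using e(1) by auto
  show thesis
  proof (rule that[OF e1])
    fix b assume b: "b \<in> branch_values" "Im (b * cnj e) = 0"
    show "b = 0"
    proof (rule ccontr)
      assume "b \<noteq> 0"
      define r where "r = Re (b * cnj e)"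
      have be: "b * cnj e = of_real r" using b by (simp add: r_def complex_eq_iff)
      have "e * cnj e = 1" using e1 by (simp add: complex_norm_square[symmetric])
      then have "b = (b * cnj e) * e" by (simp add: mult.assoc mult.commute[of "cnj e"])
      then have br: "b = of_real r * e" unfolding be .
      have cb: "cmod b = \<bar>r\<bar>" unfolding br by (simp add: norm_mult e1)
      have "r \<noteq> 0" using br \<open>b \<noteq> 0\<close> by auto
      then have "e = b / of_real (cmod b) \<or> e = - b / of_real (cmod b)"
        unfolding cb by (cases "r > 0") (simp_all add: br)
      then have "e \<in> X" using b(1) unfolding X_def by blast
      then show False using e(2) by simp
    qed
  qed
qed

text \<open>The derivative of \<open>mob a\<close> at a point of the disc has modulus at most
  \<open>(1 + |a|) / (1 - |a|)\<close>, so passing back to \<open>B\<close> costs only this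
  factor.\<close>

lemma bound_after_shift:
  assumes a: "cmod a < 1" and gen: "generic_disc_map (\<lambda>z. mob a (B z)) n"
  shows "\<exists>z\<in>ball 0 1. 0.695356 * (1 - cmod a) / (1 + cmod a) \<le> cmod (deriv B z) * (1 - (cmod z)\<^sup>2)"
proof -
  obtain z where z: "z \<in> ball 0 1" "0.695356 \<le> cmod (deriv (\<lambda>z. mob a (B z)) z) * (1 - (cmod z)\<^sup>2)"
    using generic_disc_map.generic_bound[OF gen] by blast
  have z1: "cmod z < 1" using z by simp
  have d: "deriv (\<lambda>z. mob a (B z)) z = of_real (1 - (cmod a)\<^sup>2) / (1 - cnj a * B z)\<^sup>2 * deriv B z"
    by (rule DERIV_imp_deriv[OF mob_B_deriv[OF a z1]])
  define q where "q = (1 - (cmod a)\<^sup>2) / (cmod (1 - cnj a * B z))\<^sup>2"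
  have a2: "1 - (cmod a)\<^sup>2 > 0" using a by (simp add: abs_square_less_1)
  then have cd: "cmod (deriv (\<lambda>z. mob a (B z)) z) = q * cmod (deriv B z)"
    unfolding d q_def by (simp add: norm_mult norm_divide norm_power del: of_real_diff)
  have "1 - cmod a \<le> cmod (1 - cnj a * B z)"
  proof -
    have "cmod (cnj a * B z) \<le> cmod a * 1" unfolding norm_mult using intoB[OF z1] by (intro mult_mono) auto
    then show ?thesis using norm_triangle_ineq2[of 1 "cnj a * B z"] by simp
  qed
  then have "(1 - cmod a)\<^sup>2 \<le> (cmod (1 - cnj a * B z))\<^sup>2" using a by (intro power_mono) auto
  then have "q \<le> (1 - (cmod a)\<^sup>2) / (1 - cmod a)\<^sup>2"
    unfolding q_def using a a2 by (intro divide_left_mono mult_pos_pos) (auto intro: less_le_trans[of 0 "(1 - cmod a)\<^sup>2"])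
  also have "\<dots> = (1 + cmod a) / (1 - cmod a)"
  proof -
    have "1 - (cmod a)\<^sup>2 = (1 + cmod a) * (1 - cmod a)" by (simp add: algebra_simps power2_eq_square)
    then show ?thesis using a by (simp add: power2_eq_square)
  qed
  finally have q: "q \<le> (1 + cmod a) / (1 - cmod a)" .
  have "0.695356 \<le> q * (cmod (deriv B z) * (1 - (cmod z)\<^sup>2))" using z(2) unfolding cd by (simp add: mult.assoc)
  also have "\<dots> \<le> (1 + cmod a) / (1 - cmod a) * (cmod (deriv B z) * (1 - (cmod z)\<^sup>2))"
    using q z1 by (intro mult_right_mono mult_nonneg_nonneg) (auto simp: abs_square_le_1)
  finally have main: "0.695356 \<le> (1 + cmod a) / (1 - cmod a) * (cmod (deriv B z) * (1 - (cmod z)\<^sup>2))" .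
  have conv: "c * s / t \<le> x" if "c \<le> t / s * x" "s > 0" "t > 0" for c s t x :: real
    using that by (simp add: field_simps)
  have "0.695356 * (1 - cmod a) / (1 + cmod a) \<le> cmod (deriv B z) * (1 - (cmod z)\<^sup>2)"
    by (rule conv[OF main]) (use a in \<open>auto simp: add_pos_nonneg\<close>)
  then show ?thesis using z(1) by blast
qed

text \<open>Each pair of branch values excludes no small positive \<epsilon>, and there are finitely
  many pairs; rotating by \<open>cnj e\<close> reduces every pair to real shifts.\<close>

lemma generic_shifts:
  obtains e where "cmod e = 1" "eventually (\<lambda>\<epsilon>::real. generic_disc_map (\<lambda>z. mob (of_real \<epsilon> * e) (B z)) n) (at_right 0)"
proof -
  obtain e where e: "cmod e = 1" "\<And>b. b \<in> branch_values \<Longrightarrow> Im (b * cnj e) = 0 \<Longrightarrow> b = 0" using generic_direction by blast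
  have ee: "cnj e * e = 1" using e(1) by (metis complex_norm_square mult.commute of_real_1 power_one)
  have rot: "mob (of_real \<epsilon> * e) b = e * mob (of_real \<epsilon>) (b * cnj e)" for \<epsilon> b
  proof -
    have "b - of_real \<epsilon> * e = e * (b * cnj e - of_real \<epsilon>)" using ee by (simp add: algebra_simps)
    then show ?thesis by (simp add: mob_def mult_ac)
  qed
  have pair: "eventually (\<lambda>\<epsilon>::real. Im (mob (of_real \<epsilon> * e) b' / mob (of_real \<epsilon> * e) b) \<noteq> 0 \<or> mob (of_real \<epsilon> * e) b = 0) (at_right 0)"
    if b: "b \<in> branch_values" "b' \<in> branch_values" "b \<noteq> b'" for b b'
  proof -
    have e0: "e \<noteq> 0" using e(1) by auto
    have "cmod (b * cnj e) < 1" "cmod (b' * cnj e) < 1" using b e(1) by (auto simp: branch_values_def norm_mult)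
    moreover have "b * cnj e \<noteq> b' * cnj e" using b(3) e0 by simp
    moreover have "b * cnj e = 0" if "Im (b * cnj e) = 0" using e(2)[OF b(1) that] by simp
    moreover have "b' * cnj e = 0" if "Im (b' * cnj e) = 0" using e(2)[OF b(2) that] by simp
    ultimately have "eventually (\<lambda>\<epsilon>::real. Im (mob (of_real \<epsilon>) (b' * cnj e) / mob (of_real \<epsilon>) (b * cnj e)) \<noteq> 0 \<or> mob (of_real \<epsilon>) (b * cnj e) = 0) (at_right 0)"
      by (rule mob_not_collinear)
    then show ?thesis unfolding rot using e0 by simp
  qed
  have "eventually (\<lambda>\<epsilon>::real. \<forall>b\<in>branch_values. \<forall>b'\<in>branch_values. b \<noteq> b' \<longrightarrow>
      Im (mob (of_real \<epsilon> * e) b' / mob (of_real \<epsilon> * e) b) \<noteq> 0 \<or> mob (of_real \<epsilon> * e) b = 0) (at_right 0)"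
    using pair finite_branch_values by (intro eventually_ball_finite ballI) (auto simp: eventually_const_iff)
  moreover have "eventually (\<lambda>\<epsilon>::real. 0 < \<epsilon> \<and> \<epsilon> < 1) (at_right 0)"
    by (intro eventually_conj eventually_at_right_less eventually_at_rightI[of 0 1]) auto
  ultimately have "eventually (\<lambda>\<epsilon>::real. generic_disc_map (\<lambda>z. mob (of_real \<epsilon> * e) (B z)) n) (at_right 0)"
  proof eventually_elim
    fix \<epsilon> :: real
    assume cond: "\<forall>b\<in>branch_values. \<forall>b'\<in>branch_values. b \<noteq> b' \<longrightarrow> Im (mob (of_real \<epsilon> * e) b' / mob (of_real \<epsilon> * e) b) \<noteq> 0 \<or> mob (of_real \<epsilon> * e) b = 0"
      and eps: "0 < \<epsilon> \<and> \<epsilon> < 1"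
    define a where "a = of_real \<epsilon> * e"
    have a: "cmod a < 1" "a \<noteq> 0" using eps e(1) by (auto simp: a_def norm_mult)
    then have a': "cmod (- a) < 1" by simp
    interpret F: proper_disc_map "\<lambda>z. mob a (B z)" n by (rule proper_disc_map_mob[OF a(1)])
    \<comment> \<open>The new value \<open>0\<close> is the old value \<open>a\<close>. It lies on
      the diameter through \<open>e\<close>, where only the origin could be a branch value.\<close>
    have aV: "a \<notin> branch_values"
    proof
      assume "a \<in> branch_values"
      moreover have "Im (a * cnj e) = 0" using ee by (simp add: a_def mult.assoc mult.commute[of e])
      ultimately show False using e(2) a(2) by blast
    qed
    have FV: "cmod v < 1" "mob (- a) v \<in> branch_values" "v = mob a (mob (- a) v)" if "v \<in> F.branch_values" for v
    proof -
      show v: "cmod v < 1" using that by (simp add: F.branch_values_def)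
      have "card (fibre B (mob (- a) v)) \<noteq> n" using that fibre_mob[OF a(1) v intoB] by (simp add: F.branch_values_def)
      then show "mob (- a) v \<in> branch_values" using mob_less[OF a' v] by (simp add: branch_values_def)
      show "v = mob a (mob (- a) v)" using mob_inverse[OF a' v] by simp
    qed
    show "generic_disc_map (\<lambda>z. mob (of_real \<epsilon> * e) (B z)) n"
      unfolding a_def[symmetric]
    proof
      show "0 \<notin> F.branch_values"
      proof
        assume "0 \<in> F.branch_values"
        then have "mob (- a) 0 \<in> branch_values" using FV(2) by blast
        then show False using aV by (simp add: mob_def)
      qed
      fix v v' assume v: "v \<in> F.branch_values" "v' \<in> F.branch_values" "Im (v' / v) = 0" "Re (v' / v) > 0"
      show "v' = v"
      proof (rule ccontr)
        assume "v' \<noteq> v"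
        then have "mob (- a) v \<noteq> mob (- a) v'" using FV(3)[OF v(1)] FV(3)[OF v(2)] by metis
        then have "Im (v' / v) \<noteq> 0 \<or> v = 0"
          using cond[folded a_def] FV(2)[OF v(1)] FV(2)[OF v(2)] FV(3)[OF v(1)] FV(3)[OF v(2)] by metis
        then show False using v by auto
      qed
    qed
  qed
  then show thesis using that e(1) by blast
qed

text \<open>The loss factor \<open>(1 - \<epsilon>) / (1 + \<epsilon>)\<close> tends to 1. The
  points found may vary with \<epsilon>, but the supremum dominates all of them.\<close>

theorem Bloch_seminorm_ge: "Bloch_seminorm B \<ge> ereal 0.695356"
proof -
  obtain e where e: "cmod e = 1" "eventually (\<lambda>\<epsilon>::real. generic_disc_map (\<lambda>z. mob (of_real \<epsilon> * e) (B z)) n) (at_right 0)"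
    using generic_shifts by blast
  have "eventually (\<lambda>\<epsilon>::real. 0 < \<epsilon> \<and> \<epsilon> < 1) (at_right 0)"
    by (intro eventually_conj eventually_at_right_less eventually_at_rightI[of 0 1]) auto
  with e(2) have "eventually (\<lambda>\<epsilon>. ereal (0.695356 * (1 - \<epsilon>) / (1 + \<epsilon>)) \<le> Bloch_seminorm B) (at_right 0)"
  proof eventually_elim
    fix \<epsilon> :: real
    assume gen: "generic_disc_map (\<lambda>z. mob (of_real \<epsilon> * e) (B z)) n" and eps: "0 < \<epsilon> \<and> \<epsilon> < 1"
    have c: "cmod (of_real \<epsilon> * e) = \<epsilon>" using eps e(1) by (simp add: norm_mult)
    then obtain z where z: "z \<in> ball 0 1" "0.695356 * (1 - \<epsilon>) / (1 + \<epsilon>) \<le> cmod (deriv B z) * (1 - (cmod z)\<^sup>2)"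
      using bound_after_shift[OF _ gen] eps by auto
    have "ereal (0.695356 * (1 - \<epsilon>) / (1 + \<epsilon>)) \<le> ereal (cmod (deriv B z) * (1 - (cmod z)\<^sup>2))" using z(2) by simp
    also have "\<dots> \<le> Bloch_seminorm B" unfolding Bloch_seminorm_def by (rule SUP_upper[OF z(1)])
    finally show "ereal (0.695356 * (1 - \<epsilon>) / (1 + \<epsilon>)) \<le> Bloch_seminorm B" .
  qed
  moreover have "((\<lambda>\<epsilon>::real. ereal (0.695356 * (1 - \<epsilon>) / (1 + \<epsilon>))) \<longlongrightarrow> ereal (0.695356 * (1 - 0) / (1 + 0))) (at_right 0)"
    by (intro tendsto_intros) auto
  ultimately have "ereal (0.695356 * (1 - 0) / (1 + 0)) \<le> Bloch_seminorm B"
    by (intro tendsto_upperbound[of _ _ "at_right 0"]) auto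
  then show ?thesis by simp
qed

end

subsection \<open>Finite Blaschke products\<close>

lemma sum_order_complex:
  fixes p :: "complex poly"
  assumes "p \<noteq> 0" shows "(\<Sum>z | poly p z = 0. order z p) = degree p"
proof -
  have "degree p = size (proots p)" by (rule size_proots_complex[symmetric])
  also have "\<dots> = (\<Sum>z\<in>set_mset (proots p). count (proots p) z)"
    by (rule size_multiset_overloaded_eq)
  also have "\<dots> = (\<Sum>z | poly p z = 0. order z p)" using assms by (simp add: count_proots)
  finally show ?thesis by simp
qed

text \<open>The conjugate reciprocal polynomial of formal degree \<open>d\<close>; for
  \<open>degree p \<le> d\<close> it reflects nonzero roots in the unit circle.\<close>

definition conj_reflect :: "nat \<Rightarrow> complex poly \<Rightarrow> complex poly" where
  "conj_reflect d p = (\<Sum>i\<le>d. monom (cnj (coeff p i)) (d - i))"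

lemma poly_conj_reflect:
  assumes "degree p \<le> d" "z \<noteq> 0"
  shows "poly (conj_reflect d p) z = z ^ d * cnj (poly p (1 / cnj z))"
proof -
  have p: "poly p x = (\<Sum>i\<le>d. coeff p i * x ^ i)" for x
    unfolding poly_altdef using assms(1) by (intro sum.mono_neutral_left) (auto simp: coeff_eq_0)
  have "poly (conj_reflect d p) z = (\<Sum>i\<le>d. cnj (coeff p i) * z ^ (d - i))"
    by (simp add: conj_reflect_def poly_sum poly_monom)
  also have "\<dots> = (\<Sum>i\<le>d. z ^ d * cnj (coeff p i * (1 / cnj z) ^ i))"
    using assms(2) by (intro sum.cong) (auto simp: power_diff power_divide)
  finally show ?thesis by (simp add: p sum_distrib_left)
qed

lemma degree_conj_reflect: "degree (conj_reflect d p) \<le> d"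
  unfolding conj_reflect_def by (intro degree_sum_le) (auto intro: order_trans[OF degree_monom_le])

lemma poly_eqI_nonzero:
  fixes p q :: "complex poly"
  assumes "\<And>z. z \<noteq> 0 \<Longrightarrow> poly p z = poly q z" shows "p = q"
proof -
  have "[:0, 1:] * p = [:0, 1:] * q" by (rule poly_ext) (use assms in auto)
  then show ?thesis by (simp del: mult_pCons_left)
qed

text \<open>Split off the roots in the disc: if \<open>N = M R\<close>, then self-inversiveness gives \<open>N = M\<^sup>* R\<^sup>*\<close> where
  \<open>M\<^sup>*\<close> has no roots in the disc, so all roots of \<open>M\<close> are roots of \<open>R\<^sup>*\<close>.\<close>

lemma self_inversive_roots_in_disc:
  fixes N :: "complex poly"
  assumes "N \<noteq> 0" and deg: "degree N \<le> 2 * m"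
    and inv: "\<And>z. z \<noteq> 0 \<Longrightarrow> z ^ (2 * m) * cnj (poly N (1 / cnj z)) = poly N z"
  shows "(\<Sum>z | cmod z < 1 \<and> poly N z = 0. order z N) \<le> m"
proof -
  define Z where "Z = {z. cmod z < 1 \<and> poly N z = 0}"
  define Z' where "Z' = {z. \<not> cmod z < 1 \<and> poly N z = 0}"
  have finR: "finite {z. poly N z = 0}" using poly_roots_finite[OF assms(1)] .
  have fin: "finite Z" "finite Z'" using finR by (auto simp: Z_def Z'_def intro: finite_subset)
  define s where "s = (\<Sum>z\<in>Z. order z N)"
  define M where "M = (\<Prod>z\<in>Z. [:- z, 1:] ^ order z N)"
  define R where "R = smult (lead_coeff N) (\<Prod>z\<in>Z'. [:- z, 1:] ^ order z N)"
  have "{z. poly N z = 0} = Z \<union> Z'" "Z \<inter> Z' = {}" by (auto simp: Z_def Z'_def)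
  then have NMR: "N = M * R"
    using complex_poly_decompose[of N] fin by (simp add: M_def R_def prod.union_disjoint)
  have degM: "degree M = s"
    unfolding M_def s_def by (subst degree_prod_eq_sum_degree) (auto simp: degree_power_eq)
  have "M \<noteq> 0" "R \<noteq> 0" using NMR assms(1) by auto
  then have degN: "degree N = s + degree R" using NMR degM by (simp add: degree_mult_eq)
  define M' where "M' = (\<Prod>z\<in>Z. [:1, - cnj z:] ^ order z N)"
  define R' where "R' = conj_reflect (2 * m - s) R"
  have "N = M' * R'"
  proof (rule poly_eqI_nonzero)
    fix z :: complex assume z: "z \<noteq> 0"
    have lin: "z * cnj (1 / cnj z - c) = 1 - cnj c * z" for c using z by (simp add: field_simps)
    have M'z: "poly M' z = z ^ s * cnj (poly M (1 / cnj z))"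
    proof -
      have "poly M' z = (\<Prod>c\<in>Z. (1 - cnj c * z) ^ order c N)"
        by (simp add: M'_def poly_prod mult.commute)
      also have "\<dots> = (\<Prod>c\<in>Z. z ^ order c N * cnj ((1 / cnj z - c) ^ order c N))"
        by (simp only: lin[symmetric] power_mult_distrib complex_cnj_power)
      also have "\<dots> = z ^ s * (\<Prod>c\<in>Z. cnj ((1 / cnj z - c) ^ order c N))"
        by (simp only: prod.distrib s_def power_sum)
      also have "(\<Prod>c\<in>Z. cnj ((1 / cnj z - c) ^ order c N)) = cnj (poly M (1 / cnj z))"
        by (simp add: M_def poly_prod)
      finally show ?thesis .
    qed
    have R'z: "poly R' z = z ^ (2 * m - s) * cnj (poly R (1 / cnj z))"
      unfolding R'_def using z degN deg by (intro poly_conj_reflect) auto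
    have "poly N z = z ^ (2 * m) * cnj (poly N (1 / cnj z))" using inv[OF z] by simp
    also have "z ^ (2 * m) = z ^ s * z ^ (2 * m - s)" using degN deg by (simp flip: power_add)
    also have "cnj (poly N (1 / cnj z)) = cnj (poly M (1 / cnj z)) * cnj (poly R (1 / cnj z))" by (simp add: NMR)
    finally show "poly N z = poly (M' * R') z" by (simp add: M'z R'z)
  qed
  then have nz: "M' * R' \<noteq> 0" using assms(1) by simp
  then have "R' \<noteq> 0" by auto
  have ord: "order c N = order c R'" if c: "c \<in> Z" for c
  proof -
    have "1 - cnj z * c \<noteq> 0" if "z \<in> Z" for z
    proof
      assume "1 - cnj z * c = 0"
      then have "cmod (cnj z * c) = 1" by (metis norm_one eq_iff_diff_eq_0)
      moreover have "cmod z * cmod c < 1" using c that by (metis Z_def mem_Collect_eq mult_strict_mono' norm_ge_zero mult_1)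
      ultimately show False by (simp add: norm_mult)
    qed
    then have "poly M' c \<noteq> 0" using fin by (auto simp: M'_def poly_prod mult.commute)
    then have "order c M' = 0" by (rule order_0I)
    then show ?thesis using \<open>N = M' * R'\<close> order_mult[OF nz, of c] by simp
  qed
  have "s = (\<Sum>c\<in>Z. order c R')" unfolding s_def using ord by simp
  also have "\<dots> \<le> (\<Sum>c | poly R' c = 0. order c R')"
  proof (rule sum_mono2)
    show "finite {c. poly R' c = 0}" using poly_roots_finite[OF \<open>R' \<noteq> 0\<close>] .
    show "Z \<subseteq> {c. poly R' c = 0}"
    proof
      fix c assume c: "c \<in> Z"
      then have "poly N c = 0" by (simp add: Z_def)
      then have "order c N \<noteq> 0" using assms(1) order_root[of N c] by blast
      then have "order c R' \<noteq> 0" using ord[OF c] by simp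
      then have "poly R' c = 0" using order_root[of R' c] by blast
      then show "c \<in> {c. poly R' c = 0}" by simp
    qed
  qed simp
  also have "\<dots> = degree R'" by (rule sum_order_complex[OF \<open>R' \<noteq> 0\<close>])
  \<comment> \<open>\<open>R'\<close> carries all \<open>s\<close> roots of \<open>M\<close> but has
    degree at most \<open>2 m - s\<close>, hence \<open>2 s \<le> 2 m\<close>.\<close>
  also have "\<dots> \<le> 2 * m - s" unfolding R'_def by (rule degree_conj_reflect)
  finally show ?thesis unfolding s_def Z_def by linarith
qed

lemma norm_diff_ge_outside_disc:
  assumes "cmod a < 1" "cmod z \<ge> 1" shows "cmod (1 - cnj a * z) \<le> cmod (z - a)"
proof (rule power2_le_imp_le)
  have "(cmod (z - a))\<^sup>2 - (cmod (1 - cnj a * z))\<^sup>2 = ((cmod z)\<^sup>2 - 1) * (1 - (cmod a)\<^sup>2)"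
    unfolding cmod_power2 by (simp add: algebra_simps power2_eq_square)
  moreover have "(cmod z)\<^sup>2 \<ge> 1" "(cmod a)\<^sup>2 \<le> 1" using assms by (auto simp: abs_square_le_1)
  ultimately show "(cmod (1 - cnj a * z))\<^sup>2 \<le> (cmod (z - a))\<^sup>2"
    by (smt (verit) mult_nonneg_nonneg)
qed simp

locale Blaschke =
  fixes n :: nat and a :: "nat \<Rightarrow> complex"
  assumes n: "n \<ge> 1" and a: "\<And>j. j \<in> {1..n} \<Longrightarrow> cmod (a j) < 1"
begin

definition P :: "complex poly" where "P = (\<Prod>j=1..n. [:- a j, 1:])"
definition Q :: "complex poly" where "Q = (\<Prod>j=1..n. [:1, - cnj (a j):])"
definition f :: "complex \<Rightarrow> complex" where "f z = (\<Prod>j=1..n. (z - a j) / (1 - cnj (a j) * z))"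

lemma poly_P: "poly P z = (\<Prod>j=1..n. z - a j)" and poly_Q: "poly Q z = (\<Prod>j=1..n. 1 - cnj (a j) * z)"
  by (simp_all add: P_def Q_def poly_prod mult.commute)

lemma f_eq: "f z = poly P z / poly Q z"
  by (simp add: f_def poly_P poly_Q prod_dividef)

lemma Q_nz: assumes "cmod z \<le> 1" shows "poly Q z \<noteq> 0"
  using mob_denom[OF a assms] by (simp add: poly_Q)

lemma f_mob: "f z = (\<Prod>j=1..n. mob (a j) z)"
  by (simp add: f_def mob_def)

lemma norm_f_circle: "cmod z = 1 \<Longrightarrow> cmod (f z) = 1"
  using mob_circle[OF a] by (simp add: f_mob flip: prod_norm)

lemma norm_f_less: assumes "cmod z < 1" shows "cmod (f z) < 1"
proof -
  have lt: "cmod (mob (a j) z) < 1" if "j \<in> {1..n}" for j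
    using mob_less[OF a[OF that] assms] .
  have "{1..n} = insert 1 {2..n}" using n by auto
  then have "cmod (f z) = (\<Prod>j\<in>insert 1 {2..n}. cmod (mob (a j) z))"
    unfolding f_mob prod_norm[symmetric] by (simp only:)
  also have "\<dots> = cmod (mob (a 1) z) * (\<Prod>j=2..n. cmod (mob (a j) z))"
    by (rule prod.insert) auto
  also have "\<dots> \<le> cmod (mob (a 1) z) * 1"
    using lt by (intro mult_left_mono prod_le_1) (auto simp: less_imp_le)
  also have "\<dots> < 1" using lt[of 1] n by simp
  finally show ?thesis .
qed

lemma deg_P: "degree P = n" "lead_coeff P = 1"
proof -
  show "degree P = n" unfolding P_def by (subst degree_prod_eq_sum_degree) auto
  show "lead_coeff P = 1" unfolding P_def by (subst lead_coeff_prod) auto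
qed

lemma deg_Q: "degree Q \<le> n"
proof -
  have "degree Q \<le> (\<Sum>j=1..n. degree [:1, - cnj (a j):])" unfolding Q_def by (rule degree_prod_sum_le[unfolded o_def]) auto
  also have "\<dots> \<le> (\<Sum>j=1..n. 1)" by (intro sum_mono) auto
  finally show ?thesis by simp
qed

definition p :: "complex \<Rightarrow> complex poly" where "p w = P - smult w Q"

lemma poly_p: "poly (p w) z = poly P z - w * poly Q z"
  by (simp add: p_def)

text \<open>Outside the open disc \<open>|P| \<ge> |Q|\<close> and \<open>P\<close> has no zero, so
  \<open>P = w Q\<close> is impossible for \<open>|w| < 1\<close>.\<close>

lemma root_p_in_disc: assumes "cmod w < 1" "poly (p w) z = 0" shows "cmod z < 1"
proof (rule ccontr)
  assume z: "\<not> cmod z < 1"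
  have "cmod (poly Q z) \<le> cmod (poly P z)"
    unfolding poly_P poly_Q prod_norm[symmetric] using norm_diff_ge_outside_disc[OF a, of _ z] z by (intro prod_mono) auto
  moreover have "poly P z \<noteq> 0" using a z by (auto simp: poly_P)
  moreover have "cmod (poly P z) = cmod w * cmod (poly Q z)" using assms(2) by (simp add: poly_p norm_mult)
  ultimately show False using assms(1)
    by (metis mult_less_cancel_right2 norm_ge_zero norm_le_zero_iff not_le order_trans mult_eq_0_iff norm_eq_zero less_eq_real_def mult_le_cancel_right1)
qed

text \<open>The coefficient of \<open>z^n\<close> is 1 minus \<open>w\<close> times that of
  \<open>Q\<close>. The latter is zero or a product of factors of modulus at most 1, so no
  cancellation occurs.\<close>

lemma deg_p: assumes "cmod w < 1" shows "degree (p w) = n" "p w \<noteq> 0"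
proof -
  have "coeff (p w) n \<noteq> 0"
  proof (cases "degree Q = n")
    case True
    then have "coeff Q n = lead_coeff Q" by simp
    also have "\<dots> = (\<Prod>j=1..n. lead_coeff [:1, - cnj (a j):])" unfolding Q_def by (rule lead_coeff_prod)
    finally have "cmod (coeff Q n) = (\<Prod>j=1..n. cmod (lead_coeff [:1, - cnj (a j):]))" by (simp only: prod_norm[symmetric])
    also have "\<dots> \<le> 1" by (rule prod_le_1) (use a in \<open>auto simp: less_imp_le\<close>)
    finally have "cmod (coeff Q n) \<le> 1" .
    then have "cmod w * cmod (coeff Q n) \<le> cmod w * 1" by (intro mult_left_mono) auto
    then have "w * coeff Q n \<noteq> 1" using assms by (metis mult.right_neutral norm_mult norm_one not_le)
    then show ?thesis using deg_P by (simp add: p_def)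
  next
    case False
    then have "coeff Q n = 0" using deg_Q by (simp add: coeff_eq_0)
    then show ?thesis using deg_P by (simp add: p_def)
  qed
  moreover have "degree (p w) \<le> n" unfolding p_def
    using deg_P deg_Q by (intro degree_diff_le) (auto intro: order_trans[OF degree_smult_le])
  ultimately show "degree (p w) = n" by (metis le_antisym le_degree)
  show "p w \<noteq> 0" using \<open>coeff (p w) n \<noteq> 0\<close> by auto
qed

lemma fibre_f: assumes "cmod w < 1" shows "fibre f w = {z. poly (p w) z = 0}"
proof -
  have "f z = w \<longleftrightarrow> poly (p w) z = 0" if "cmod z < 1" for z
    using Q_nz[of z] that by (simp add: f_eq poly_p field_simps)
  then show ?thesis using root_p_in_disc[OF assms] by (auto simp: fibre_def)
qed

lemma sum_order_p: assumes "cmod w < 1" shows "(\<Sum>z\<in>fibre f w. order z (p w)) = n"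
  using sum_order_complex[of "p w"] deg_p[OF assms] fibre_f[OF assms] by simp

lemma order_p_pos: assumes "cmod w < 1" "z \<in> fibre f w" shows "order z (p w) \<ge> 1"
  using assms fibre_f[OF assms(1)] deg_p[OF assms(1)] order_root[of "p w" z] by (simp add: Suc_le_eq)

lemma finite_fibre_f: assumes "cmod w < 1" shows "finite (fibre f w)"
  unfolding fibre_f[OF assms] using deg_p[OF assms] by (intro poly_roots_finite) auto

lemma deficit: assumes "cmod w < 1" shows "(\<Sum>z\<in>fibre f w. order z (p w) - 1) + card (fibre f w) = n"
proof -
  have "(\<Sum>z\<in>fibre f w. order z (p w) - 1) + card (fibre f w) = (\<Sum>z\<in>fibre f w. (order z (p w) - 1) + 1)"
    by (simp only: sum.distrib) simp
  also have "\<dots> = (\<Sum>z\<in>fibre f w. order z (p w))"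
  proof (rule sum.cong[OF refl])
    fix z assume "z \<in> fibre f w"
    then show "(order z (p w) - 1) + 1 = order z (p w)" using order_p_pos[OF assms] by fastforce
  qed
  finally show ?thesis using sum_order_p[OF assms] by simp
qed

text \<open>The Wronskian of \<open>P\<close> and \<open>Q\<close>, which is the numerator of the
  derivative of \<open>f\<close> over \<open>Q^2\<close>.\<close>

definition N :: "complex poly" where "N = pderiv P * Q - P * pderiv Q"

text \<open>The Wronskian does not change when a multiple of \<open>Q\<close> is subtracted from
  \<open>P\<close>. Hence multiple roots of every \<open>p w\<close> are roots of one and the same
  polynomial.\<close>

lemma N_p: "N = pderiv (p w) * Q - p w * pderiv Q"
  by (simp add: N_def p_def pderiv_diff pderiv_smult algebra_simps)

text \<open>The logarithmic derivative of the product, cleared of denominators. From this form one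
  reads off the degree, the self-inversiveness and a value that is visibly nonzero.\<close>

lemma N_sum: "N = (\<Sum>j=1..n. smult (1 - a j * cnj (a j)) (\<Prod>i\<in>{1..n}-{j}. [:- a i, 1:] * [:1, - cnj (a i):]))"
proof -
  define p' where "p' = (\<lambda>j. [:- a j, 1:])"
  define q' where "q' = (\<lambda>j. [:1, - cnj (a j):])"
  have dP: "pderiv P = (\<Sum>j=1..n. prod p' ({1..n} - {j}))"
    unfolding P_def p'_def by (simp add: pderiv_prod pderiv_pCons)
  have dQ: "pderiv Q = (\<Sum>j=1..n. prod q' ({1..n} - {j}) * [:- cnj (a j):])"
    unfolding Q_def q'_def by (simp add: pderiv_prod pderiv_pCons)
  have Pj: "P = p' j * prod p' ({1..n} - {j})" "Q = q' j * prod q' ({1..n} - {j})" if "j \<in> {1..n}" for j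
    unfolding P_def Q_def p'_def q'_def using that by (simp_all add: prod.remove)
  have "N = (\<Sum>j=1..n. prod p' ({1..n} - {j}) * Q - P * (prod q' ({1..n} - {j}) * [:- cnj (a j):]))"
    unfolding N_def dP dQ by (simp only: sum_distrib_right sum_distrib_left sum_subtractf)
  also have "\<dots> = (\<Sum>j=1..n. smult (1 - a j * cnj (a j)) (\<Prod>i\<in>{1..n}-{j}. p' i * q' i))"
  proof (rule sum.cong[OF refl])
    fix j assume j: "j \<in> {1..n}"
    have "prod p' ({1..n} - {j}) * Q - P * (prod q' ({1..n} - {j}) * [:- cnj (a j):])
      = (q' j - p' j * [:- cnj (a j):]) * (prod p' ({1..n} - {j}) * prod q' ({1..n} - {j}))"
      by (subst Pj(1)[OF j], subst Pj(2)[OF j]) (simp only: algebra_simps)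
    also have "q' j - p' j * [:- cnj (a j):] = [:1 - a j * cnj (a j):]" by (simp add: p'_def q'_def)
    finally show "prod p' ({1..n} - {j}) * Q - P * (prod q' ({1..n} - {j}) * [:- cnj (a j):])
      = smult (1 - a j * cnj (a j)) (\<Prod>i\<in>{1..n}-{j}. p' i * q' i)" by (simp add: prod.distrib)
  qed
  finally show ?thesis unfolding p'_def q'_def .
qed

lemma poly_N: "poly N z = (\<Sum>j=1..n. (1 - a j * cnj (a j)) * (\<Prod>i\<in>{1..n}-{j}. (z - a i) * (1 - cnj (a i) * z)))"
  unfolding N_sum by (simp add: poly_sum poly_prod mult.commute del: mult_pCons_left mult_pCons_right)

text \<open>At \<open>z = 1\<close> each factor pair equals \<open>|1 - a i|^2\<close>, so the sum
  has positive terms only.\<close>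

lemma N_nz: "N \<noteq> 0"
proof
  assume "N = 0"
  have pos: "1 - (cmod (a j))\<^sup>2 > 0" if "j \<in> {1..n}" for j using a[OF that] by (simp add: abs_square_less_1)
  define S where "S = (\<Sum>j=1..n. (1 - (cmod (a j))\<^sup>2) * (\<Prod>i\<in>{1..n}-{j}. (cmod (1 - a i))\<^sup>2))"
  have e1: "(1 - a i) * (1 - cnj (a i) * 1) = of_real ((cmod (1 - a i))\<^sup>2)" for i
    by (subst complex_norm_square) simp
  have e2: "1 - a j * cnj (a j) = of_real (1 - (cmod (a j))\<^sup>2)" for j
    by (subst of_real_diff, subst complex_norm_square) simp
  have "poly N 1 = of_real S"
    unfolding poly_N S_def e1 e2 of_real_sum of_real_mult of_real_prod ..
  then have "S = 0" unfolding \<open>N = 0\<close> by (metis of_real_eq_0_iff poly_0)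
  moreover have "S > 0"
    unfolding S_def
  proof (rule sum_pos)
    fix j assume j: "j \<in> {1..n}"
    have "(\<Prod>i\<in>{1..n}-{j}. (cmod (1 - a i))\<^sup>2) > 0"
    proof (rule prod_pos)
      fix i assume "i \<in> {1..n} - {j}"
      then have "a i \<noteq> 1" using a[of i] by auto
      then show "0 < (cmod (1 - a i))\<^sup>2" by simp
    qed
    with pos[OF j] show "0 < (1 - (cmod (a j))\<^sup>2) * (\<Prod>i\<in>{1..n}-{j}. (cmod (1 - a i))\<^sup>2)"
      by (rule mult_pos_pos)
  qed (use n in auto)
  ultimately show False by simp
qed

lemma deg_N: "degree N \<le> 2 * (n - 1)"
  unfolding N_sum
proof (intro degree_sum_le)
  fix j assume j: "j \<in> {1..n}"
  have "degree (\<Prod>i\<in>{1..n}-{j}. [:- a i, 1:] * [:1, - cnj (a i):]) \<le> (\<Sum>i\<in>{1..n}-{j}. degree ([:- a i, 1:] * [:1, - cnj (a i):]))"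
    by (rule degree_prod_sum_le[unfolded o_def]) auto
  also have "\<dots> \<le> (\<Sum>i\<in>{1..n}-{j}. 2)"
    by (intro sum_mono order_trans[OF degree_mult_le]) auto
  also have "\<dots> = 2 * (n - 1)" using j by simp
  finally show "degree (smult (1 - a j * cnj (a j)) (\<Prod>i\<in>{1..n}-{j}. [:- a i, 1:] * [:1, - cnj (a i):])) \<le> 2 * (n - 1)"
    using degree_smult_le order_trans by blast
qed auto

text \<open>Each of the \<open>n - 1\<close> factor pairs is self-inversive of degree 2, and the
  coefficients \<open>1 - |a j|^2\<close> are real.\<close>

lemma N_self_inversive:
  assumes "z \<noteq> 0" shows "z ^ (2 * (n - 1)) * cnj (poly N (1 / cnj z)) = poly N z"
proof -
  have fac: "z\<^sup>2 * cnj ((1 / cnj z - c) * (1 - cnj c * (1 / cnj z))) = (z - c) * (1 - cnj c * z)" for c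
    using assms by (simp add: field_simps power2_eq_square)
  have prod_fac: "z ^ (2 * (n - 1)) * (\<Prod>i\<in>{1..n}-{j}. cnj ((1 / cnj z - a i) * (1 - cnj (a i) * (1 / cnj z))))
    = (\<Prod>i\<in>{1..n}-{j}. (z - a i) * (1 - cnj (a i) * z))" if "j \<in> {1..n}" for j
  proof -
    have "card ({1..n} - {j}) = n - 1" using that by simp
    then have "z ^ (2 * (n - 1)) = (\<Prod>i\<in>{1..n}-{j}. z\<^sup>2)" by (simp add: power_mult)
    then show ?thesis by (simp only: fac prod.distrib[symmetric])
  qed
  have "cnj (poly N (1 / cnj z)) = (\<Sum>j=1..n. (1 - a j * cnj (a j)) * (\<Prod>i\<in>{1..n}-{j}. cnj ((1 / cnj z - a i) * (1 - cnj (a i) * (1 / cnj z)))))"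
    unfolding poly_N by (simp only: cnj_sum cnj_prod complex_cnj_mult complex_cnj_diff complex_cnj_one complex_cnj_cnj mult.commute)
  then have "z ^ (2 * (n - 1)) * cnj (poly N (1 / cnj z)) = (\<Sum>j=1..n. (1 - a j * cnj (a j)) *
      (z ^ (2 * (n - 1)) * (\<Prod>i\<in>{1..n}-{j}. cnj ((1 / cnj z - a i) * (1 - cnj (a i) * (1 / cnj z))))))"
    by (simp only: sum_distrib_left mult.left_commute)
  also have "\<dots> = poly N z" unfolding poly_N by (intro sum.cong[OF refl]) (simp only: prod_fac)
  finally show ?thesis .
qed

lemma order_N: assumes "cmod w < 1" "z \<in> fibre f w" shows "order z (p w) - 1 \<le> order z N"
proof -
  have z: "poly (p w) z = 0" using assms fibre_f by auto
  define k where "k = order z (p w) - 1"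
  have k: "order z (p w) = Suc k" using order_p_pos[OF assms] by (simp add: k_def)
  have ok: "order z (pderiv (p w)) = k" using order_pderiv[OF deg_p(2)[OF assms(1)] z] k by simp
  have "[:- z, 1:] ^ k dvd pderiv (p w)" unfolding ok[symmetric] by (rule order_1)
  moreover have "[:- z, 1:] ^ k dvd p w" using order_divides[of z k "p w"] k by simp
  ultimately have "[:- z, 1:] ^ k dvd N" unfolding N_p[of w] by (intro dvd_diff dvd_mult2)
  then show ?thesis using order_divides[of z k N] N_nz by (simp add: k_def)
qed

text \<open>A preimage of order \<open>k\<close> is a zero of \<open>N\<close> of order at least
  \<open>k - 1\<close>, and \<open>N\<close> has at most \<open>n - 1\<close> zeros in the disc,
  counted with multiplicity.\<close>

lemma RH: assumes "finite W" "W \<subseteq> ball 0 1" shows "(\<Sum>w\<in>W. n - card (fibre f w)) \<le> n - 1"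
proof -
  have w1: "cmod w < 1" if "w \<in> W" for w using that assms(2) by auto
  define Z where "Z = {z. cmod z < 1 \<and> poly N z = 0}"
  have finZ: "finite Z" unfolding Z_def using poly_roots_finite[OF N_nz] by (rule rev_finite_subset) auto
  have "(\<Sum>w\<in>W. n - card (fibre f w)) = (\<Sum>w\<in>W. \<Sum>z\<in>fibre f w. order z (p w) - 1)"
  proof (rule sum.cong[OF refl])
    fix w assume "w \<in> W"
    then show "n - card (fibre f w) = (\<Sum>z\<in>fibre f w. order z (p w) - 1)"
      using deficit[OF w1[of w]] by linarith
  qed
  also have "\<dots> \<le> (\<Sum>w\<in>W. \<Sum>z\<in>fibre f w. order z N)"
    by (intro sum_mono order_N w1)
  also have "\<dots> = (\<Sum>z\<in>(\<Union>w\<in>W. fibre f w). order z N)"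
  proof (rule sum.UNION_disjoint[symmetric, OF assms(1)])
    show "\<forall>i\<in>W. finite (fibre f i)" using finite_fibre_f w1 by blast
    show "\<forall>i\<in>W. \<forall>j\<in>W. i \<noteq> j \<longrightarrow> fibre f i \<inter> fibre f j = {}" by (auto simp: fibre_def)
  qed
  also have "\<dots> = (\<Sum>z\<in>(\<Union>w\<in>W. fibre f w) \<inter> Z. order z N)"
  proof (rule sum.mono_neutral_right)
    show "finite (\<Union>w\<in>W. fibre f w)" using finite_fibre_f w1 assms(1) by auto
    show "\<forall>i\<in>(\<Union>w\<in>W. fibre f w) - (\<Union>w\<in>W. fibre f w) \<inter> Z. order i N = 0"
      by (auto simp: Z_def fibre_def intro!: order_0I)
  qed auto
  also have "\<dots> \<le> (\<Sum>z\<in>Z. order z N)" using finZ by (intro sum_mono2) auto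
  also have "\<dots> \<le> n - 1" unfolding Z_def
    by (rule self_inversive_roots_in_disc[OF N_nz deg_N N_self_inversive])
  finally show ?thesis .
qed

lemma f_deriv: assumes "cmod z \<le> 1" shows "(f has_field_derivative (poly N z / (poly Q z)\<^sup>2)) (at z)"
proof -
  have "((\<lambda>z. poly P z / poly Q z) has_field_derivative ((poly (pderiv P) z * poly Q z - poly P z * poly (pderiv Q) z) / (poly Q z * poly Q z))) (at z)"
    by (intro DERIV_divide poly_DERIV Q_nz assms)
  moreover have "(\<lambda>z. poly P z / poly Q z) = f" by (simp add: f_eq fun_eq_iff)
  ultimately show ?thesis by (simp add: N_def power2_eq_square)
qed

sublocale proper_disc_map f n
proof
  show "f holomorphic_on ball 0 1"
    unfolding holomorphic_on_def field_differentiable_def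
    using f_deriv DERIV_subset by (metis has_field_derivative_at_within mem_ball_0 less_imp_le)
  show "continuous_on (cball 0 1) f"
    by (intro continuous_at_imp_continuous_on ballI) (use f_deriv DERIV_isCont in auto)
  fix w assume w: "cmod w < 1"
  show "card (fibre f w) \<le> n" using deficit[OF w] by simp
  fix z assume c: "card (fibre f w) = n" and z: "z \<in> fibre f w"
  \<comment> \<open>A full fibre leaves no room for multiplicities, so every root of
    \<open>p w\<close> is simple and \<open>N\<close> does not vanish there.\<close>
  have "(\<Sum>z\<in>fibre f w. order z (p w) - 1) = 0" using deficit[OF w] c by simp
  then have "order z (p w) - 1 = 0" using finite_fibre_f[OF w] z by simp
  then have o: "order z (p w) = 1" using order_p_pos[OF w z] by simp
  have z1: "cmod z < 1" "poly (p w) z = 0" using z fibre_f[OF w] by (auto simp: fibre_def)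
  have "order z (pderiv (p w)) = 0" using order_pderiv[OF deg_p(2)[OF w] z1(2)] o by simp
  moreover have "pderiv (p w) \<noteq> 0" using deg_p(1)[OF w] n by (auto simp: pderiv_eq_0_iff)
  ultimately have "poly (pderiv (p w)) z \<noteq> 0" using order_root by blast
  then have "poly N z \<noteq> 0" using z1 Q_nz[of z] by (simp add: N_p[of w])
  then show "deriv f z \<noteq> 0" using DERIV_imp_deriv[OF f_deriv[of z]] z1 Q_nz[of z] by simp
qed (use n norm_f_circle norm_f_less finite_fibre_f RH in auto)

end

theorem theorem1:
  shows "(\<exists>r0::real. 0.695356 \<le> r0 \<and> r0 < 0.695357 \<and>
            (\<forall>B. finite_Blaschke_product B \<longrightarrow> Bloch_seminorm B \<ge> ereal r0)) \<and>
         (0.73575 \<le> 2 / exp (1::real) \<and> 2 / exp (1::real) < 0.73576) \<and>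
         (\<forall>k::real. k > 2 / exp 1 \<longrightarrow>
            (\<exists>B. finite_Blaschke_product B \<and> Bloch_seminorm B \<le> ereal k))"
proof (intro conjI allI impI)
  have "Bloch_seminorm B \<ge> ereal 0.695356" if B: "finite_Blaschke_product B" for B
  proof -
    obtain n :: nat and a where n: "n \<ge> 1" and a: "\<forall>j\<in>{1..n}. cmod (a j) < 1"
      and eq: "B = (\<lambda>z. \<Prod>j=1..n. (z - a j) / (1 - cnj (a j) * z))"
      using B unfolding finite_Blaschke_product_def by (elim exE conjE)
    interpret Blaschke n a using n a by unfold_locales auto
    have "B = f" by (simp add: eq f_def fun_eq_iff)
    then show ?thesis using Bloch_seminorm_ge by simp
  qed
  then show "\<exists>r0::real. 0.695356 \<le> r0 \<and> r0 < 0.695357 \<and>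
      (\<forall>B. finite_Blaschke_product B \<longrightarrow> Bloch_seminorm B \<ge> ereal r0)"
    \<comment> \<open>The truncated decimal itself serves as \<open>r0\<close>, since both lift
      estimates reach it.\<close>
    by (intro exI[of _ "0.695356 :: real"]) auto
qed (use two_over_e_bounds Blaschke_upper in auto)

end
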